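(* The Even-Hole-Free-Sandwich-Problem is $\mathsf{NP}$-hard. That is, the following decision problem is $\mathsf{NP}$-hard: given two graphs $G_1, G_2$ on the same vertex set $V$ with $E(G_1)\subseteq E(G_2)$, decide whether there exists a graph $G$ with $V(G)=V$ and $E(G_1)\subseteq E(G)\subseteq E(G_2)$ such that $G$ contains no even hole as an induced subgraph.
   Context: All graphs are finite and simple. A hole is an induced subgraph that is a cycle on $k\geq 4$ vertices; it is an odd hole if $k$ is odd and an even hole if $k$ is even. *)

theory Defs
  imports Main "HOL-Computational_Algebra.Polynomial"
begin

section \<open>Turing machines\<close>

text \<open>
  A machine is a finite set of transitions, possibly nondeterministic, on finitely many two-way
  infinite tapes. States and tape symbols are natural numbers; since the transition set is finite,
  only finitely many of them matter for a given machine. A transition is a tuple (state, symbols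
  read, new state, action on each tape).
\<close>

datatype head_move = Move_Left | Stay | Move_Right

type_synonym tape_action = "nat \<times> head_move"
type_synonym transition = "nat \<times> nat list \<times> nat \<times> tape_action list"
type_synonym tape = "(int \<Rightarrow> nat) \<times> int"
type_synonym config = "nat \<times> tape list"

record tm =
  tm_tapes :: nat
  tm_trans :: "transition set"
  tm_start :: nat
  tm_final :: nat

definition wf_tm :: "tm \<Rightarrow> bool" where
  "wf_tm M \<longleftrightarrow> 0 < tm_tapes M \<and> finite (tm_trans M) \<and>
     (\<forall>(q, rs, q', as) \<in> tm_trans M.
        length rs = tm_tapes M \<and> length as = tm_tapes M \<and> q \<noteq> tm_final M)"

definition deterministic_tm :: "tm \<Rightarrow> bool" where
  "deterministic_tm M \<longleftrightarrow>
     (\<forall>q rs q1 as1 q2 as2. (q, rs, q1, as1) \<in> tm_trans M \<longrightarrow> (q, rs, q2, as2) \<in> tm_trans M \<longrightarrow>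
        q1 = q2 \<and> as1 = as2)"

fun head_offset :: "head_move \<Rightarrow> int" where
  "head_offset Move_Left = -1"
| "head_offset Stay = 0"
| "head_offset Move_Right = 1"

fun read_tape :: "tape \<Rightarrow> nat" where
  "read_tape (c, h) = c h"

fun act_tape :: "tape_action \<Rightarrow> tape \<Rightarrow> tape" where
  "act_tape (w, m) (c, h) = (c(h := w), h + head_offset m)"

inductive tm_step :: "tm \<Rightarrow> config \<Rightarrow> config \<Rightarrow> bool" for M where
  "(q, map read_tape ts, q', as) \<in> tm_trans M \<Longrightarrow> tm_step M (q, ts) (q', map2 act_tape as ts)"

text \<open>Symbol 0 is the blank; the bits 0 and 1 are the symbols 1 and 2.\<close>

definition tape_contents :: "bool list \<Rightarrow> int \<Rightarrow> nat" where
  "tape_contents x i =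
     (if 0 \<le> i \<and> i < int (length x) then (if x ! nat i then 2 else 1) else 0)"

definition initial_config :: "tm \<Rightarrow> bool list \<Rightarrow> config" where
  "initial_config M x =
     (tm_start M, (tape_contents x, 0) # replicate (tm_tapes M - 1) (tape_contents [], 0))"

section \<open>Polynomial time, NP and NP-hardness\<close>

text \<open>Languages are sets of bit strings. The last tape is the output tape.\<close>

definition poly_time_computable :: "(bool list \<Rightarrow> bool list) \<Rightarrow> bool" where
  "poly_time_computable f \<longleftrightarrow>
     (\<exists>M (p :: nat poly). wf_tm M \<and> deterministic_tm M \<and>
        (\<forall>x. \<exists>t \<le> poly p (length x). \<exists>ts h.
           (tm_step M ^^ t) (initial_config M x) (tm_final M, ts) \<and>
           last ts = (tape_contents (f x), h)))"

definition accepts_in :: "tm \<Rightarrow> bool list \<Rightarrow> nat \<Rightarrow> bool" where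
  "accepts_in M x t \<longleftrightarrow> (\<exists>ts. (tm_step M ^^ t) (initial_config M x) (tm_final M, ts))"

text \<open>
  Nondeterministic polynomial time: members have an accepting computation of polynomial length,
  non-members have no accepting computation at all.
\<close>

definition NP :: "bool list set set" where
  "NP = {L. \<exists>M (p :: nat poly). wf_tm M \<and>
     (\<forall>x. (x \<in> L \<longrightarrow> (\<exists>t \<le> poly p (length x). accepts_in M x t)) \<and>
          (x \<notin> L \<longrightarrow> (\<forall>t. \<not> accepts_in M x t)))}"

definition poly_time_reducible :: "bool list set \<Rightarrow> bool list set \<Rightarrow> bool" where
  "poly_time_reducible L L' \<longleftrightarrow>
     (\<exists>f. poly_time_computable f \<and> (\<forall>x. x \<in> L \<longleftrightarrow> f x \<in> L'))"

definition NP_hard :: "bool list set \<Rightarrow> bool" where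
  "NP_hard L' \<longleftrightarrow> (\<forall>L \<in> NP. poly_time_reducible L L')"

section \<open>Graphs and even holes\<close>

definition simple_graph :: "'a set \<Rightarrow> 'a set set \<Rightarrow> bool" where
  "simple_graph V E \<longleftrightarrow> finite V \<and> (\<forall>e \<in> E. e \<subseteq> V \<and> card e = 2)"

definition induced_edges :: "'a set set \<Rightarrow> 'a set \<Rightarrow> 'a set set" where
  "induced_edges E W = {e \<in> E. e \<subseteq> W}"

definition is_cycle :: "'a set \<Rightarrow> 'a set set \<Rightarrow> bool" where
  "is_cycle V E \<longleftrightarrow>
     (\<exists>vs. distinct vs \<and> 3 \<le> length vs \<and> V = set vs \<and>
        E = {{vs ! i, vs ! ((i + 1) mod length vs)} | i. i < length vs})"

definition is_hole :: "'a set \<Rightarrow> 'a set set \<Rightarrow> 'a set \<Rightarrow> bool" where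
  "is_hole V E W \<longleftrightarrow> W \<subseteq> V \<and> is_cycle W (induced_edges E W) \<and> 4 \<le> card W"

definition even_hole_free :: "'a set \<Rightarrow> 'a set set \<Rightarrow> bool" where
  "even_hole_free V E \<longleftrightarrow> (\<nexists>W. is_hole V E W \<and> even (card W))"

section \<open>The sandwich problem\<close>

definition sandwich_instance :: "'a set \<Rightarrow> 'a set set \<Rightarrow> 'a set set \<Rightarrow> bool" where
  "sandwich_instance V E1 E2 \<longleftrightarrow> simple_graph V E1 \<and> simple_graph V E2 \<and> E1 \<subseteq> E2"

definition has_even_hole_free_sandwich :: "'a set \<Rightarrow> 'a set set \<Rightarrow> 'a set set \<Rightarrow> bool" where
  "has_even_hole_free_sandwich V E1 E2 \<longleftrightarrow>
     (\<exists>E. simple_graph V E \<and> E1 \<subseteq> E \<and> E \<subseteq> E2 \<and> even_hole_free V E)"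

text \<open>
  Instances have vertex set \<open>{0..<n}\<close> and are encoded as \<open>n\<close> in unary, followed by the two
  adjacency matrices, row by row.
\<close>

definition adjacency_bits :: "nat \<Rightarrow> nat set set \<Rightarrow> bool list" where
  "adjacency_bits n E = concat (map (\<lambda>i. map (\<lambda>j. {i, j} \<in> E) [0..<n]) [0..<n])"

definition encode_instance :: "nat \<Rightarrow> nat set set \<Rightarrow> nat set set \<Rightarrow> bool list" where
  "encode_instance n E1 E2 =
     replicate n True @ [False] @ adjacency_bits n E1 @ adjacency_bits n E2"

definition Even_Hole_Free_Sandwich_Problem :: "bool list set" where
  "Even_Hole_Free_Sandwich_Problem =
     {encode_instance n E1 E2 | n E1 E2.
        sandwich_instance {0..<n} E1 E2 \<and> has_even_hole_free_sandwich {0..<n} E1 E2}"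

lemma adjacency_bits_inj:
  assumes "adjacency_bits n E = adjacency_bits n F"
    and "simple_graph {0..<n} E" and "simple_graph {0..<n} F"
  shows "E = F"
proof -
  have "map (\<lambda>i. map (\<lambda>j. {i, j} \<in> E) [0..<n]) [0..<n] = map (\<lambda>i. map (\<lambda>j. {i, j} \<in> F) [0..<n]) [0..<n]"
    by (rule concat_injective[OF assms(1)[unfolded adjacency_bits_def]])
      (auto simp: set_zip)
  then have eq: "{i, j} \<in> E \<longleftrightarrow> {i, j} \<in> F" if "i < n" "j < n" for i j
    using that by auto
  have "e \<in> E \<longleftrightarrow> e \<in> F" if "e \<subseteq> {0..<n}" "card e = 2" for e
    using that eq by (auto simp: card_2_iff)
  then show ?thesis
    using assms(2,3) unfolding simple_graph_def by (intro set_eqI) metis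
qed

lemma encode_instance_inj:
  assumes "encode_instance n E1 E2 = encode_instance m F1 F2"
    and "sandwich_instance {0..<n} E1 E2" and "sandwich_instance {0..<m} F1 F2"
  shows "n = m \<and> E1 = F1 \<and> E2 = F2"
proof -
  have "length (takeWhile id (encode_instance n E1 E2)) = n" for n E1 E2
    unfolding encode_instance_def by (subst takeWhile_append2) auto
  with assms(1) have nm: "n = m" by metis
  have len: "length (adjacency_bits k E) = k * k" for k E
    by (simp add: adjacency_bits_def length_concat comp_def sum_list_triv)
  from assms(1) have "adjacency_bits n E1 = adjacency_bits n F1 \<and> adjacency_bits n E2 = adjacency_bits n F2"
    unfolding encode_instance_def nm by (simp add: len)
  with assms(2,3) nm show ?thesis
    unfolding sandwich_instance_def by (metis adjacency_bits_inj)
qed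

lemma encode_instance_in_problem_iff:
  assumes "sandwich_instance {0..<n} E1 E2"
  shows "encode_instance n E1 E2 \<in> Even_Hole_Free_Sandwich_Problem
           \<longleftrightarrow> has_even_hole_free_sandwich {0..<n} E1 E2"
proof
  assume "encode_instance n E1 E2 \<in> Even_Hole_Free_Sandwich_Problem"
  then obtain m F1 F2 where eq: "encode_instance n E1 E2 = encode_instance m F1 F2"
    and inst: "sandwich_instance {0..<m} F1 F2"
    and yes: "has_even_hole_free_sandwich {0..<m} F1 F2"
    unfolding Even_Hole_Free_Sandwich_Problem_def by auto
  from encode_instance_inj[OF eq assms inst] yes
  show "has_even_hole_free_sandwich {0..<n} E1 E2" by simp
next
  assume "has_even_hole_free_sandwich {0..<n} E1 E2"
  with assms show "encode_instance n E1 E2 \<in> Even_Hole_Free_Sandwich_Problem"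
    unfolding Even_Hole_Free_Sandwich_Problem_def by auto
qed

end

theory Submission
  imports Defs
begin

text \<open>
  The reduction goes from an arbitrary language in NP through the satisfiability of a tableau
  formula to the sandwich problem.

  The gadget graph consists of a long path \<open>W 0, W 1, \<dots>\<close> of even length and a clique of \<^emph>\<open>hubs\<close>,
  all adjacent to both ends of the path. A hub may in addition be joined to some vertices at odd
  positions of the path. A hub and a subpath between two consecutive neighbours form a hole whose
  parity is that of their distance, so even-hole-freeness forces every hub to choose exactly one of
  its optional neighbours. The positions are grouped into segments, one for each variable; hubs that
  choose between two consecutive positions, together with vertices \<open>S\<close> creating a 4-cycle as soon as
  two hubs disagree on a position, make the choices in a segment alternate, and the two alternating
  patterns are the truth values. A hub for each clause chooses a position of one of its true literals.

  Conversely, given a satisfying assignment, the non-hubs induce an interval graph. A hole contains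
  at most two hubs, and the remaining vertices form an induced path of this interval graph, whose
  length has the parity that makes the hole odd.

  The reduction is computed by counter programs: the head position of a tape with a single mark is
  a counter, and a program whose counters stay polynomially bounded runs in polynomial time.
\<close>

section \<open>Counter programs and their simulation by Turing machines\<close>

text \<open>Running time has to be bounded for concrete multitape machines, so the instance is built
  to be describable by arithmetic: variables, clauses and vertices are numbers, every number below a
  fixed power of the base \<open>b\<close> is a potential clause, and codes carrying no literal are
  ignored. Adjacency becomes a formula with polynomially bounded quantifiers, and closure of
  computability under bounded sums yields the reduction. A clause hub may have any number of
  options, so the tableau clauses are used at full width, without a detour through 3-SAT.

  The delicate point of the graph is a compared position \<open>g\<close> that no hub chooses. The
  vertices \<open>S g b\<close> keep their forced edges to \<open>W (2 * g + 1)\<close> and to one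
  hub, and still must not create an even hole. Each is then glued to an edge of the path on one side
  of \<open>g\<close> and to the hubs choosing the neighbouring position on the other side, which
  makes both resulting cycles odd. Such hubs must not have \<open>g\<close> as a second option;
  hence no clause may have two adjacent options, that is, contain a variable together with its
  negation.\<close>

type_synonym cstate = "(nat \<Rightarrow> nat) \<times> nat \<times> bool list"

datatype instr = IInc nat | IDec nat | IRight | ILeft | IEmit bool
  | IJmpZ nat nat | IJmpBlank nat | IJmpNotOne nat | IJmp nat

fun inext :: "bool list \<Rightarrow> instr \<Rightarrow> nat \<Rightarrow> cstate \<Rightarrow> nat \<times> cstate" where
  "inext x (IInc r) pc (e, i, w) = (Suc pc, e(r := Suc (e r)), i, w)"
| "inext x (IDec r) pc (e, i, w) = (Suc pc, e(r := e r - 1), i, w)"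
| "inext x IRight pc (e, i, w) = (Suc pc, e, Suc i, w)"
| "inext x ILeft pc (e, i, w) = (Suc pc, e, i - 1, w)"
| "inext x (IEmit b) pc (e, i, w) = (Suc pc, e, i, w @ [b])"
| "inext x (IJmpZ r a) pc (e, i, w) = (if e r = 0 then a else Suc pc, e, i, w)"
| "inext x (IJmpBlank a) pc (e, i, w) = (if length x \<le> i then a else Suc pc, e, i, w)"
| "inext x (IJmpNotOne a) pc (e, i, w) = (if i < length x \<and> x ! i then Suc pc else a, e, i, w)"
| "inext x (IJmp a) pc (e, i, w) = (a, e, i, w)"

text \<open>At 0 a decrement or a left move would take a head to a negative cell, whereas the
  subtraction of \<open>inext\<close> truncates. These conditions keep the two in step.\<close>

fun iok :: "instr \<Rightarrow> cstate \<Rightarrow> bool" where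
  "iok (IDec r) (e, i, w) \<longleftrightarrow> 0 < e r"
| "iok ILeft (e, i, w) \<longleftrightarrow> 0 < i"
| "iok _ _ \<longleftrightarrow> True"

fun iregs :: "instr \<Rightarrow> nat set" where
  "iregs (IInc r) = {r}"
| "iregs (IDec r) = {r}"
| "iregs (IJmpZ r a) = {r}"
| "iregs _ = {}"

definition istep :: "bool list \<Rightarrow> instr list \<Rightarrow> nat \<times> cstate \<Rightarrow> nat \<times> cstate \<Rightarrow> bool" where
  "istep x P c d \<longleftrightarrow> fst c < length P \<and> iok (P ! fst c) (snd c) \<and>
     d = inext x (P ! fst c) (fst c) (snd c)"

text \<open>Counter \<open>r\<close> is the head position on a tape that is blank except for a mark at 0.\<close>

definition counter_tape :: "int \<Rightarrow> nat" where
  "counter_tape i = (if i = 0 then 1 else 0)"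

definition ctapes :: "bool list \<Rightarrow> nat \<Rightarrow> cstate \<Rightarrow> tape list" where
  "ctapes x k s = (case s of (e, i, w) \<Rightarrow>
     (tape_contents x, int i) # map (\<lambda>r. (counter_tape, int (e r))) [0..<k] @
       [(tape_contents w, int (length w))])"

definition keep :: "nat list \<Rightarrow> tape_action list" where
  "keep rs = map (\<lambda>a. (a, Stay)) rs"

fun iact :: "nat \<Rightarrow> instr \<Rightarrow> nat list \<Rightarrow> tape_action list" where
  "iact k (IInc r) rs = (keep rs)[Suc r := (rs ! Suc r, Move_Right)]"
| "iact k (IDec r) rs = (keep rs)[Suc r := (rs ! Suc r, Move_Left)]"
| "iact k IRight rs = (keep rs)[0 := (rs ! 0, Move_Right)]"
| "iact k ILeft rs = (keep rs)[0 := (rs ! 0, Move_Left)]"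
| "iact k (IEmit b) rs = (keep rs)[Suc k := (if b then 2 else 1, Move_Right)]"
| "iact k _ rs = keep rs"

fun igoto :: "instr \<Rightarrow> nat \<Rightarrow> nat list \<Rightarrow> nat" where
  "igoto (IJmpZ r a) pc rs = (if rs ! Suc r = 1 then a else Suc pc)"
| "igoto (IJmpBlank a) pc rs = (if rs ! 0 = 0 then a else Suc pc)"
| "igoto (IJmpNotOne a) pc rs = (if rs ! 0 = 2 then Suc pc else a)"
| "igoto (IJmp a) pc rs = a"
| "igoto _ pc rs = Suc pc"

text \<open>Blank, bits and the counter mark are all among 0, 1, 2, so the transition table can be
  finite.\<close>

definition symbol_vectors :: "nat \<Rightarrow> nat list set" where
  "symbol_vectors k = {rs. set rs \<subseteq> {0, 1, 2} \<and> length rs = k + 2}"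

definition init_act :: "nat \<Rightarrow> nat list \<Rightarrow> tape_action list" where
  "init_act k rs = (rs ! 0, Stay) # replicate k (1, Stay) @ [(0, Stay)]"

text \<open>State 0 sets the marks on the counter tapes; state \<open>pc + 1\<close> stands for the program
  counter \<open>pc\<close>.\<close>

definition machine :: "nat \<Rightarrow> instr list \<Rightarrow> tm" where
  "machine k P = \<lparr>tm_tapes = k + 2,
     tm_trans = (\<lambda>rs. (0, rs, 1, init_act k rs)) ` symbol_vectors k \<union>
       (\<lambda>(pc, rs). (Suc pc, rs, Suc (igoto (P ! pc) pc rs), iact k (P ! pc) rs)) `
         ({..<length P} \<times> symbol_vectors k),
     tm_start = 0, tm_final = Suc (length P)\<rparr>"

lemma finite_symbol_vectors: "finite (symbol_vectors k)"
  unfolding symbol_vectors_def by (intro finite_lists_length_eq) auto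

lemma length_iact: "length (iact k i rs) = length rs"
  by (cases i) (auto simp: keep_def)

lemma wf_machine: "wf_tm (machine k P)"
  unfolding wf_tm_def machine_def using finite_symbol_vectors
  by (auto simp: symbol_vectors_def init_act_def length_iact)

lemma deterministic_machine: "deterministic_tm (machine k P)"
  unfolding deterministic_tm_def machine_def by auto

lemma length_ctapes: "length (ctapes x k s) = k + 2"
  by (auto simp: ctapes_def split: prod.split)

lemma tape_symbols: "tape_contents x i \<in> {0, 1, 2}" "counter_tape i \<in> {0, 1, 2}"
  by (auto simp: tape_contents_def counter_tape_def)

lemma read_ctapes: "map read_tape (ctapes x k s) \<in> symbol_vectors k"
proof -
  obtain e i w where s: "s = (e, i, w)" by (cases s) auto
  show ?thesis
    using tape_symbols(1)[of x "int i"] tape_symbols(1)[of w "int (length w)"] tape_symbols(2)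
    unfolding symbol_vectors_def s ctapes_def by (simp add: image_subset_iff del: insert_iff)
qed

lemma act_keep: "map2 act_tape (keep (map read_tape ts)) ts = ts"
  by (induction ts) (auto simp: keep_def)

lemma act_keep_update:
  "j < length ts \<Longrightarrow>
    map2 act_tape ((keep (map read_tape ts))[j := a]) ts = ts[j := act_tape a (ts ! j)]"
proof -
  assume j: "j < length ts"
  have l: "length (keep (map read_tape ts)) = length ts" by (simp add: keep_def)
  show ?thesis
  proof (rule nth_equalityI)
    fix i assume "i < length (map2 act_tape ((keep (map read_tape ts))[j := a]) ts)"
    then have i: "i < length ts" by (simp add: l)
    have "map2 act_tape (keep (map read_tape ts)) ts ! i = ts ! i" by (simp add: act_keep)
    then have "act_tape (keep (map read_tape ts) ! i) (ts ! i) = ts ! i" using i l by simp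
    then show "map2 act_tape ((keep (map read_tape ts))[j := a]) ts ! i = ts[j := act_tape a (ts ! j)] ! i"
      using i j l by (cases "i = j") auto
  qed (simp add: l)
qed

lemma ctapes_nth:
  "ctapes x k (e, i, w) ! 0 = (tape_contents x, int i)"
  "r < k \<Longrightarrow> ctapes x k (e, i, w) ! Suc r = (counter_tape, int (e r))"
  "ctapes x k (e, i, w) ! Suc k = (tape_contents w, int (length w))"
  by (auto simp: ctapes_def nth_append)

lemma ctapes_update_reg:
  assumes "r < k"
  shows "ctapes x k (e(r := v), i, w) = (ctapes x k (e, i, w))[Suc r := (counter_tape, int v)]"
proof (rule nth_equalityI)
  fix j assume "j < length (ctapes x k (e(r := v), i, w))"
  then have "j = 0 \<or> (\<exists>q<k. j = Suc q) \<or> j = Suc k" by (cases j) (auto simp: length_ctapes)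
  then show "ctapes x k (e(r := v), i, w) ! j = (ctapes x k (e, i, w))[Suc r := (counter_tape, int v)] ! j"
    using assms by (elim disjE exE) (auto simp: ctapes_nth nth_list_update length_ctapes)
qed (simp add: length_ctapes)

lemma ctapes_update_pos:
  "ctapes x k (e, i', w) = (ctapes x k (e, i, w))[0 := (tape_contents x, int i')]"
  by (simp add: ctapes_def)

lemma ctapes_update_out:
  "ctapes x k (e, i, w') = (ctapes x k (e, i, w))[Suc k := (tape_contents w', int (length w'))]"
  by (simp add: ctapes_def list_update_append)

lemma tape_contents_snoc:
  "(tape_contents w)(int (length w) := (if b then 2 else 1)) = tape_contents (w @ [b])"
  by (rule ext) (auto simp: tape_contents_def nth_append)

lemma machine_step:
  assumes "pc < length P" "iok (P ! pc) s" "iregs (P ! pc) \<subseteq> {..<k}"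
    and n: "inext x (P ! pc) pc s = (pc', s')"
  shows "tm_step (machine k P) (Suc pc, ctapes x k s) (Suc pc', ctapes x k s')"
proof -
  obtain e i w where s: "s = (e, i, w)" by (cases s) auto
  let ?ts = "ctapes x k s" and ?rs = "map read_tape (ctapes x k s)"
  have "(Suc pc, ?rs, Suc (igoto (P ! pc) pc ?rs), iact k (P ! pc) ?rs) \<in> tm_trans (machine k P)"
    using assms(1) read_ctapes[of x k s] by (auto simp: machine_def)
  then have "tm_step (machine k P) (Suc pc, ?ts)
      (Suc (igoto (P ! pc) pc ?rs), map2 act_tape (iact k (P ! pc) ?rs) ?ts)"
    by (rule tm_step.intros)
  moreover have "igoto (P ! pc) pc ?rs = pc'"
    using assms n unfolding s
    by (cases "P ! pc")
      (auto simp: ctapes_nth length_ctapes counter_tape_def tape_contents_def split: if_splits)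
  moreover have "map2 act_tape (iact k (P ! pc) ?rs) ?ts = ctapes x k s'"
  proof (cases "P ! pc")
    case (IInc r)
    then have "r < k" using assms by simp
    then show ?thesis using IInc n s
      by (auto simp: act_keep_update length_ctapes ctapes_nth ctapes_update_reg add.commute)
  next
    case (IDec r)
    then have "r < k" "0 < e r" using assms s by auto
    then show ?thesis using IDec n s
      by (auto simp: act_keep_update length_ctapes ctapes_nth ctapes_update_reg of_nat_diff)
  next
    case IRight
    then show ?thesis using n s
      by (auto simp: act_keep_update length_ctapes ctapes_nth ctapes_update_pos[of x k e "Suc i" w i]
          add.commute)
  next
    case ILeft
    then have "0 < i" using assms s by simp
    then obtain i' where i': "i = Suc i'" by (cases i) auto
    show ?thesis using ILeft n s
      by (auto simp: i' act_keep_update length_ctapes ctapes_nth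
          ctapes_update_pos[of x k e i' w "Suc i'"])
  next
    case (IEmit b)
    then show ?thesis using n s tape_contents_snoc[of w b]
      by (auto simp: act_keep_update length_ctapes ctapes_nth
          ctapes_update_out[of x k e i "w @ [b]" w] add.commute)
  qed (use n s in \<open>auto simp: act_keep\<close>)
  ultimately show ?thesis by simp
qed

lemma machine_steps:
  assumes "(istep x P ^^ t) (pc, s) (pc', s')" "\<And>i. i \<in> set P \<Longrightarrow> iregs i \<subseteq> {..<k}"
  shows "(tm_step (machine k P) ^^ t) (Suc pc, ctapes x k s) (Suc pc', ctapes x k s')"
  using assms(1)
proof (induction t arbitrary: pc' s')
  case (Suc t)
  then obtain pc1 s1 where a: "(istep x P ^^ t) (pc, s) (pc1, s1)" "istep x P (pc1, s1) (pc', s')"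
    by auto
  from a(2) have "pc1 < length P" "iok (P ! pc1) s1" "inext x (P ! pc1) pc1 s1 = (pc', s')"
    by (auto simp: istep_def)
  then have "tm_step (machine k P) (Suc pc1, ctapes x k s1) (Suc pc', ctapes x k s')"
    using machine_step[of pc1 P s1 k x pc' s'] assms(2)[of "P ! pc1"] by simp
  then show ?case using Suc.IH[OF a(1)] by auto
qed simp

lemma machine_init:
  "tm_step (machine k P) (initial_config (machine k P) x) (1, ctapes x k (\<lambda>_. 0, 0, []))"
proof -
  let ?ts = "(tape_contents x, 0) # replicate (k + 1) (tape_contents [], 0 :: int)"
  have ic: "initial_config (machine k P) x = (0, ?ts)"
    by (simp add: initial_config_def machine_def)
  have "map read_tape ?ts \<in> symbol_vectors k"
    by (auto simp: symbol_vectors_def tape_contents_def)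
  then have "(0, map read_tape ?ts, 1, init_act k (map read_tape ?ts)) \<in> tm_trans (machine k P)"
    by (auto simp: machine_def)
  then have "tm_step (machine k P) (0, ?ts) (1, map2 act_tape (init_act k (map read_tape ?ts)) ?ts)"
    by (rule tm_step.intros)
  moreover have "map2 act_tape (init_act k (map read_tape ?ts)) ?ts = ctapes x k (\<lambda>_. 0, 0, [])"
  proof -
    have c: "act_tape (Suc 0, Stay) (tape_contents [], 0) = (counter_tape, 0)"
      by (auto simp: tape_contents_def counter_tape_def fun_eq_iff)
    have w: "act_tape (0, Stay) (tape_contents [], 0) = (tape_contents [], 0)"
      by (auto simp: tape_contents_def fun_eq_iff)
    have r: "replicate (k + 1) (tape_contents [], 0 :: int) =
        replicate k (tape_contents [], 0) @ [(tape_contents [], 0)]"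
      by (metis Suc_eq_plus1 replicate_Suc replicate_append_same)
    have i: "act_tape (tape_contents x 0, Stay) (tape_contents x, 0) = (tape_contents x, 0)"
      by simp
    show ?thesis unfolding init_act_def r
      using i by (simp add: c w zip_replicate ctapes_def map_replicate_const del: act_tape.simps)
  qed
  ultimately show ?thesis using ic by simp
qed

section \<open>Structured loop programs and their polynomial cost\<close>

datatype com = Inc nat | DecS nat | InR | InL | Emit bool | EmitReg nat | BitInc nat | Scan nat
  | Skip | Seq com com | Loop nat com

fun compile :: "com \<Rightarrow> nat \<Rightarrow> instr list" where
  "compile (Inc r) n = [IInc r]"
| "compile (DecS r) n = [IJmpZ r (n + 2), IDec r]"
| "compile InR n = [IRight]"
| "compile InL n = [ILeft]"
| "compile (Emit b) n = [IEmit b]"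
| "compile (EmitReg r) n = [IJmpZ r (n + 3), IEmit True, IJmp (n + 4), IEmit False]"
| "compile (BitInc r) n = [IJmpNotOne (n + 2), IInc r]"
| "compile (Scan r) n = [IJmpBlank (n + 4), IRight, IInc r, IJmp n]"
| "compile Skip n = []"
| "compile (Seq a b) n = compile a n @ compile b (n + length (compile a n))"
| "compile (Loop r c) n =
     [IJmpZ r (n + length (compile c (n + 2)) + 3), IDec r] @ compile c (n + 2) @ [IJmp n]"

fun cregs :: "com \<Rightarrow> nat set" where
  "cregs (Inc r) = {r}"
| "cregs (DecS r) = {r}"
| "cregs (EmitReg r) = {r}"
| "cregs (BitInc r) = {r}"
| "cregs (Scan r) = {r}"
| "cregs (Seq a b) = cregs a \<union> cregs b"
| "cregs (Loop r c) = insert r (cregs c)"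
| "cregs _ = {}"

lemma finite_cregs: "finite (cregs c)" by (induction c) auto

lemma iregs_compile: "i \<in> set (compile c n) \<Longrightarrow> iregs i \<subseteq> cregs c"
  by (induction c arbitrary: n) auto

text \<open>Execution with all counters bounded by \<open>B\<close>. A loop consumes its counter, which its body
  must leave alone; this makes the running time polynomial in \<open>B\<close>.\<close>

inductive exec :: "bool list \<Rightarrow> nat \<Rightarrow> com \<Rightarrow> cstate \<Rightarrow> cstate \<Rightarrow> bool" for x B where
  Inc: "e r < B \<Longrightarrow> exec x B (Inc r) (e, i, w) (e(r := Suc (e r)), i, w)"
| DecS: "exec x B (DecS r) (e, i, w) (e(r := e r - 1), i, w)"
| InR: "exec x B InR (e, i, w) (e, Suc i, w)"
| InL: "exec x B InL (e, Suc i, w) (e, i, w)"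
| Emit: "exec x B (Emit b) (e, i, w) (e, i, w @ [b])"
| EmitReg: "exec x B (EmitReg r) (e, i, w) (e, i, w @ [e r \<noteq> 0])"
| BitInc: "e r < B \<Longrightarrow> exec x B (BitInc r) (e, i, w)
    (e(r := (if i < length x \<and> x ! i then Suc (e r) else e r)), i, w)"
| Scan: "i \<le> length x \<Longrightarrow> e r + (length x - i) \<le> B \<Longrightarrow>
    exec x B (Scan r) (e, i, w) (e(r := e r + (length x - i)), length x, w)"
| Skip: "exec x B Skip s s"
| Seq: "exec x B a s s1 \<Longrightarrow> exec x B b s1 s2 \<Longrightarrow> exec x B (Seq a b) s s2"
| Loop0: "e r = 0 \<Longrightarrow> exec x B (Loop r c) (e, i, w) (e, i, w)"
| LoopS: "e r = Suc n \<Longrightarrow> exec x B c (e(r := n), i, w) (e1, i1, w1) \<Longrightarrow> e1 r = n \<Longrightarrow>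
    exec x B (Loop r c) (e1, i1, w1) s2 \<Longrightarrow> exec x B (Loop r c) (e, i, w) s2"

fun cost :: "com \<Rightarrow> nat \<Rightarrow> nat" where
  "cost (Scan r) B = 4 * B + 1"
| "cost (Seq a b) B = cost a B + cost b B"
| "cost (Loop r c) B = B * (cost c B + 3) + 1"
| "cost _ B = 3"

text \<open>A loop is charged by the current value of its counter instead of the bound
  \<open>B\<close>; with the uniform bound the induction over the iterations would not
  close.\<close>

fun cost_at :: "com \<Rightarrow> cstate \<Rightarrow> nat \<Rightarrow> nat" where
  "cost_at (Loop r c) s B = fst s r * (cost c B + 3) + 1"
| "cost_at c s B = cost c B"

lemma cost_at_le: "(\<And>r. fst s r \<le> B) \<Longrightarrow> cost_at c s B \<le> cost c B"
  by (cases c) (auto intro!: mult_le_mono1)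

definition code_at :: "instr list \<Rightarrow> nat \<Rightarrow> instr list \<Rightarrow> bool" where
  "code_at P n cs \<longleftrightarrow> n + length cs \<le> length P \<and> (\<forall>i<length cs. P ! (n + i) = cs ! i)"

lemma code_at_append: "code_at P n (a @ b) \<longleftrightarrow> code_at P n a \<and> code_at P (n + length a) b"
proof -
  have "(\<forall>i<length a + length b. P ! (n + i) = (a @ b) ! i) \<longleftrightarrow>
    (\<forall>i<length a. P ! (n + i) = a ! i) \<and> (\<forall>i<length b. P ! (n + length a + i) = b ! i)"
    (is "?l \<longleftrightarrow> ?r")
  proof
    assume l: ?l
    have "P ! (n + i) = a ! i" if "i < length a" for i
      using l[rule_format, of i] that by (simp add: nth_append)
    moreover have "P ! (n + length a + i) = b ! i" if "i < length b" for i
      using l[rule_format, of "length a + i"] that by (simp add: nth_append add.assoc)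
    ultimately show ?r by blast
  next
    assume r: ?r
    show ?l
    proof (intro allI impI)
      fix i assume i: "i < length a + length b"
      show "P ! (n + i) = (a @ b) ! i"
      proof (cases "i < length a")
        case False
        then have "i - length a < length b" using i by simp
        then have "P ! (n + length a + (i - length a)) = b ! (i - length a)" using r by blast
        then show ?thesis using False by (simp add: nth_append)
      qed (use r in \<open>simp add: nth_append\<close>)
    qed
  qed
  then show ?thesis unfolding code_at_def by auto
qed

lemma code_at_Cons:
  "code_at P n (i # cs) \<longleftrightarrow> n < length P \<and> P ! n = i \<and> code_at P (Suc n) cs"
  using code_at_append[of P n "[i]" cs] unfolding code_at_def by auto

lemma relpowp_add_trans:
  assumes "(R ^^ a) p q" "(R ^^ b) q r"
  shows "(R ^^ (a + b)) p r"
  using assms unfolding relpowp_add by auto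

definition reach :: "bool list \<Rightarrow> instr list \<Rightarrow> nat \<Rightarrow> nat \<times> cstate \<Rightarrow> nat \<times> cstate \<Rightarrow> bool" where
  "reach x P t c d \<longleftrightarrow> (\<exists>t'\<le>t. (istep x P ^^ t') c d)"

lemma reach_refl: "reach x P t c c"
  unfolding reach_def by (intro exI[of _ 0]) simp

lemma reach_trans: "reach x P t c d \<Longrightarrow> reach x P t' d d' \<Longrightarrow> t + t' \<le> u \<Longrightarrow> reach x P u c d'"
  unfolding reach_def by (meson add_mono le_trans relpowp_add_trans)

lemma reach_step:
  assumes "n < length P" "iok (P ! n) s" "inext x (P ! n) n s = c"
  shows "reach x P 1 (n, s) c"
proof -
  have "istep x P (n, s) c" using assms by (simp add: istep_def)
  then have "(istep x P ^^ 1) (n, s) c" by (simp only: relpowp_1)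
  then show ?thesis unfolding reach_def by blast
qed

lemma reach_steps:
  assumes "n < length P" "iok (P ! n) s" "inext x (P ! n) n s = c" "reach x P t c d"
  shows "reach x P (Suc t) (n, s) d"
  by (rule reach_trans[OF reach_step[OF assms(1-3)] assms(4)]) simp

lemma scan_steps:
  assumes c: "code_at P n [IJmpBlank (n + 4), IRight, IInc r, IJmp n]" and "i \<le> length x"
  shows "reach x P (4 * (length x - i) + 1) (n, e, i, w)
    (n + 4, e(r := e r + (length x - i)), length x, w)"
  using assms(2)
proof (induction "length x - i" arbitrary: e i)
  case 0
  then have "i = length x" by simp
  then show ?case using reach_step[of n P "(e, i, w)" x] c by (simp add: code_at_Cons)
next
  case (Suc m)
  then have i: "i < length x" by simp
  let ?e = "e(r := Suc (e r))"
  have cs: "n < length P" "P ! n = IJmpBlank (n + 4)" "Suc n < length P" "P ! Suc n = IRight"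
    "Suc (Suc n) < length P" "P ! Suc (Suc n) = IInc r"
    "Suc (Suc (Suc n)) < length P" "P ! Suc (Suc (Suc n)) = IJmp n"
    using c by (auto simp: code_at_Cons)
  have "reach x P (4 * (length x - Suc i) + 1) (n, ?e, Suc i, w)
      (n + 4, ?e(r := ?e r + (length x - Suc i)), length x, w)"
    by (rule Suc.hyps(1)) (use Suc.hyps(2) i in auto)
  moreover have "?e r + (length x - Suc i) = e r + (length x - i)" using i by simp
  then have "?e(r := ?e r + (length x - Suc i)) = e(r := e r + (length x - i))"
    by (simp only: fun_upd_upd)
  ultimately have r4: "reach x P (4 * (length x - Suc i) + 1) (n, ?e, Suc i, w)
      (n + 4, e(r := e r + (length x - i)), length x, w)"
    by simp
  have "reach x P (Suc (Suc (Suc (Suc (4 * (length x - Suc i) + 1))))) (n, e, i, w)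
      (n + 4, e(r := e r + (length x - i)), length x, w)"
    by (rule reach_steps[of _ _ _ _ "(Suc n, e, i, w)"], use cs i in simp_all,
        rule reach_steps[of _ _ _ _ "(Suc (Suc n), e, Suc i, w)"], use cs i in simp_all,
        rule reach_steps[of _ _ _ _ "(Suc (Suc (Suc n)), ?e, Suc i, w)"], use cs i in simp_all,
        rule reach_steps[of _ _ _ _ "(n, ?e, Suc i, w)"], use cs i r4 in simp_all)
  moreover have "Suc (Suc (Suc (Suc (4 * (length x - Suc i) + 1)))) = 4 * (length x - i) + 1"
    using i by auto
  ultimately show ?case by simp
qed

text \<open>The register bound is carried through the induction because the cost of whatever runs
  next is again measured in \<open>B\<close>.\<close>

lemma exec_steps:
  assumes "exec x B c s s'" "code_at P n (compile c n)" "\<And>r. fst s r \<le> B"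
  shows "reach x P (cost_at c s B) (n, s) (n + length (compile c n), s') \<and> (\<forall>r. fst s' r \<le> B)"
  using assms
proof (induction arbitrary: n rule: exec.induct)
  case (Inc e r i w)
  then have "reach x P 1 (n, e, i, w) (Suc n, e(r := Suc (e r)), i, w)"
    by (intro reach_step) (auto simp: code_at_Cons)
  from reach_trans[OF this reach_refl[of _ _ 0], of 3] show ?case using Inc by auto
next
  case (DecS r e i w)
  have cs: "n < length P" "P ! n = IJmpZ r (n + 2)" "Suc n < length P" "P ! Suc n = IDec r"
    using DecS.prems(1) by (auto simp: code_at_Cons)
  have "reach x P 3 (n, e, i, w) (n + 2, e(r := e r - 1), i, w)"
  proof (cases "e r = 0")
    case True
    then have "reach x P 1 (n, e, i, w) (n + 2, e, i, w)" using cs by (intro reach_step) auto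
    moreover have "e(r := e r - 1) = e" using True by (simp add: fun_upd_idem)
    ultimately show ?thesis using reach_trans[OF _ reach_refl[of _ _ 0], of x P 1 _ _ 3] by simp
  next
    case False
    then have "reach x P 1 (n, e, i, w) (Suc n, e, i, w)" using cs by (intro reach_step) auto
    moreover have "reach x P 1 (Suc n, e, i, w) (n + 2, e(r := e r - 1), i, w)"
      using cs False by (intro reach_step) auto
    ultimately show ?thesis by (rule reach_trans) simp
  qed
  moreover have "e r - 1 \<le> B" using DecS.prems(2)[of r] by simp
  ultimately show ?case using DecS.prems(2) by auto
next
  case (InR e i w)
  then have "reach x P 1 (n, e, i, w) (Suc n, e, Suc i, w)"
    by (intro reach_step) (auto simp: code_at_Cons)
  from reach_trans[OF this reach_refl[of _ _ 0], of 3] show ?case using InR by auto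
next
  case (InL e i w)
  then have "reach x P 1 (n, e, Suc i, w) (Suc n, e, i, w)"
    by (intro reach_step) (auto simp: code_at_Cons)
  from reach_trans[OF this reach_refl[of _ _ 0], of 3] show ?case using InL by auto
next
  case (Emit b e i w)
  then have "reach x P 1 (n, e, i, w) (Suc n, e, i, w @ [b])"
    by (intro reach_step) (auto simp: code_at_Cons)
  from reach_trans[OF this reach_refl[of _ _ 0], of 3] show ?case using Emit by auto
next
  case (EmitReg r e i w)
  let ?w = "w @ [e r \<noteq> 0]"
  have cs: "n < length P" "P ! n = IJmpZ r (n + 3)" "Suc n < length P" "P ! Suc n = IEmit True"
    "Suc (Suc n) < length P" "P ! Suc (Suc n) = IJmp (n + 4)"
    "n + 3 < length P" "P ! (n + 3) = IEmit False"
    using EmitReg.prems(1) by (auto simp: code_at_Cons eval_nat_numeral)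
  have "reach x P 3 (n, e, i, w) (n + 4, e, i, ?w)"
  proof (cases "e r = 0")
    case True
    then have "reach x P 1 (n, e, i, w) (n + 3, e, i, w)" using cs by (intro reach_step) auto
    moreover have "reach x P 1 (n + 3, e, i, w) (n + 4, e, i, ?w)"
      using cs True by (intro reach_step) auto
    ultimately show ?thesis by (rule reach_trans) simp
  next
    case False
    then have "reach x P 1 (n, e, i, w) (Suc n, e, i, w)" using cs by (intro reach_step) auto
    moreover have "reach x P 1 (Suc n, e, i, w) (Suc (Suc n), e, i, ?w)"
      using cs False by (intro reach_step) auto
    ultimately have "reach x P 2 (n, e, i, w) (Suc (Suc n), e, i, ?w)" by (rule reach_trans) simp
    moreover have "reach x P 1 (Suc (Suc n), e, i, ?w) (n + 4, e, i, ?w)"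
      using cs by (intro reach_step) auto
    ultimately show ?thesis by (rule reach_trans) simp
  qed
  moreover have "n + length (compile (EmitReg r) n) = n + 4" "cost_at (EmitReg r) (e, i, w) B = 3" by simp_all
  ultimately show ?case using EmitReg.prems(2) by (simp only: fst_conv) simp
next
  case (BitInc e r i w)
  have cs: "n < length P" "P ! n = IJmpNotOne (n + 2)" "Suc n < length P" "P ! Suc n = IInc r"
    using BitInc.prems(1) by (auto simp: code_at_Cons)
  let ?e = "e(r := (if i < length x \<and> x ! i then Suc (e r) else e r))"
  have "reach x P 3 (n, e, i, w) (n + 2, ?e, i, w)"
  proof (cases "i < length x \<and> x ! i")
    case False
    then have "reach x P 1 (n, e, i, w) (n + 2, e, i, w)" using cs by (intro reach_step) auto
    moreover have "?e = e" using False by (simp add: fun_upd_idem)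
    ultimately show ?thesis using reach_trans[OF _ reach_refl[of _ _ 0], of x P 1 _ _ 3] by simp
  next
    case True
    then have "reach x P 1 (n, e, i, w) (Suc n, e, i, w)" using cs by (intro reach_step) auto
    moreover have "reach x P 1 (Suc n, e, i, w) (n + 2, ?e, i, w)"
      using cs True by (intro reach_step) auto
    ultimately show ?thesis by (rule reach_trans) simp
  qed
  then show ?case using BitInc by auto
next
  case (Scan i e r w)
  then have c: "code_at P n [IJmpBlank (n + 4), IRight, IInc r, IJmp n]" by simp
  have "4 * (length x - i) + 1 \<le> 4 * B + 1" using Scan by simp
  with reach_trans[OF scan_steps[OF c Scan(1), of e w] reach_refl[of _ _ 0]]
  have "reach x P (4 * B + 1) (n, e, i, w) (n + 4, e(r := e r + (length x - i)), length x, w)"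
    by simp
  moreover have "n + length (compile (Scan r) n) = n + 4" "cost_at (Scan r) (e, i, w) B = 4 * B + 1"
    by simp_all
  moreover have "fst (e(r := e r + (length x - i)), length x, w) r' \<le> B" for r'
    using Scan.prems(2)[of r'] Scan(2) by simp
  ultimately show ?case by metis
next
  case (Skip s)
  then show ?case using reach_refl by simp
next
  case (Seq a s s1 b s2)
  let ?m = "n + length (compile a n)"
  have "code_at P n (compile a n)" and cb: "code_at P ?m (compile b ?m)"
    using Seq.prems(1) by (auto simp: code_at_append)
  with Seq.IH(1) Seq.prems(2) have t1: "reach x P (cost_at a s B) (n, s) (?m, s1)"
    and r1: "\<And>r. fst s1 r \<le> B" by blast+
  from Seq.IH(2)[OF cb r1] have
    t2: "reach x P (cost_at b s1 B) (?m, s1) (?m + length (compile b ?m), s2)"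
    and r2: "\<forall>r. fst s2 r \<le> B" by blast+
  have "cost_at a s B \<le> cost a B" by (rule cost_at_le) (rule Seq.prems(2))
  moreover have "cost_at b s1 B \<le> cost b B" by (rule cost_at_le) (rule r1)
  ultimately have "cost_at a s B + cost_at b s1 B \<le> cost a B + cost b B" by simp
  from reach_trans[OF t1 t2 this] show ?case using r2 by (simp add: add.assoc)
next
  case (Loop0 e r c i w)
  then have "reach x P 1 (n, e, i, w) (n + length (compile c (n + 2)) + 3, e, i, w)"
    by (intro reach_step) (auto simp: code_at_Cons)
  moreover have "n + length (compile (Loop r c) n) = n + length (compile c (n + 2)) + 3"
    "cost_at (Loop r c) (e, i, w) B = 1" using Loop0.hyps by simp_all
  ultimately show ?case using Loop0.prems(2) by metis
next
  case (LoopS e r m c i w e1 i1 w1 s2)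
  let ?cs = "compile c (n + 2)"
  let ?q = "n + 2 + length ?cs"
  have at: "n < length P" "P ! n = IJmpZ r (n + length ?cs + 3)" "Suc n < length P" "P ! Suc n = IDec r"
    "code_at P (n + 2) ?cs" "?q < length P" "P ! ?q = IJmp n"
    using LoopS.prems(1) by (auto simp: code_at_Cons code_at_append)
  have b: "fst (e(r := m), i, w) r' \<le> B" for r'
    using LoopS.prems(2)[of r'] LoopS.prems(2)[of r] LoopS.hyps(1) by simp
  from LoopS.IH(1)[OF at(5) b] have
    t1: "reach x P (cost_at c (e(r := m), i, w) B) (n + 2, e(r := m), i, w) (?q, e1, i1, w1)"
    and r1: "\<And>r. fst (e1, i1, w1) r \<le> B" by blast+
  from LoopS.IH(2)[OF LoopS.prems(1) r1] have
    t2: "reach x P (m * (cost c B + 3) + 1) (n, e1, i1, w1) (n + length (compile (Loop r c) n), s2)"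
    and r2: "\<forall>r. fst s2 r \<le> B" using LoopS.hyps by auto
  have c1: "cost_at c (e(r := m), i, w) B \<le> cost c B" by (rule cost_at_le) (rule b)
  have "reach x P 1 (n, e, i, w) (Suc n, e, i, w)"
    using at LoopS.hyps(1) by (intro reach_step) auto
  moreover have "reach x P 1 (Suc n, e, i, w) (n + 2, e(r := m), i, w)"
    using at LoopS.hyps(1) by (intro reach_step) auto
  ultimately have "reach x P 2 (n, e, i, w) (n + 2, e(r := m), i, w)" by (rule reach_trans) simp
  from this t1 have "reach x P (2 + cost c B) (n, e, i, w) (?q, e1, i1, w1)"
    by (rule reach_trans) (use c1 in simp)
  moreover have "reach x P 1 (?q, e1, i1, w1) (n, e1, i1, w1)"
    using at by (intro reach_step) auto
  ultimately have "reach x P (3 + cost c B) (n, e, i, w) (n, e1, i1, w1)" by (rule reach_trans) simp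
  from this t2 have "reach x P (Suc m * (cost c B + 3) + 1) (n, e, i, w)
      (n + length (compile (Loop r c) n), s2)"
    by (rule reach_trans) simp
  then show ?case using r2 LoopS.hyps(1) by simp
qed

lemma cost_poly: "\<exists>q :: nat poly. \<forall>B. cost c B = poly q B"
proof (induction c)
  case (Scan r)
  have "cost (Scan r) B = poly [:1, 4:] B" for B by simp
  then show ?case by blast
next
  case (Seq a b)
  then obtain p q where "\<And>B. cost a B = poly p B" "\<And>B. cost b B = poly q B" by auto
  then have "cost (Seq a b) B = poly (p + q) B" for B by simp
  then show ?case by blast
next
  case (Loop r c)
  then obtain p where "\<And>B. cost c B = poly p B" by auto
  then have "cost (Loop r c) B = poly ([:0, 1:] * (p + [:3:]) + 1) B" for B by simp
  then show ?case by blast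
qed (auto intro: exI[of _ "[:3:]"])

theorem poly_time_computable_exec:
  fixes p :: "nat poly"
  assumes "\<And>x. \<exists>e i. exec x (poly p (length x)) c (\<lambda>_. 0, 0, []) (e, i, f x)"
  shows "poly_time_computable f"
proof -
  define k where "k = Suc (Max (insert 0 (cregs c)))"
  have k: "cregs c \<subseteq> {..<k}"
  proof
    fix r assume "r \<in> cregs c"
    then have "r \<le> Max (insert 0 (cregs c))" using finite_cregs by (intro Max_ge) auto
    then show "r \<in> {..<k}" by (simp add: k_def)
  qed
  define P where "P = compile c 0"
  obtain q where q: "\<And>B. cost c B = poly q B" using cost_poly by blast
  let ?M = "machine k P"
  \<comment> \<open>The cost \<open>q\<close> is polynomial in the register bound, which is
    \<open>p\<close> of the input length; the additional step sets the counter marks.\<close>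
  let ?p = "pcompose q p + 1"
  have "\<exists>t \<le> poly ?p (length x). \<exists>ts h. (tm_step ?M ^^ t) (initial_config ?M x) (tm_final ?M, ts) \<and>
      last ts = (tape_contents (f x), h)" for x
  proof -
    let ?B = "poly p (length x)"
    obtain e i where ex: "exec x ?B c (\<lambda>_. 0, 0, []) (e, i, f x)" using assms by blast
    have "code_at P 0 (compile c 0)" by (simp add: P_def code_at_def)
    from exec_steps[OF ex this] obtain t where
      t: "t \<le> cost_at c (\<lambda>_. 0, 0, []) ?B"
      "(istep x P ^^ t) (0, \<lambda>_. 0, 0, []) (length P, e, i, f x)"
      by (auto simp: P_def reach_def)
    have "iregs j \<subseteq> {..<k}" if "j \<in> set P" for j
      using iregs_compile[of j c 0] that k by (auto simp: P_def)
    from machine_steps[OF t(2) this] machine_init[of k P x]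
    have "(tm_step ?M ^^ (1 + t)) (initial_config ?M x) (Suc (length P), ctapes x k (e, i, f x))"
      by (intro relpowp_add_trans) auto
    moreover have "t \<le> cost c ?B" using t(1) cost_at_le[of "(\<lambda>_. 0, 0, [])" ?B c] by simp
    then have "1 + t \<le> poly ?p (length x)" by (simp add: q poly_pcompose)
    moreover have "last (ctapes x k (e, i, f x)) = (tape_contents (f x), int (length (f x)))"
      by (simp add: ctapes_def)
    moreover have "tm_final ?M = Suc (length P)" by (simp add: machine_def)
    ultimately show ?thesis by metis
  qed
  then show ?thesis
    unfolding poly_time_computable_def using wf_machine deterministic_machine by blast
qed

section \<open>Functions definable by counter programs\<close>

text \<open>
  \<open>pterm n f\<close>: the value \<open>f e x\<close>, depending on the variables \<open>e 0, \<dots>, e (n - 1)\<close> and the input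
  \<open>x\<close>, is computed by a counter program for every placement \<open>\<rho>\<close> of the variables in registers
  below \<open>k\<close>; the result goes to register \<open>k\<close>, registers above serve as work space.
\<close>

definition depends_below :: "nat \<Rightarrow> ((nat \<Rightarrow> nat) \<Rightarrow> bool list \<Rightarrow> 'a) \<Rightarrow> bool" where
  "depends_below n f \<longleftrightarrow> (\<forall>e e' x. (\<forall>i<n. e i = e' i) \<longrightarrow> f e x = f e' x)"

text \<open>The bound \<open>m\<close> on input and variables is kept apart from the register bound
  \<open>B\<close>: inside a loop the index is a further variable, and the polynomial of the body is
  then applied to a larger \<open>m\<close> under the same \<open>B\<close>.\<close>

definition good_env :: "nat \<Rightarrow> (nat \<Rightarrow> nat) \<Rightarrow> nat \<Rightarrow> nat poly \<Rightarrow> bool list \<Rightarrow> (nat \<Rightarrow> nat) \<Rightarrow> nat \<Rightarrow> nat \<Rightarrow> bool"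
  where "good_env n \<rho> k p x e m B \<longleftrightarrow>
    (\<forall>r\<ge>k. e r = 0) \<and> length x \<le> m \<and> (\<forall>i<n. e (\<rho> i) \<le> m) \<and> poly p m \<le> B"

definition computes :: "nat \<Rightarrow> (nat \<Rightarrow> nat) \<Rightarrow> nat \<Rightarrow> ((nat \<Rightarrow> nat) \<Rightarrow> bool list \<Rightarrow> nat) \<Rightarrow> com \<Rightarrow> nat poly \<Rightarrow> bool"
  where "computes n \<rho> k f c p \<longleftrightarrow> (\<forall>x e m B w. good_env n \<rho> k p x e m B \<longrightarrow>
    f (\<lambda>i. e (\<rho> i)) x \<le> poly p m \<and> exec x B c (e, 0, w) (e(k := f (\<lambda>i. e (\<rho> i)) x), 0, w))"

definition pterm :: "nat \<Rightarrow> ((nat \<Rightarrow> nat) \<Rightarrow> bool list \<Rightarrow> nat) \<Rightarrow> bool" where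
  "pterm n f \<longleftrightarrow> depends_below n f \<and>
     (\<forall>\<rho> k. (\<forall>i<n. \<rho> i < k) \<longrightarrow> (\<exists>c p. computes n \<rho> k f c p))"

definition ppred :: "nat \<Rightarrow> ((nat \<Rightarrow> nat) \<Rightarrow> bool list \<Rightarrow> bool) \<Rightarrow> bool" where
  "ppred n P \<longleftrightarrow> pterm n (\<lambda>e x. if P e x then 1 else 0)"

definition outputs :: "nat \<Rightarrow> (nat \<Rightarrow> nat) \<Rightarrow> nat \<Rightarrow> ((nat \<Rightarrow> nat) \<Rightarrow> bool list \<Rightarrow> bool list) \<Rightarrow> com \<Rightarrow> nat poly \<Rightarrow> bool"
  where "outputs n \<rho> k F c p \<longleftrightarrow> (\<forall>x e m B w. good_env n \<rho> k p x e m B \<longrightarrow>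
    exec x B c (e, 0, w) (e, 0, w @ F (\<lambda>i. e (\<rho> i)) x))"

definition pout :: "nat \<Rightarrow> ((nat \<Rightarrow> nat) \<Rightarrow> bool list \<Rightarrow> bool list) \<Rightarrow> bool" where
  "pout n F \<longleftrightarrow> depends_below n F \<and>
     (\<forall>\<rho> k. (\<forall>i<n. \<rho> i < k) \<longrightarrow> (\<exists>c p. outputs n \<rho> k F c p))"

text \<open>Invariant rule: \<open>E j\<close>, \<open>I j\<close>, \<open>U j\<close> describe the
  state before iteration \<open>j\<close>. The induction runs over the number \<open>d\<close> of
  iterations left, since \<open>LoopS\<close> peels off the first one.\<close>

lemma exec_Loop_iter:
  assumes "\<And>j. j \<le> n \<Longrightarrow> E j r = n - j"
    and "\<And>j. j < n \<Longrightarrow> exec x B c ((E j)(r := n - Suc j), I j, U j) (E (Suc j), I (Suc j), U (Suc j))"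
  shows "exec x B (Loop r c) (E 0, I 0, U 0) (E n, I n, U n)"
proof -
  have "exec x B (Loop r c) (E (n - d), I (n - d), U (n - d)) (E n, I n, U n)" if "d \<le> n" for d
    using that
  proof (induction d)
    case 0
    then show ?case using assms(1)[of n] by (auto intro: exec.Loop0)
  next
    case (Suc d)
    let ?j = "n - Suc d"
    have j: "?j < n" "Suc ?j = n - d" using Suc.prems by auto
    have "E ?j r = Suc d" using assms(1)[of ?j] Suc.prems by auto
    moreover have "exec x B c ((E ?j)(r := d), I ?j, U ?j) (E (n - d), I (n - d), U (n - d))"
      using assms(2)[OF j(1)] j(2) Suc.prems by simp
    moreover have "E (n - d) r = d" using assms(1)[of "n - d"] Suc.prems by auto
    moreover have "exec x B (Loop r c) (E (n - d), I (n - d), U (n - d)) (E n, I n, U n)"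
      using Suc by simp
    ultimately show ?case by (rule exec.LoopS)
  qed
  from this[of n] show ?thesis by simp
qed

lemma exec_move:
  assumes "a \<noteq> b" "e b + e a \<le> B"
  shows "exec x B (Loop a (Inc b)) (e, i, w) (e(a := 0, b := e b + e a), i, w)"
proof -
  let ?E = "\<lambda>j. e(a := e a - j, b := e b + j)"
  have "exec x B (Loop a (Inc b)) (?E 0, i, w) (?E (e a), i, w)"
  proof (rule exec_Loop_iter[where E = ?E and I = "\<lambda>_. i" and U = "\<lambda>_. w" and n = "e a"])
    fix j assume "j < e a"
    then have "exec x B (Inc b) ((?E j)(a := e a - Suc j), i, w)
        (((?E j)(a := e a - Suc j))(b := Suc (((?E j)(a := e a - Suc j)) b)), i, w)"
      using assms by (intro exec.Inc) auto
    moreover have "((?E j)(a := e a - Suc j))(b := Suc (((?E j)(a := e a - Suc j)) b)) = ?E (Suc j)"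
      using assms(1) by (auto simp: fun_eq_iff)
    ultimately show "exec x B (Inc b) ((?E j)(a := e a - Suc j), i, w) (?E (Suc j), i, w)" by simp
  qed (use assms in auto)
  then show ?thesis by simp
qed

lemma exec_clear: "exec x B (Loop a Skip) (e, i, w) (e(a := 0), i, w)"
proof -
  let ?E = "\<lambda>j. e(a := e a - j)"
  have "exec x B (Loop a Skip) (?E 0, i, w) (?E (e a), i, w)"
  proof (rule exec_Loop_iter[where E = ?E and I = "\<lambda>_. i" and U = "\<lambda>_. w" and n = "e a"])
    fix j assume "j < e a"
    have "(?E j)(a := e a - Suc j) = ?E (Suc j)" by simp
    then show "exec x B Skip ((?E j)(a := e a - Suc j), i, w) (?E (Suc j), i, w)"
      by (simp only: exec.Skip)
  qed simp
  then show ?thesis by simp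
qed

lemma exec_Seq_eq: "exec x B a s s1 \<Longrightarrow> exec x B b s1 s2 \<Longrightarrow> s2 = s3 \<Longrightarrow> exec x B (Seq a b) s s3"
  by (auto intro: exec.Seq)

lemma depends_belowD: "depends_below n f \<Longrightarrow> (\<And>i. i < n \<Longrightarrow> e i = e' i) \<Longrightarrow> f e x = f e' x"
  unfolding depends_below_def by blast

lemma ptermE:
  assumes "pterm n f" "\<forall>i<n. \<rho> i < k"
  obtains c p where "computes n \<rho> k f c p"
  using assms unfolding pterm_def by blast

lemma pterm_depends: "pterm n f \<Longrightarrow> depends_below n f"
  unfolding pterm_def by blast

lemma pterm_update: "pterm n f \<Longrightarrow> f (e(n := v)) x = f e x"
  using depends_belowD[OF pterm_depends, of n f "e(n := v)" e x] by simp

lemma good_env_le: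
  assumes "good_env n \<rho> k p x e m B" "\<And>m. poly p' m \<le> poly p m"
  shows "good_env n \<rho> k p' x e m B"
proof -
  have "poly p' m \<le> B" using assms(1) assms(2)[of m] unfolding good_env_def by simp
  then show ?thesis using assms(1) unfolding good_env_def by simp
qed

lemma good_env_upd:
  assumes "good_env n \<rho> k p x e m B" "\<And>i. i < n \<Longrightarrow> \<rho> i < k" "\<And>m. poly p' m \<le> poly p m"
  shows "good_env n \<rho> (Suc k) p' x (e(k := v)) m B"
proof -
  have "(e(k := v)) (\<rho> i) = e (\<rho> i)" if "i < n" for i using assms(2)[OF that] by simp
  moreover have "(e(k := v)) r = e r" if "Suc k \<le> r" for r using that by simp
  moreover have "poly p' m \<le> B" using assms(1) assms(3)[of m] unfolding good_env_def by simp
  ultimately show ?thesis using assms(1) unfolding good_env_def by simp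
qed

lemma pterm_Suc:
  assumes "pterm n f"
  shows "pterm (Suc n) f"
  unfolding pterm_def
proof (intro conjI allI impI)
  show "depends_below (Suc n) f"
    using pterm_depends[OF assms] unfolding depends_below_def by (meson less_SucI)
  fix \<rho> k assume "\<forall>i<Suc n. \<rho> i < (k::nat)"
  then have "\<forall>i<n. \<rho> i < k" by simp
  then obtain c p where cp: "computes n \<rho> k f c p" using ptermE[OF assms] by blast
  have "good_env n \<rho> k p x e m B" if "good_env (Suc n) \<rho> k p x e m B" for x e m B
    using that unfolding good_env_def by simp
  then have "computes (Suc n) \<rho> k f c p" using cp unfolding computes_def by blast
  then show "\<exists>c p. computes (Suc n) \<rho> k f c p" by blast
qed

text \<open>Reading a counter destroys it, so its value is moved into two registers at once and one
  copy is moved back.\<close>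

lemma pterm_var:
  assumes "i < n"
  shows "pterm n (\<lambda>e x. e i)"
  unfolding pterm_def
proof (intro conjI allI impI)
  show "depends_below n (\<lambda>e x. e i)" using assms by (simp add: depends_below_def)
  fix \<rho> k assume r: "\<forall>i<n. \<rho> i < (k::nat)"
  let ?c = "Seq (Loop (\<rho> i) (Seq (Inc k) (Inc (Suc k)))) (Loop (Suc k) (Inc (\<rho> i)))"
  have "computes n \<rho> k (\<lambda>e x. e i) ?c [:0, 1:]"
    unfolding computes_def
  proof (intro allI impI)
    fix x e m B w assume g: "good_env n \<rho> k [:0, 1:] x e m B"
    have ri: "\<rho> i < k" using r assms by blast
    have eB: "e (\<rho> i) \<le> m" "m \<le> B" using g assms unfolding good_env_def by auto
    have e0: "e k = 0" "e (Suc k) = 0" using g unfolding good_env_def by auto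
    let ?a = "\<rho> i"
    let ?E = "\<lambda>j. e(?a := e ?a - j, k := j, Suc k := j)"
    have "exec x B (Loop ?a (Seq (Inc k) (Inc (Suc k)))) (?E 0, 0, w) (?E (e ?a), 0, w)"
    proof (rule exec_Loop_iter[where E = ?E and I = "\<lambda>_. 0" and U = "\<lambda>_. w" and n = "e ?a"])
      fix j assume j: "j < e ?a"
      show "exec x B (Seq (Inc k) (Inc (Suc k))) ((?E j)(?a := e ?a - Suc j), 0, w) (?E (Suc j), 0, w)"
        by (rule exec_Seq_eq, rule exec.Inc, use j eB ri in simp, rule exec.Inc, use j eB ri in simp)
          (use ri in \<open>auto simp: fun_eq_iff\<close>)
    qed (use ri in auto)
    moreover have "?E 0 = e" using e0 by (auto simp: fun_eq_iff)
    ultimately have 1: "exec x B (Loop ?a (Seq (Inc k) (Inc (Suc k)))) (e, 0, w) (?E (e ?a), 0, w)"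
      by simp
    have 2: "exec x B (Loop (Suc k) (Inc ?a)) (?E (e ?a), 0, w)
        ((?E (e ?a))(Suc k := 0, ?a := ?E (e ?a) ?a + ?E (e ?a) (Suc k)), 0, w)"
      by (rule exec_move) (use ri eB in auto)
    have "(?E (e ?a))(Suc k := 0, ?a := ?E (e ?a) ?a + ?E (e ?a) (Suc k)) = e(k := e ?a)"
      using ri e0 by (auto simp: fun_eq_iff)
    then show "e (\<rho> i) \<le> poly [:0, 1:] m \<and> exec x B ?c (e, 0, w) (e(k := e (\<rho> i)), 0, w)"
      using exec_Seq_eq[OF 1 2] eB by simp
  qed
  then show "\<exists>c p. computes n \<rho> k (\<lambda>e x. e i) c p" by blast
qed

lemma pterm_0: "pterm n (\<lambda>e x. 0)"
  unfolding pterm_def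
proof (intro conjI allI impI)
  fix \<rho> :: "nat \<Rightarrow> nat" and k
  have "computes n \<rho> k (\<lambda>e x. 0) Skip 0"
    unfolding computes_def
  proof (intro allI impI)
    fix x e m B w assume "good_env n \<rho> k 0 x e m B"
    then have "e(k := 0) = e" by (auto simp: good_env_def fun_upd_idem)
    then show "0 \<le> poly 0 m \<and> exec x B Skip (e, 0, w) (e(k := 0), 0, w)" by (simp add: exec.Skip)
  qed
  then show "\<exists>c p. computes n \<rho> k (\<lambda>e x. 0) c p" by blast
qed (simp add: depends_below_def)

lemma pterm_1: "pterm n (\<lambda>e x. Suc 0)"
  unfolding pterm_def
proof (intro conjI allI impI)
  fix \<rho> :: "nat \<Rightarrow> nat" and k
  have "computes n \<rho> k (\<lambda>e x. Suc 0) (Inc k) 1"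
    unfolding computes_def
  proof (intro allI impI)
    fix x e m B w assume g: "good_env n \<rho> k 1 x e m B"
    then have "exec x B (Inc k) (e, 0, w) (e(k := Suc (e k)), 0, w)"
      by (intro exec.Inc) (auto simp: good_env_def)
    moreover have "e k = 0" using g by (auto simp: good_env_def)
    ultimately show "Suc 0 \<le> poly 1 m \<and> exec x B (Inc k) (e, 0, w) (e(k := Suc 0), 0, w)" by simp
  qed
  then show "\<exists>c p. computes n \<rho> k (\<lambda>e x. Suc 0) c p" by blast
qed (simp add: depends_below_def)

text \<open>\<open>Scan\<close> leaves the input head at the right end, but every program has to
  return it to 0. The length just counted drives the way back and is saved in \<open>Suc k\<close>
  meanwhile.\<close>

lemma pterm_length: "pterm n (\<lambda>e x. length x)"
  unfolding pterm_def
proof (intro conjI allI impI)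
  fix \<rho> :: "nat \<Rightarrow> nat" and k
  let ?c = "Seq (Scan k) (Seq (Loop k (Seq InL (Inc (Suc k)))) (Loop (Suc k) (Inc k)))"
  have "computes n \<rho> k (\<lambda>e x. length x) ?c [:0, 1:]"
    unfolding computes_def
  proof (intro allI impI)
    fix x :: "bool list" and e m B w assume g: "good_env n \<rho> k [:0, 1:] x e m B"
    have e0: "e k = 0" "e (Suc k) = 0" and mB: "length x \<le> m" "m \<le> B"
      using g unfolding good_env_def by auto
    let ?L = "length x"
    have "exec x B (Scan k) (e, 0, w) (e(k := e k + (length x - 0)), length x, w)"
      by (rule exec.Scan) (use e0 mB in auto)
    then have 1: "exec x B (Scan k) (e, 0, w) (e(k := ?L), ?L, w)" using e0 by simp
    let ?E = "\<lambda>j. e(k := ?L - j, Suc k := j)"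
    have "exec x B (Loop k (Seq InL (Inc (Suc k)))) (?E 0, ?L - 0, w) (?E ?L, ?L - ?L, w)"
    proof (rule exec_Loop_iter[where E = ?E and I = "\<lambda>j. ?L - j" and U = "\<lambda>_. w" and n = ?L])
      fix j assume j: "j < ?L"
      then have "?L - j = Suc (?L - Suc j)" by simp
      then show "exec x B (Seq InL (Inc (Suc k))) ((?E j)(k := ?L - Suc j), ?L - j, w)
          (?E (Suc j), ?L - Suc j, w)"
        by (simp only:) (rule exec_Seq_eq, rule exec.InL, rule exec.Inc, use j mB in simp,
            auto simp: fun_eq_iff)
    qed auto
    moreover have "?E 0 = e(k := ?L)" using e0 by (auto simp: fun_eq_iff)
    ultimately have 2: "exec x B (Loop k (Seq InL (Inc (Suc k)))) (e(k := ?L), ?L, w) (?E ?L, 0, w)"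
      by simp
    have 3: "exec x B (Loop (Suc k) (Inc k)) (?E ?L, 0, w)
        ((?E ?L)(Suc k := 0, k := ?E ?L k + ?E ?L (Suc k)), 0, w)"
      by (rule exec_move) (use mB in auto)
    have "(?E ?L)(Suc k := 0, k := ?E ?L k + ?E ?L (Suc k)) = e(k := ?L)"
      using e0 by (auto simp: fun_eq_iff)
    then show "?L \<le> poly [:0, 1:] m \<and> exec x B ?c (e, 0, w) (e(k := ?L), 0, w)"
      using exec.Seq[OF 1 exec.Seq[OF 2 3]] mB by simp
  qed
  then show "\<exists>c p. computes n \<rho> k (\<lambda>e x. length x) c p" by blast
qed (simp add: depends_below_def)

text \<open>The value of \<open>f\<close> walks the head to the queried bit; its copy in
  \<open>Suc k\<close> walks the head back after the test.\<close>

lemma ppred_bit: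
  assumes f: "pterm n f"
  shows "ppred n (\<lambda>e x. f e x < length x \<and> x ! f e x)"
  unfolding ppred_def pterm_def
proof (intro conjI allI impI)
  show "depends_below n (\<lambda>e x. if f e x < length x \<and> x ! f e x then 1 else (0::nat))"
    using pterm_depends[OF f] unfolding depends_below_def by metis
  fix \<rho> k assume r: "\<forall>i<n. \<rho> i < (k::nat)"
  obtain cf p where cf: "computes n \<rho> k f cf p" using ptermE[OF f r] by blast
  let ?c = "Seq cf (Seq (Loop k (Seq InR (Inc (Suc k)))) (Seq (BitInc k) (Loop (Suc k) InL)))"
  let ?g = "\<lambda>e x. if f e x < length x \<and> x ! f e x then 1 else (0::nat)"
  have "computes n \<rho> k ?g ?c (p + 1)"
    unfolding computes_def
  proof (intro allI impI)
    fix x e m B w assume g: "good_env n \<rho> k (p + 1) x e m B"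
    let ?v = "f (\<lambda>i. e (\<rho> i)) x"
    have "good_env n \<rho> k p x e m B" by (rule good_env_le[OF g]) simp
    with cf have v: "?v \<le> poly p m" and 1: "exec x B cf (e, 0, w) (e(k := ?v), 0, w)"
      unfolding computes_def by blast+
    have e0: "e k = 0" "e (Suc k) = 0" and B: "?v < B" using g v unfolding good_env_def by auto
    let ?E = "\<lambda>j. e(k := ?v - j, Suc k := j)"
    have "exec x B (Loop k (Seq InR (Inc (Suc k)))) (?E 0, 0, w) (?E ?v, ?v, w)"
    proof (rule exec_Loop_iter[where E = ?E and I = "\<lambda>j. j" and U = "\<lambda>_. w" and n = ?v])
      fix j assume j: "j < ?v"
      show "exec x B (Seq InR (Inc (Suc k))) ((?E j)(k := ?v - Suc j), j, w) (?E (Suc j), Suc j, w)"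
        by (rule exec_Seq_eq, rule exec.InR, rule exec.Inc, use j B in simp) (auto simp: fun_eq_iff)
    qed auto
    moreover have "?E 0 = e(k := ?v)" using e0 by (auto simp: fun_eq_iff)
    ultimately have 2: "exec x B (Loop k (Seq InR (Inc (Suc k)))) (e(k := ?v), 0, w) (?E ?v, ?v, w)"
      by simp
    let ?b = "?g (\<lambda>i. e (\<rho> i)) x"
    have "exec x B (BitInc k) (?E ?v, ?v, w)
        ((?E ?v)(k := (if ?v < length x \<and> x ! ?v then Suc (?E ?v k) else ?E ?v k)), ?v, w)"
      by (rule exec.BitInc) (use B in simp)
    moreover have "(?E ?v)(k := (if ?v < length x \<and> x ! ?v then Suc (?E ?v k) else ?E ?v k)) =
        e(k := ?b, Suc k := ?v)" by (auto simp: fun_eq_iff)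
    ultimately have 3: "exec x B (BitInc k) (?E ?v, ?v, w) (e(k := ?b, Suc k := ?v), ?v, w)" by simp
    let ?F = "\<lambda>j. e(k := ?b, Suc k := ?v - j)"
    have "exec x B (Loop (Suc k) InL) (?F 0, ?v - 0, w) (?F ?v, ?v - ?v, w)"
    proof (rule exec_Loop_iter[where E = ?F and I = "\<lambda>j. ?v - j" and U = "\<lambda>_. w" and n = ?v])
      fix j assume j: "j < ?v"
      then have a: "?v - j = Suc (?v - Suc j)" by simp
      have b: "(?F j)(Suc k := ?v - Suc j) = ?F (Suc j)" by (auto simp: fun_eq_iff)
      show "exec x B InL ((?F j)(Suc k := ?v - Suc j), ?v - j, w) (?F (Suc j), ?v - Suc j, w)"
        unfolding b unfolding a by (rule exec.InL)
    qed auto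
    moreover have "?F ?v = e(k := ?b)" using e0 by (auto simp: fun_eq_iff)
    ultimately have 4: "exec x B (Loop (Suc k) InL) (e(k := ?b, Suc k := ?v), ?v, w) (e(k := ?b), 0, w)"
      by simp
    have "exec x B ?c (e, 0, w) (e(k := ?b), 0, w)"
      by (rule exec.Seq[OF 1 exec.Seq[OF 2 exec.Seq[OF 3 4]]])
    then show "?b \<le> poly (p + 1) m \<and> exec x B ?c (e, 0, w) (e(k := ?b), 0, w)" by simp
  qed
  then show "\<exists>c p. computes n \<rho> k ?g c p" by blast
qed

lemma pterm_binary:
  assumes f: "pterm n f" and g: "pterm n g"
    and h: "\<And>x B e i w k. h (e k) (e (Suc k)) \<le> B \<Longrightarrow> e k \<le> B \<Longrightarrow>
      exec x B (Loop (Suc k) (b k)) (e, i, w) (e(k := h (e k) (e (Suc k)), Suc k := 0), i, w)"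
    and hb: "\<And>u v. h u v \<le> u + v"
  shows "pterm n (\<lambda>e x. h (f e x) (g e x))"
  unfolding pterm_def
proof (intro conjI allI impI)
  show "depends_below n (\<lambda>e x. h (f e x) (g e x))"
    using pterm_depends[OF f] pterm_depends[OF g] unfolding depends_below_def by metis
  fix \<rho> k assume r: "\<forall>i<n. \<rho> i < (k::nat)"
  then have r': "\<forall>i<n. \<rho> i < Suc k" by (simp add: less_SucI)
  obtain cf p where cf: "computes n \<rho> k f cf p" using ptermE[OF f r] by blast
  obtain cg q where cg: "computes n \<rho> (Suc k) g cg q" using ptermE[OF g r'] by blast
  let ?c = "Seq cf (Seq cg (Loop (Suc k) (b k)))"
  have "computes n \<rho> k (\<lambda>e x. h (f e x) (g e x)) ?c (p + q)"
    unfolding computes_def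
  proof (intro allI impI)
    fix x e m B w assume ge: "good_env n \<rho> k (p + q) x e m B"
    let ?u = "f (\<lambda>i. e (\<rho> i)) x" and ?v = "g (\<lambda>i. e (\<rho> i)) x"
    have "good_env n \<rho> k p x e m B" by (rule good_env_le[OF ge]) simp
    with cf have u: "?u \<le> poly p m" and 1: "exec x B cf (e, 0, w) (e(k := ?u), 0, w)"
      unfolding computes_def by blast+
    have "good_env n \<rho> (Suc k) q x (e(k := ?u)) m B"
      by (rule good_env_upd[OF ge]) (use r in auto)
    with cg have v': "g (\<lambda>i. (e(k := ?u)) (\<rho> i)) x \<le> poly q m" and
      2: "exec x B cg (e(k := ?u), 0, w) (e(k := ?u, Suc k := g (\<lambda>i. (e(k := ?u)) (\<rho> i)) x), 0, w)"
      unfolding computes_def by blast+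
    have eq: "g (\<lambda>i. (e(k := ?u)) (\<rho> i)) x = ?v"
      by (rule depends_belowD[OF pterm_depends[OF g]]) (use r in auto)
    have e0: "e (Suc k) = 0" and B: "?u \<le> B" "?u + ?v \<le> B" using ge u v' eq unfolding good_env_def by auto
    let ?e = "e(k := ?u, Suc k := ?v)"
    have "exec x B (Loop (Suc k) (b k)) (?e, 0, w) (?e(k := h (?e k) (?e (Suc k)), Suc k := 0), 0, w)"
      by (rule h) (use B hb[of ?u ?v] in auto)
    moreover have "?e(k := h (?e k) (?e (Suc k)), Suc k := 0) = e(k := h ?u ?v)"
      using e0 by (auto simp: fun_eq_iff)
    ultimately have 3: "exec x B (Loop (Suc k) (b k)) (?e, 0, w) (e(k := h ?u ?v), 0, w)" by simp
    have "h ?u ?v \<le> poly (p + q) m" using hb[of ?u ?v] u v' eq by simp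
    then show "h ?u ?v \<le> poly (p + q) m \<and> exec x B ?c (e, 0, w) (e(k := h ?u ?v), 0, w)"
      using exec.Seq[OF 1 exec.Seq[OF 2[unfolded eq] 3]] by blast
  qed
  then show "\<exists>c p. computes n \<rho> k (\<lambda>e x. h (f e x) (g e x)) c p" by blast
qed

lemma pterm_add:
  assumes "pterm n f" "pterm n g"
  shows "pterm n (\<lambda>e x. f e x + g e x)"
  using assms
proof (rule pterm_binary[where h = "(+)" and b = "\<lambda>k. Inc k"])
  fix x B and e :: "nat \<Rightarrow> nat" and i w k assume "e k + e (Suc k) \<le> B"
  then have "exec x B (Loop (Suc k) (Inc k)) (e, i, w) (e(Suc k := 0, k := e k + e (Suc k)), i, w)"
    by (intro exec_move) auto
  then show "exec x B (Loop (Suc k) (Inc k)) (e, i, w) (e(k := e k + e (Suc k), Suc k := 0), i, w)"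
    by (simp add: fun_upd_twist)
qed auto

lemma pterm_diff:
  assumes "pterm n f" "pterm n g"
  shows "pterm n (\<lambda>e x. f e x - g e x)"
  using assms
proof (rule pterm_binary[where h = "(-)" and b = "\<lambda>k. DecS k"])
  fix x B and e :: "nat \<Rightarrow> nat" and i w k
  let ?E = "\<lambda>j. e(k := e k - j, Suc k := e (Suc k) - j)"
  have "exec x B (Loop (Suc k) (DecS k)) (?E 0, i, w) (?E (e (Suc k)), i, w)"
  proof (rule exec_Loop_iter[where E = ?E and I = "\<lambda>_. i" and U = "\<lambda>_. w" and n = "e (Suc k)"])
    fix j assume "j < e (Suc k)"
    have "exec x B (DecS k) ((?E j)(Suc k := e (Suc k) - Suc j), i, w)
        (((?E j)(Suc k := e (Suc k) - Suc j))(k := ((?E j)(Suc k := e (Suc k) - Suc j)) k - 1), i, w)"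
      by (rule exec.DecS)
    moreover have "((?E j)(Suc k := e (Suc k) - Suc j))(k := ((?E j)(Suc k := e (Suc k) - Suc j)) k - 1)
        = ?E (Suc j)" by (auto simp: fun_eq_iff)
    ultimately show "exec x B (DecS k) ((?E j)(Suc k := e (Suc k) - Suc j), i, w) (?E (Suc j), i, w)"
      by simp
  qed auto
  then show "exec x B (Loop (Suc k) (DecS k)) (e, i, w) (e(k := e k - e (Suc k), Suc k := 0), i, w)"
    by simp
qed auto

text \<open>The index enters the body both as slot \<open>n\<close> of the environment and as an
  explicit argument. By \<open>ind\<close> only the argument counts, so the body may be evaluated in
  any environment that agrees below \<open>n\<close>.\<close>

lemma body_env:
  assumes dep: "depends_below (Suc n) (\<lambda>e x. h (e n) e x)"
    and ind: "\<And>v u e x. h v (e(n := u)) x = h v e x"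
    and eq: "\<And>i. i < n \<Longrightarrow> e' i = e i"
  shows "h v e' x = h v e x"
proof -
  have "h ((e'(n := v)) n) (e'(n := v)) x = h ((e(n := v)) n) (e(n := v)) x"
    by (rule depends_belowD[OF dep]) (use eq in \<open>auto simp: less_Suc_eq\<close>)
  then show ?thesis using ind by simp
qed

text \<open>The closure rule for terms whose loop body is an arbitrary program; products and bounded
  quantifiers are instances of it.\<close>

lemma pterm_sum:
  assumes g: "pterm n g" and h: "pterm (Suc n) (\<lambda>e x. h (e n) e x)"
    and ind: "\<And>v u e x. h v (e(n := u)) x = h v e x"
  shows "pterm n (\<lambda>e x. \<Sum>v<g e x. h v e x)"
  unfolding pterm_def
proof (intro conjI allI impI)
  note dep = body_env[of n h, OF pterm_depends[OF h] ind]
  show "depends_below n (\<lambda>e x. \<Sum>v<g e x. h v e x)"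
    unfolding depends_below_def
  proof (intro allI impI)
    fix e e' :: "nat \<Rightarrow> nat" and x assume a: "\<forall>i<n. e i = e' i"
    have "g e x = g e' x" by (rule depends_belowD[OF pterm_depends[OF g]]) (use a in auto)
    moreover have "h v e x = h v e' x" for v by (rule dep) (use a in auto)
    ultimately show "(\<Sum>v<g e x. h v e x) = (\<Sum>v<g e' x. h v e' x)" by simp
  qed
  fix \<rho> k assume r: "\<forall>i<n. \<rho> i < (k::nat)"
  \<comment> \<open>Register \<open>k\<close> accumulates the sum and \<open>?r\<close> receives the
    value of the body. The loop consumes its counter \<open>?t\<close> downwards, so the index needs
    the separate register \<open>?i\<close>.\<close>
  let ?i = "Suc k" and ?t = "Suc (Suc k)" and ?r = "Suc (Suc (Suc k))"
  let ?\<rho> = "\<rho>(n := ?i)"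
  have rt: "\<forall>i<n. \<rho> i < ?t" and rr: "\<forall>i<Suc n. ?\<rho> i < ?r"
    using r by (auto simp: less_Suc_eq)
  obtain cg p where cg: "computes n \<rho> ?t g cg p" using ptermE[OF g rt] by blast
  obtain ch q where ch: "computes (Suc n) ?\<rho> ?r (\<lambda>e x. h (e n) e x) ch q" using ptermE[OF h rr] by blast
  \<comment> \<open>The index stays below \<open>poly p m\<close>, so \<open>m + poly p m\<close>
    bounds the variables of the body. In \<open>?P\<close> the product bounds the sum, and the 1
    provides the strict inequality that \<open>Inc\<close> needs.\<close>
  let ?q = "pcompose q ([:0, 1:] + p)"
  let ?P = "p + ?q + p * ?q + 1"
  let ?body = "Seq ch (Seq (Loop ?r (Inc k)) (Inc ?i))"
  let ?c = "Seq cg (Seq (Loop ?t ?body) (Loop ?i Skip))"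
  have "computes n \<rho> k (\<lambda>e x. \<Sum>v<g e x. h v e x) ?c ?P"
    unfolding computes_def
  proof (intro allI impI)
    fix x e m B w assume ge: "good_env n \<rho> k ?P x e m B"
    let ?e = "\<lambda>i. e (\<rho> i)"
    define N where "N = g ?e x"
    define H where "H v = h v ?e x" for v
    have z: "e r = 0" if "k \<le> r" for r using ge that unfolding good_env_def by blast
    have PB: "poly p m + poly ?q m + poly p m * poly ?q m + 1 \<le> B"
      using ge unfolding good_env_def by simp
    have "good_env n \<rho> ?t p x e m B" using ge unfolding good_env_def by auto
    with cg have N: "N \<le> poly p m" and 1: "exec x B cg (e, 0, w) (e(?t := N), 0, w)"
      unfolding computes_def N_def by blast+
    have body: "H v \<le> poly ?q m \<and> exec x B ch (E, 0, w) (E(?r := H v), 0, w)"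
      if v: "v < N" and E: "\<And>i. i < n \<Longrightarrow> E (\<rho> i) = e (\<rho> i)" "E ?i = v" "\<And>r. ?r \<le> r \<Longrightarrow> E r = 0" for E v
    proof -
      have "E (?\<rho> i) \<le> m + poly p m" if "i < Suc n" for i
      proof (cases "i = n")
        case False
        then have "i < n" using that by simp
        then have "E (?\<rho> i) \<le> m" using ge E(1) unfolding good_env_def by auto
        then show ?thesis by simp
      qed (use v E N in auto)
      then have "good_env (Suc n) ?\<rho> ?r q x E (m + poly p m) B"
        using ge E(3) PB unfolding good_env_def by (auto simp: poly_pcompose)
      with ch have *: "h (E (?\<rho> n)) (\<lambda>i. E (?\<rho> i)) x \<le> poly q (m + poly p m)"
        "exec x B ch (E, 0, w) (E(?r := h (E (?\<rho> n)) (\<lambda>i. E (?\<rho> i)) x), 0, w)"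
        unfolding computes_def by blast+
      have "h (E (?\<rho> n)) (\<lambda>i. E (?\<rho> i)) x = h v (\<lambda>i. E (?\<rho> i)) x" using E by simp
      also have "\<dots> = H v" unfolding H_def by (rule dep) (use E in auto)
      finally show ?thesis using * by (simp add: poly_pcompose)
    qed
    have S: "(\<Sum>v<j. H v) \<le> poly p m * poly ?q m" if "j \<le> N" for j
    proof -
      have "H v \<le> poly ?q m" if v: "v < N" for v
      proof (rule conjunct1[OF body[OF v, of "e(?i := v)"]])
        show "(e(?i := v)) (\<rho> i) = e (\<rho> i)" if "i < n" for i
        proof -
          have "\<rho> i < k" using r that by blast
          then show ?thesis by simp
        qed
        show "(e(?i := v)) r = 0" if "?r \<le> r" for r using z[of r] that by simp
      qed simp
      then have "(\<Sum>v<j. H v) \<le> (\<Sum>v<j. poly ?q m)" using \<open>j \<le> N\<close> by (intro sum_mono) auto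
      also have "\<dots> \<le> poly p m * poly ?q m" using N that by (simp add: mult_le_mono)
      finally show ?thesis .
    qed
    let ?E = "\<lambda>j. e(k := (\<Sum>v<j. H v), ?i := j, ?t := N - j)"
    have "exec x B (Loop ?t ?body) (?E 0, 0, w) (?E N, 0, w)"
    proof (rule exec_Loop_iter[where E = ?E and I = "\<lambda>_. 0" and U = "\<lambda>_. w" and n = N])
      fix j assume j: "j < N"
      let ?F = "(?E j)(?t := N - Suc j)"
      have a: "exec x B ch (?F, 0, w) (?F(?r := H j), 0, w)"
      proof (rule conjunct2[OF body[OF j, of ?F]])
        show "?F (\<rho> i) = e (\<rho> i)" if "i < n" for i
        proof -
          have "\<rho> i < k" using r that by blast
          then show ?thesis by simp
        qed
        show "?F r = 0" if "?r \<le> r" for r using z[of r] that by simp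
      qed simp
      have Sj: "(\<Sum>v<Suc j. H v) \<le> B" "j < B" using S[of "Suc j"] j PB N by auto
      have b: "exec x B (Loop ?r (Inc k)) (?F(?r := H j), 0, w)
          (?F(?r := H j, ?r := 0, k := (?F(?r := H j)) k + (?F(?r := H j)) ?r), 0, w)"
        by (rule exec_move) (use Sj in auto)
      have c: "exec x B (Inc ?i) (?F(?r := H j, ?r := 0, k := (?F(?r := H j)) k + (?F(?r := H j)) ?r), 0, w)
        ((?F(?r := H j, ?r := 0, k := (?F(?r := H j)) k + (?F(?r := H j)) ?r))(?i :=
          Suc ((?F(?r := H j, ?r := 0, k := (?F(?r := H j)) k + (?F(?r := H j)) ?r)) ?i)), 0, w)"
        by (rule exec.Inc) (use Sj in simp)
      have d: "(?F(?r := H j, ?r := 0, k := (?F(?r := H j)) k + (?F(?r := H j)) ?r))(?i :=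
          Suc ((?F(?r := H j, ?r := 0, k := (?F(?r := H j)) k + (?F(?r := H j)) ?r)) ?i)) = ?E (Suc j)"
        using z by (auto simp: fun_eq_iff)
      show "exec x B ?body (?F, 0, w) (?E (Suc j), 0, w)"
        using exec.Seq[OF a exec.Seq[OF b c]] unfolding d .
    qed auto
    moreover have "?E 0 = e(?t := N)" using z by (auto simp: fun_eq_iff)
    ultimately have 2: "exec x B (Loop ?t ?body) (e(?t := N), 0, w) (?E N, 0, w)" by simp
    have "exec x B (Loop ?i Skip) (?E N, 0, w) ((?E N)(?i := 0), 0, w)" by (rule exec_clear)
    moreover have "(?E N)(?i := 0) = e(k := (\<Sum>v<N. H v))" using z by (auto simp: fun_eq_iff)
    ultimately have 3: "exec x B (Loop ?i Skip) (?E N, 0, w) (e(k := (\<Sum>v<N. H v)), 0, w)" by simp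
    have "exec x B ?c (e, 0, w) (e(k := (\<Sum>v<N. H v)), 0, w)"
      by (rule exec.Seq[OF 1 exec.Seq[OF 2 3]])
    moreover have "(\<Sum>v<N. H v) \<le> poly ?P m" using S[of N] by simp
    ultimately show "(\<Sum>v<g ?e x. h v ?e x) \<le> poly ?P m \<and>
        exec x B ?c (e, 0, w) (e(k := (\<Sum>v<g ?e x. h v ?e x)), 0, w)"
      unfolding N_def H_def by blast
  qed
  then show "\<exists>c p. computes n \<rho> k (\<lambda>e x. \<Sum>v<g e x. h v e x) c p" by blast
qed

section \<open>Closure under arithmetic, connectives and bounded quantifiers\<close>

lemma pterm_const: "pterm n (\<lambda>e x. c)"
proof (induction c)
  case (Suc c)
  from pterm_add[OF Suc pterm_1[of n]] show ?case by simp
qed (rule pterm_0)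

lemma pterm_mult:
  assumes f: "pterm n f" and g: "pterm n g"
  shows "pterm n (\<lambda>e x. f e x * g e x)"
proof -
  have "pterm n (\<lambda>e x. \<Sum>v<f e x. g e x)"
    by (rule pterm_sum[where h = "\<lambda>v. g", OF f pterm_Suc[OF g]]) (rule pterm_update[OF g])
  then show ?thesis by simp
qed

lemma pterm_poly:
  assumes f: "pterm n f"
  shows "pterm n (\<lambda>e x. poly p (f e x))"
proof (induction p)
  case 0
  show ?case using pterm_0[of n] by simp
next
  case (pCons a p)
  from pterm_add[OF pterm_const[of n a] pterm_mult[OF f pCons.IH]] show ?case by simp
qed

lemma pterm_power:
  assumes f: "pterm n f"
  shows "pterm n (\<lambda>e x. f e x ^ c)"
proof (induction c)
  case 0
  show ?case using pterm_const[of n 1] by simp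
next
  case (Suc c)
  from pterm_mult[OF f Suc] show ?case by simp
qed

lemma ppred_cong:
  assumes "ppred n P" "\<And>e x. Q e x \<longleftrightarrow> P e x"
  shows "ppred n Q"
proof -
  have "Q = P" using assms(2) by (intro ext) auto
  then show ?thesis using assms(1) by simp
qed

lemma ppred_of_pterm:
  assumes "pterm n f" "\<And>e x. f e x = (if P e x then 1 else 0)"
  shows "ppred n P"
proof -
  have "f = (\<lambda>e x. if P e x then 1 else 0)" using assms(2) by (intro ext) auto
  then show ?thesis using assms(1) unfolding ppred_def by simp
qed

lemma pterm_of_ppred: "ppred n P \<Longrightarrow> pterm n (\<lambda>e x. if P e x then 1 else 0)"
  unfolding ppred_def .

text \<open>With truncated subtraction, \<open>1 - (1 - f)\<close> is the sign function.\<close>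

lemma ppred_pos:
  assumes "pterm n f"
  shows "ppred n (\<lambda>e x. 0 < f e x)"
  by (rule ppred_of_pterm[OF pterm_diff[OF pterm_const[of n 1] pterm_diff[OF pterm_const[of n 1] assms]]])
    auto

lemma ppred_not:
  assumes "ppred n P"
  shows "ppred n (\<lambda>e x. \<not> P e x)"
  by (rule ppred_of_pterm[OF pterm_diff[OF pterm_const[of n 1] pterm_of_ppred[OF assms]]]) auto

lemma ppred_conj:
  assumes "ppred n P" "ppred n Q"
  shows "ppred n (\<lambda>e x. P e x \<and> Q e x)"
  by (rule ppred_of_pterm[OF pterm_mult[OF pterm_of_ppred[OF assms(1)] pterm_of_ppred[OF assms(2)]]])
    auto

lemma ppred_disj:
  assumes "ppred n P" "ppred n Q"
  shows "ppred n (\<lambda>e x. P e x \<or> Q e x)"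
  by (rule ppred_cong[OF ppred_not[OF ppred_conj[OF ppred_not[OF assms(1)] ppred_not[OF assms(2)]]]])
    auto

lemma ppred_less:
  assumes "pterm n f" "pterm n g"
  shows "ppred n (\<lambda>e x. f e x < g e x)"
  by (rule ppred_cong[OF ppred_pos[OF pterm_diff[OF assms(2,1)]]]) auto

lemma ppred_le:
  assumes "pterm n f" "pterm n g"
  shows "ppred n (\<lambda>e x. f e x \<le> g e x)"
  by (rule ppred_cong[OF ppred_not[OF ppred_less[OF assms(2,1)]]]) auto

lemma ppred_eq:
  assumes "pterm n f" "pterm n g"
  shows "ppred n (\<lambda>e x. f e x = g e x)"
  by (rule ppred_cong[OF ppred_conj[OF ppred_le[OF assms] ppred_le[OF assms(2,1)]]]) auto

lemma ppred_False: "ppred n (\<lambda>e x. False)"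
  by (rule ppred_of_pterm[OF pterm_0]) auto

lemma ppred_const: "ppred n (\<lambda>e x. b)"
  by (cases b) (use ppred_False[of n] ppred_not[OF ppred_False[of n]] in auto)

text \<open>A bounded sum counts the witnesses, and the count is tested for being positive.\<close>

lemma ppred_ex:
  assumes g: "pterm n g" and P: "ppred (Suc n) (\<lambda>e x. P (e n) e x)"
    and ind: "\<And>v u e x. P v (e(n := u)) x \<longleftrightarrow> P v e x"
  shows "ppred n (\<lambda>e x. \<exists>v<g e x. P v e x)"
proof -
  have "pterm n (\<lambda>e x. \<Sum>v<g e x. if P v e x then 1 else 0)"
    by (rule pterm_sum[where h = "\<lambda>v e x. if P v e x then 1 else 0", OF g])
      (use P ind in \<open>auto simp: ppred_def\<close>)
  from ppred_pos[OF this] show ?thesis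
  proof (rule ppred_cong)
    fix e :: "nat \<Rightarrow> nat" and x
    define s where "s = (\<Sum>v<g e x. if P v e x then 1 else (0::nat))"
    have "s = 0 \<longleftrightarrow> (\<forall>v<g e x. \<not> P v e x)" unfolding s_def by (subst sum_eq_0_iff) auto
    then have "(\<exists>v<g e x. P v e x) \<longleftrightarrow> 0 < s" by auto
    then show "(\<exists>v<g e x. P v e x) \<longleftrightarrow> 0 < (\<Sum>v<g e x. if P v e x then 1 else (0::nat))"
      unfolding s_def .
  qed
qed

lemma ppred_finite_ex:
  assumes "finite A" "\<And>a. a \<in> A \<Longrightarrow> ppred n (P a)"
  shows "ppred n (\<lambda>e x. \<exists>a\<in>A. P a e x)"
  using assms
proof (induction A rule: finite_induct)
  case empty
  then show ?case using ppred_False by simp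
next
  case (insert a A)
  have "ppred n (\<lambda>e x. P a e x \<or> (\<exists>a\<in>A. P a e x))"
    by (rule ppred_disj) (use insert in auto)
  then show ?case by simp
qed

lemma pterm_if:
  assumes "ppred n P" "pterm n f" "pterm n g"
  shows "pterm n (\<lambda>e x. if P e x then f e x else g e x)"
proof -
  have "(\<lambda>e x. if P e x then f e x else g e x) =
    (\<lambda>e x. (if P e x then 1 else 0) * f e x + (1 - (if P e x then 1 else 0)) * g e x)"
    by (intro ext) auto
  then show ?thesis
    using pterm_add[OF pterm_mult[OF pterm_of_ppred[OF assms(1)] assms(2)]
        pterm_mult[OF pterm_diff[OF pterm_const[of n 1] pterm_of_ppred[OF assms(1)]] assms(3)]]
    by simp
qed

section \<open>Programs that write output\<close>

lemma poutE:
  assumes "pout n F" "\<forall>i<n. \<rho> i < k"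
  obtains c p where "outputs n \<rho> k F c p"
  using assms unfolding pout_def by blast

lemma pout_depends: "pout n F \<Longrightarrow> depends_below n F"
  unfolding pout_def by blast

lemma pout_bit:
  assumes P: "ppred n P"
  shows "pout n (\<lambda>e x. [P e x])"
  unfolding pout_def
proof (intro conjI allI impI)
  note t = pterm_of_ppred[OF P]
  show "depends_below n (\<lambda>e x. [P e x])"
    unfolding depends_below_def
  proof (intro allI impI)
    fix e e' :: "nat \<Rightarrow> nat" and x assume "\<forall>i<n. e i = e' i"
    then have "(if P e x then 1 else (0::nat)) = (if P e' x then 1 else 0)"
      using pterm_depends[OF t] unfolding depends_below_def by blast
    then show "[P e x] = [P e' x]" by (auto split: if_splits)
  qed
  fix \<rho> k assume r: "\<forall>i<n. \<rho> i < (k::nat)"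
  obtain c p where c: "computes n \<rho> k (\<lambda>e x. if P e x then 1 else 0) c p"
    using ptermE[OF t r] by blast
  let ?c = "Seq c (Seq (EmitReg k) (Loop k Skip))"
  have "outputs n \<rho> k (\<lambda>e x. [P e x]) ?c p"
    unfolding outputs_def
  proof (intro allI impI)
    fix x e m B w assume g: "good_env n \<rho> k p x e m B"
    define v :: nat where "v = (if P (\<lambda>i. e (\<rho> i)) x then 1 else 0)"
    have 1: "exec x B c (e, 0, w) (e(k := v), 0, w)"
      using c g unfolding computes_def v_def by blast
    have 2: "exec x B (EmitReg k) (e(k := v), 0, w) (e(k := v), 0, w @ [(e(k := v)) k \<noteq> 0])"
      by (rule exec.EmitReg)
    have 3: "exec x B (Loop k Skip) (e(k := v), 0, w @ [(e(k := v)) k \<noteq> 0])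
        ((e(k := v))(k := 0), 0, w @ [(e(k := v)) k \<noteq> 0])"
      by (rule exec_clear)
    have "(e(k := v))(k := 0) = e" using g by (auto simp: good_env_def fun_eq_iff)
    moreover have "((e(k := v)) k \<noteq> 0) = P (\<lambda>i. e (\<rho> i)) x" by (simp add: v_def)
    ultimately show "exec x B ?c (e, 0, w) (e, 0, w @ [P (\<lambda>i. e (\<rho> i)) x])"
      using exec.Seq[OF 1 exec.Seq[OF 2 3]] by simp
  qed
  then show "\<exists>c p. outputs n \<rho> k (\<lambda>e x. [P e x]) c p" by blast
qed

lemma pout_append:
  assumes F: "pout n F" and F': "pout n F'"
  shows "pout n (\<lambda>e x. F e x @ F' e x)"
  unfolding pout_def
proof (intro conjI allI impI)
  show "depends_below n (\<lambda>e x. F e x @ F' e x)"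
    using pout_depends[OF F] pout_depends[OF F'] unfolding depends_below_def by metis
  fix \<rho> k assume r: "\<forall>i<n. \<rho> i < (k::nat)"
  obtain c p where c: "outputs n \<rho> k F c p" using poutE[OF F r] by blast
  obtain d q where d: "outputs n \<rho> k F' d q" using poutE[OF F' r] by blast
  have "outputs n \<rho> k (\<lambda>e x. F e x @ F' e x) (Seq c d) (p + q)"
    unfolding outputs_def
  proof (intro allI impI)
    fix x e m B w assume g: "good_env n \<rho> k (p + q) x e m B"
    have gp: "good_env n \<rho> k p x e m B" by (rule good_env_le[OF g]) simp
    have gq: "good_env n \<rho> k q x e m B" by (rule good_env_le[OF g]) simp
    have 1: "exec x B c (e, 0, w) (e, 0, w @ F (\<lambda>i. e (\<rho> i)) x)"
      using c gp unfolding outputs_def by blast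
    have 2: "exec x B d (e, 0, w @ F (\<lambda>i. e (\<rho> i)) x)
        (e, 0, (w @ F (\<lambda>i. e (\<rho> i)) x) @ F' (\<lambda>i. e (\<rho> i)) x)"
      using d gq unfolding outputs_def by blast
    show "exec x B (Seq c d) (e, 0, w) (e, 0, w @ F (\<lambda>i. e (\<rho> i)) x @ F' (\<lambda>i. e (\<rho> i)) x)"
      using exec.Seq[OF 1 2] by simp
  qed
  then show "\<exists>c p. outputs n \<rho> k (\<lambda>e x. F e x @ F' e x) c p" by blast
qed

lemma pout_for:
  assumes g: "pterm n g" and F: "pout (Suc n) (\<lambda>e x. F (e n) e x)"
    and ind: "\<And>v u e x. F v (e(n := u)) x = F v e x"
  shows "pout n (\<lambda>e x. concat (map (\<lambda>v. F v e x) [0..<g e x]))"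
  unfolding pout_def
proof (intro conjI allI impI)
  note dep = body_env[of n F, OF pout_depends[OF F] ind]
  show "depends_below n (\<lambda>e x. concat (map (\<lambda>v. F v e x) [0..<g e x]))"
    unfolding depends_below_def
  proof (intro allI impI)
    fix e e' :: "nat \<Rightarrow> nat" and x assume a: "\<forall>i<n. e i = e' i"
    have "g e x = g e' x" by (rule depends_belowD[OF pterm_depends[OF g]]) (use a in auto)
    moreover have "F v e x = F v e' x" for v by (rule dep) (use a in auto)
    ultimately show "concat (map (\<lambda>v. F v e x) [0..<g e x]) = concat (map (\<lambda>v. F v e' x) [0..<g e' x])"
      by simp
  qed
  fix \<rho> k assume r: "\<forall>i<n. \<rho> i < (k::nat)"
  let ?t = "Suc k" and ?r = "Suc (Suc k)"
  let ?\<rho> = "\<rho>(n := k)"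
  have rt: "\<forall>i<n. \<rho> i < ?t" and rr: "\<forall>i<Suc n. ?\<rho> i < ?r"
    using r by (auto simp: less_Suc_eq)
  obtain cg p where cg: "computes n \<rho> ?t g cg p" using ptermE[OF g rt] by blast
  obtain ch q where ch: "outputs (Suc n) ?\<rho> ?r (\<lambda>e x. F (e n) e x) ch q" using poutE[OF F rr] by blast
  let ?q = "pcompose q ([:0, 1:] + p)"
  let ?P = "p + ?q"
  let ?body = "Seq ch (Inc k)"
  let ?c = "Seq cg (Seq (Loop ?t ?body) (Loop k Skip))"
  have "outputs n \<rho> k (\<lambda>e x. concat (map (\<lambda>v. F v e x) [0..<g e x])) ?c ?P"
    unfolding outputs_def
  proof (intro allI impI)
    fix x e m B w assume ge: "good_env n \<rho> k ?P x e m B"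
    let ?e = "\<lambda>i. e (\<rho> i)"
    define N where "N = g ?e x"
    define H where "H v = F v ?e x" for v
    have z: "e r = 0" if "k \<le> r" for r using ge that unfolding good_env_def by blast
    have PB: "poly p m + poly ?q m \<le> B" using ge unfolding good_env_def by simp
    have "good_env n \<rho> ?t p x e m B" using ge unfolding good_env_def by auto
    with cg have N: "N \<le> poly p m" and 1: "exec x B cg (e, 0, w) (e(?t := N), 0, w)"
      unfolding computes_def N_def by blast+
    have body: "exec x B ch (E, 0, u) (E, 0, u @ H v)"
      if v: "v < N" and E: "\<And>i. i < n \<Longrightarrow> E (\<rho> i) = e (\<rho> i)" "E k = v" "\<And>r. ?r \<le> r \<Longrightarrow> E r = 0"
      for E v u
    proof -
      have "E (?\<rho> i) \<le> m + poly p m" if "i < Suc n" for i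
      proof (cases "i = n")
        case False
        then have "i < n" using that by simp
        then have "E (?\<rho> i) \<le> m" using ge E(1) unfolding good_env_def by auto
        then show ?thesis by simp
      qed (use v E N in auto)
      then have "good_env (Suc n) ?\<rho> ?r q x E (m + poly p m) B"
        using ge E(3) PB unfolding good_env_def by (auto simp: poly_pcompose)
      with ch have *: "exec x B ch (E, 0, u) (E, 0, u @ F (E (?\<rho> n)) (\<lambda>i. E (?\<rho> i)) x)"
        unfolding outputs_def by blast
      have "F (E (?\<rho> n)) (\<lambda>i. E (?\<rho> i)) x = F v (\<lambda>i. E (?\<rho> i)) x" using E by simp
      also have "\<dots> = H v" unfolding H_def by (rule dep) (use E in auto)
      finally show ?thesis using * by simp
    qed
    let ?E = "\<lambda>j. e(k := j, ?t := N - j)" and ?U = "\<lambda>j. w @ concat (map H [0..<j])"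
    have "exec x B (Loop ?t ?body) (?E 0, 0, ?U 0) (?E N, 0, ?U N)"
    proof (rule exec_Loop_iter[where E = ?E and I = "\<lambda>_. 0" and U = ?U and n = N])
      fix j assume j: "j < N"
      let ?F = "(?E j)(?t := N - Suc j)"
      have a: "exec x B ch (?F, 0, ?U j) (?F, 0, ?U j @ H j)"
      proof (rule body[OF j, of ?F])
        show "?F (\<rho> i) = e (\<rho> i)" if "i < n" for i
        proof -
          have "\<rho> i < k" using r that by blast
          then show ?thesis by simp
        qed
        show "?F r = 0" if "?r \<le> r" for r using z[of r] that by simp
      qed simp
      have b: "exec x B (Inc k) (?F, 0, ?U j @ H j) (?F(k := Suc (?F k)), 0, ?U j @ H j)"
        by (rule exec.Inc) (use j N PB in simp)
      have d: "?F(k := Suc (?F k)) = ?E (Suc j)" "?U j @ H j = ?U (Suc j)"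
        by (auto simp: fun_eq_iff)
      show "exec x B ?body (?F, 0, ?U j) (?E (Suc j), 0, ?U (Suc j))"
        using exec.Seq[OF a b] unfolding d .
    qed auto
    moreover have "?E 0 = e(?t := N)" using z by (auto simp: fun_eq_iff)
    ultimately have 2: "exec x B (Loop ?t ?body) (e(?t := N), 0, w) (?E N, 0, ?U N)" by simp
    have "exec x B (Loop k Skip) (?E N, 0, ?U N) ((?E N)(k := 0), 0, ?U N)" by (rule exec_clear)
    moreover have "(?E N)(k := 0) = e" using z by (auto simp: fun_eq_iff)
    ultimately have 3: "exec x B (Loop k Skip) (?E N, 0, ?U N) (e, 0, ?U N)" by simp
    have "exec x B ?c (e, 0, w) (e, 0, ?U N)"
      by (rule exec.Seq[OF 1 exec.Seq[OF 2 3]])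
    then show "exec x B ?c (e, 0, w) (e, 0, w @ concat (map (\<lambda>v. F v ?e x) [0..<g ?e x]))"
      unfolding N_def H_def .
  qed
  then show "\<exists>c p. outputs n \<rho> k (\<lambda>e x. concat (map (\<lambda>v. F v e x) [0..<g e x])) c p" by blast
qed

theorem poly_time_computable_pout:
  assumes "pout 0 (\<lambda>e. f)"
  shows "poly_time_computable f"
proof -
  obtain c p where c: "outputs 0 (\<lambda>i. i) 0 (\<lambda>e. f) c p" using poutE[OF assms, of "\<lambda>i. i" 0] by blast
  show ?thesis
  proof (rule poly_time_computable_exec[of p])
    fix x :: "bool list"
    have "good_env 0 (\<lambda>i. i) 0 p x (\<lambda>_. 0) (length x) (poly p (length x))"
      by (simp add: good_env_def)
    with c have "exec x (poly p (length x)) c (\<lambda>_. 0, 0, []) (\<lambda>_. 0, 0, [] @ f x)"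
      unfolding outputs_def by blast
    then show "\<exists>e i. exec x (poly p (length x)) c (\<lambda>_. 0, 0, []) (e, i, f x)" by auto
  qed
qed

text \<open>The output has the shape of \<open>encode_instance\<close>, so a reduction to the
  sandwich problem is computable as soon as its vertex number and its two adjacency relations are
  definable.\<close>

theorem poly_time_computable_encoding:
  assumes N: "pterm 0 (\<lambda>e. N)" and P: "ppred 2 (\<lambda>e x. P (e 0) (e 1) x)"
    and Q: "ppred 2 (\<lambda>e x. Q (e 0) (e 1) x)"
  shows "poly_time_computable (\<lambda>x. replicate (N x) True @ [False] @
    concat (map (\<lambda>i. map (\<lambda>j. P i j x) [0..<N x]) [0..<N x]) @
    concat (map (\<lambda>i. map (\<lambda>j. Q i j x) [0..<N x]) [0..<N x]))"
proof -
  have matrix: "pout 0 (\<lambda>e x. concat (map (\<lambda>i. map (\<lambda>j. R i j x) [0..<N x]) [0..<N x]))"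
    if R: "ppred 2 (\<lambda>e x. R (e 0) (e 1) x)" for R
  proof -
    have "pout 1 (\<lambda>e x. concat (map (\<lambda>j. [R (e 0) j x]) [0..<N x]))"
    proof (rule pout_for[where F = "\<lambda>j e x. [R (e 0) j x]"])
      show "pterm 1 (\<lambda>e x. N x)" using pterm_Suc[OF N] by simp
      show "pout (Suc 1) (\<lambda>e x. [R (e 0) (e 1) x])"
        using pout_bit[OF R] by (simp add: numeral_2_eq_2)
    qed simp
    then have "pout (Suc 0) (\<lambda>e x. map (\<lambda>j. R (e 0) j x) [0..<N x])"
      by (simp add: concat_map_singleton)
    then show ?thesis
      by (intro pout_for[where F = "\<lambda>i e x. map (\<lambda>j. R i j x) [0..<N x]", OF N]) auto
  qed
  have one: "pout n (\<lambda>e x. [b])" for n b using pout_bit[OF ppred_const[of n b]] by simp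
  have "pout 0 (\<lambda>e x. concat (map (\<lambda>i. [True]) [0..<N x]))"
    by (rule pout_for[where F = "\<lambda>i e x. [True]", OF N]) (auto intro: one)
  then have unary: "pout 0 (\<lambda>e x. replicate (N x) True)"
    by (simp add: concat_map_singleton map_replicate_const)
  show ?thesis
    by (rule poly_time_computable_pout)
      (rule pout_append[OF unary pout_append[OF one[of 0 False] pout_append[OF matrix[OF P] matrix[OF Q]]]])
qed

section \<open>The tableau of a nondeterministic machine\<close>

text \<open>\<open>c0\<close> depends on the machine alone and exceeds all its states, symbols and
  counts; the 12 makes room for the ten clause kinds and the small constants that occur as
  digits.\<close>

locale tableau =
  fixes M :: tm and trs :: "transition list" and c0 :: nat and x :: "bool list" and T :: nat
  assumes wf: "wf_tm M" and trs: "set trs = tm_trans M"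
    and c0: "12 \<le> c0" "length trs < c0" "Suc (tm_tapes M) < c0" "tm_start M < c0" "tm_final M < c0"
    and c0_trs: "(q, rs, q', as) \<in> set trs \<Longrightarrow> q < c0 \<and> q' < c0 \<and> (\<forall>a\<in>set rs. a < c0) \<and>
      (\<forall>a\<in>set as. fst a < c0)"
begin

text \<open>The state is kept in cell 0 of an additional tape 0, whose head never moves. Times, tape
  numbers, positions (shifted by \<open>T\<close>) and symbols are all smaller than \<open>b\<close>.\<close>

definition b :: nat where "b = 2 * T + c0"

abbreviation k :: nat where "k \<equiv> Suc (tm_tapes M)"

abbreviation m :: nat where "m \<equiv> length trs"

definition reads :: "nat \<Rightarrow> nat list" where
  "reads r = (case trs ! r of (q, rs, q', as) \<Rightarrow> q # rs)"

definition acts :: "nat \<Rightarrow> tape_action list" where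
  "acts r = (case trs ! r of (q, rs, q', as) \<Rightarrow> (q', Stay) # as)"

text \<open>\<open>RD\<close>, \<open>WR\<close> and \<open>MV\<close> depend on the machine only:
  they are finite tables, which a program can have built in. \<open>MV\<close> stores a move
  increased by 1, so that left, stay and right become 0, 1, 2.\<close>

definition RD :: "(nat \<times> nat \<times> nat) set" where
  "RD = {(r, p, a). r < m \<and> p < k \<and> a = reads r ! p}"

definition WR :: "(nat \<times> nat \<times> nat) set" where
  "WR = {(r, p, a). r < m \<and> p < k \<and> a = fst (acts r ! p)}"

definition MV :: "(nat \<times> nat \<times> nat) set" where
  "MV = {(r, p, d). r < m \<and> p < k \<and> d = nat (1 + head_offset (snd (acts r ! p)))}"

definition init :: "nat \<Rightarrow> nat \<Rightarrow> nat" where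
  "init p i = (if p = 0 then tm_start M else
     if p = 1 \<and> T \<le> i \<and> i - T < length x then (if x ! (i - T) then 2 else 1) else 0)"

text \<open>\<open>lit_rel K t p i a c k' t' p' i' a' s\<close>: the literal of sign \<open>s\<close> on the variable with code
  \<open>(k', t', p', i', a')\<close> occurs in the clause with code \<open>(K, t, p, i, a, c)\<close>. Variables of kind
  0, 1, 2 say that the head of tape \<open>p\<close> is at \<open>i\<close> at time \<open>t\<close>, that cell \<open>i\<close> of tape \<open>p\<close>
  contains \<open>a\<close> at time \<open>t\<close>, and that transition \<open>a\<close> is taken at time \<open>t\<close>. Components of a clause
  code that its kind \<open>K\<close> does not use are arbitrary.\<close>

definition lit_rel :: "nat \<Rightarrow> nat \<Rightarrow> nat \<Rightarrow> nat \<Rightarrow> nat \<Rightarrow> nat \<Rightarrow>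
    nat \<Rightarrow> nat \<Rightarrow> nat \<Rightarrow> nat \<Rightarrow> nat \<Rightarrow> bool \<Rightarrow> bool" where
  "lit_rel K t p i a c k' t' p' i' a' s \<longleftrightarrow>
    (K = 0 \<and> s \<and> k' = 1 \<and> t' = 0 \<and> p' = p \<and> i' = i \<and> a' = init p i) \<or>
    (K = 1 \<and> p < k \<and> s \<and> k' = 0 \<and> t' = 0 \<and> p' = p \<and> i' = T \<and> a' = 0) \<or>
    (K = 2 \<and> s \<and> ((k' = 2 \<and> t' = t \<and> p' = 0 \<and> i' = 0 \<and> a' < m) \<or>
       (k' = 1 \<and> t' = t \<and> p' = 0 \<and> i' = T \<and> a' = tm_final M))) \<or>
    ((K = 3 \<or> K = 4 \<or> K = 5) \<and> \<not> s \<and> ((k' = 2 \<and> t' = t \<and> p' = 0 \<and> i' = 0 \<and> a' = a) \<or>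
       (k' = 0 \<and> t' = t \<and> p' = p \<and> i' = i \<and> a' = 0))) \<or>
    (K = 3 \<and> s \<and> k' = 1 \<and> t' = t \<and> p' = p \<and> i' = i \<and> (a, p, a') \<in> RD) \<or>
    (K = 4 \<and> s \<and> k' = 1 \<and> t' = Suc t \<and> p' = p \<and> i' = i \<and> (a, p, a') \<in> WR) \<or>
    (K = 5 \<and> s \<and> k' = 0 \<and> t' = Suc t \<and> p' = p \<and> (a, p, Suc i' - i) \<in> MV \<and> i \<le> Suc i' \<and> a' = 0) \<or>
    (K = 6 \<and> t < T \<and> ((s \<and> k' = 0 \<and> t' = t \<and> p' = p \<and> i' = i \<and> a' = 0) \<or>
       (\<not> s \<and> k' = 1 \<and> t' = t \<and> p' = p \<and> i' = i \<and> a' = a) \<or>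
       (s \<and> k' = 1 \<and> t' = Suc t \<and> p' = p \<and> i' = i \<and> a' = a))) \<or>
    (K = 7 \<and> \<not> s \<and> a \<noteq> c \<and> k' = 1 \<and> t' = t \<and> p' = p \<and> i' = i \<and> (a' = a \<or> a' = c)) \<or>
    (K = 8 \<and> \<not> s \<and> i \<noteq> c \<and> k' = 0 \<and> t' = t \<and> p' = p \<and> (i' = i \<or> i' = c) \<and> a' = 0) \<or>
    (K = 9 \<and> s \<and> k' = 1 \<and> t' = T \<and> p' = 0 \<and> i' = T \<and> a' = tm_final M)"

text \<open>The kinds express: initial contents (0); initial head positions (1); a transition is
  taken unless the state is final (2); a taken transition reads, writes and moves correctly (3, 4,
  5); a cell away from the head is kept (6); symbols and head positions are unique (7, 8); the state
  at time \<open>T\<close> is final (9). Soundness can follow any transition that is marked as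
  taken.\<close>

lemma lit_rel_simps:
  "lit_rel 0 t p i a c k' t' p' i' a' s \<longleftrightarrow>
    s \<and> k' = 1 \<and> t' = 0 \<and> p' = p \<and> i' = i \<and> a' = init p i"
  "lit_rel (Suc 0) t p i a c k' t' p' i' a' s \<longleftrightarrow>
    p < k \<and> s \<and> k' = 0 \<and> t' = 0 \<and> p' = p \<and> i' = T \<and> a' = 0"
  "lit_rel 2 t p i a c k' t' p' i' a' s \<longleftrightarrow>
    s \<and> ((k' = 2 \<and> t' = t \<and> p' = 0 \<and> i' = 0 \<and> a' < m) \<or>
       (k' = 1 \<and> t' = t \<and> p' = 0 \<and> i' = T \<and> a' = tm_final M))"
  "lit_rel 3 t p i a c k' t' p' i' a' s \<longleftrightarrow>
    (\<not> s \<and> ((k' = 2 \<and> t' = t \<and> p' = 0 \<and> i' = 0 \<and> a' = a) \<or>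
       (k' = 0 \<and> t' = t \<and> p' = p \<and> i' = i \<and> a' = 0))) \<or>
    (s \<and> k' = 1 \<and> t' = t \<and> p' = p \<and> i' = i \<and> (a, p, a') \<in> RD)"
  "lit_rel 4 t p i a c k' t' p' i' a' s \<longleftrightarrow>
    (\<not> s \<and> ((k' = 2 \<and> t' = t \<and> p' = 0 \<and> i' = 0 \<and> a' = a) \<or>
       (k' = 0 \<and> t' = t \<and> p' = p \<and> i' = i \<and> a' = 0))) \<or>
    (s \<and> k' = 1 \<and> t' = Suc t \<and> p' = p \<and> i' = i \<and> (a, p, a') \<in> WR)"
  "lit_rel 5 t p i a c k' t' p' i' a' s \<longleftrightarrow>
    (\<not> s \<and> ((k' = 2 \<and> t' = t \<and> p' = 0 \<and> i' = 0 \<and> a' = a) \<or>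
       (k' = 0 \<and> t' = t \<and> p' = p \<and> i' = i \<and> a' = 0))) \<or>
    (s \<and> k' = 0 \<and> t' = Suc t \<and> p' = p \<and> (a, p, Suc i' - i) \<in> MV \<and> i \<le> Suc i' \<and> a' = 0)"
  "lit_rel 6 t p i a c k' t' p' i' a' s \<longleftrightarrow>
    t < T \<and> ((s \<and> k' = 0 \<and> t' = t \<and> p' = p \<and> i' = i \<and> a' = 0) \<or>
       (\<not> s \<and> k' = 1 \<and> t' = t \<and> p' = p \<and> i' = i \<and> a' = a) \<or>
       (s \<and> k' = 1 \<and> t' = Suc t \<and> p' = p \<and> i' = i \<and> a' = a))"
  "lit_rel 7 t p i a c k' t' p' i' a' s \<longleftrightarrow>
    \<not> s \<and> a \<noteq> c \<and> k' = 1 \<and> t' = t \<and> p' = p \<and> i' = i \<and> (a' = a \<or> a' = c)"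
  "lit_rel 8 t p i a c k' t' p' i' a' s \<longleftrightarrow>
    \<not> s \<and> i \<noteq> c \<and> k' = 0 \<and> t' = t \<and> p' = p \<and> (i' = i \<or> i' = c) \<and> a' = 0"
  "lit_rel 9 t p i a c k' t' p' i' a' s \<longleftrightarrow>
    s \<and> k' = 1 \<and> t' = T \<and> p' = 0 \<and> i' = T \<and> a' = tm_final M"
  "10 \<le> K \<Longrightarrow> \<not> lit_rel K t p i a c k' t' p' i' a' s"
  by (simp_all add: lit_rel_def)

text \<open>Within one clause, literals of opposite sign differ in the kind of their variable or in
  its time. The two occurrences of a variable in one clause become adjacent positions, which a hub
  must not have as options together.\<close>

lemma lit_rel_no_tautology:
  "\<not> (lit_rel K t p i a c k' t' p' i' a' True \<and> lit_rel K t p i a c k' t' p' i' a' False)"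
  unfolding lit_rel_def by auto

text \<open>The premise discards the digit vectors that encode no clause.\<close>

definition tab_sat :: "(nat \<Rightarrow> nat \<Rightarrow> nat \<Rightarrow> nat \<Rightarrow> nat \<Rightarrow> bool) \<Rightarrow> bool" where
  "tab_sat \<sigma> \<longleftrightarrow> (\<forall>K<b. \<forall>t<b. \<forall>p<b. \<forall>i<b. \<forall>a<b. \<forall>c<b.
     (\<exists>k'<b. \<exists>t'<b. \<exists>p'<b. \<exists>i'<b. \<exists>a'<b. \<exists>s. lit_rel K t p i a c k' t' p' i' a' s) \<longrightarrow>
     (\<exists>k'<b. \<exists>t'<b. \<exists>p'<b. \<exists>i'<b. \<exists>a'<b. lit_rel K t p i a c k' t' p' i' a' (\<sigma> k' t' p' i' a')))"

text \<open>Away from cell 0 the state tape shows \<open>tm_start M\<close>, in agreement with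
  \<open>init 0\<close>, which ignores the position.\<close>

definition ext_tapes :: "config \<Rightarrow> tape list" where
  "ext_tapes c = ((\<lambda>i. if i = 0 then fst c else tm_start M), 0) # snd c"

lemma trs_lengths:
  assumes "r < m"
  shows "length (reads r) = k" "length (acts r) = k"
proof -
  obtain q rs q' as where e: "trs ! r = (q, rs, q', as)" by (cases "trs ! r") auto
  then have "(q, rs, q', as) \<in> tm_trans M" using assms trs nth_mem[of r trs] by auto
  then have "length rs = tm_tapes M" "length as = tm_tapes M" using wf unfolding wf_tm_def by auto
  then show "length (reads r) = k" "length (acts r) = k" by (auto simp: reads_def acts_def e)
qed

lemma trs_bounds:
  assumes "r < m" "p < k"
  shows "reads r ! p < c0" "fst (acts r ! p) < c0"
proof -
  obtain q rs q' as where e: "trs ! r = (q, rs, q', as)" by (cases "trs ! r") auto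
  then have i: "(q, rs, q', as) \<in> set trs" using assms nth_mem[of r trs] by auto
  have "\<forall>a\<in>set (reads r). a < c0" "\<forall>a\<in>set (acts r). fst a < c0"
    using c0_trs[OF i] by (auto simp: reads_def acts_def e)
  then show "reads r ! p < c0" "fst (acts r ! p) < c0"
    using trs_lengths[OF assms(1)] assms(2) by auto
qed

lemma ext_tapes_step:
  "ext_tapes (q', map2 act_tape as ts) = map2 act_tape ((q', Stay) # as) (ext_tapes (q, ts))"
  unfolding ext_tapes_def by (auto simp: fun_eq_iff)

text \<open>With the state as one more symbol, a step is determined by the number of a transition
  and by what the extended tapes show.\<close>

lemma tm_step_iff:
  "tm_step M c d \<longleftrightarrow> (\<exists>r<m. map read_tape (ext_tapes c) = reads r \<and>
     d = (fst (acts r ! 0), map2 act_tape (tl (acts r)) (snd c)))"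
proof
  assume "tm_step M c d"
  then obtain q ts q' as where s: "c = (q, ts)" "d = (q', map2 act_tape as ts)"
    "(q, map read_tape ts, q', as) \<in> tm_trans M" by (auto elim: tm_step.cases)
  then obtain r where "r < m" "trs ! r = (q, map read_tape ts, q', as)"
    using trs by (metis in_set_conv_nth)
  then show "\<exists>r<m. map read_tape (ext_tapes c) = reads r \<and>
     d = (fst (acts r ! 0), map2 act_tape (tl (acts r)) (snd c))"
    using s by (intro exI[of _ r]) (auto simp: reads_def acts_def ext_tapes_def)
next
  assume "\<exists>r<m. map read_tape (ext_tapes c) = reads r \<and>
     d = (fst (acts r ! 0), map2 act_tape (tl (acts r)) (snd c))"
  then obtain r where r: "r < m" "map read_tape (ext_tapes c) = reads r"
    "d = (fst (acts r ! 0), map2 act_tape (tl (acts r)) (snd c))" by blast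
  obtain q rs q' as where e: "trs ! r = (q, rs, q', as)" by (cases "trs ! r") auto
  then have "(q, rs, q', as) \<in> tm_trans M" using r trs nth_mem[of r trs] by auto
  moreover have "c = (q, snd c)" "rs = map read_tape (snd c)"
    using r(2) e by (auto simp: reads_def ext_tapes_def intro: prod_eqI)
  moreover have "d = (q', map2 act_tape as (snd c))" using r(3) e by (simp add: acts_def)
  ultimately show "tm_step M c d" using tm_step.intros[of q "snd c" q' as M] by metis
qed

lemma ext_tapes_acts:
  assumes "r < m"
  shows "ext_tapes (fst (acts r ! 0), map2 act_tape (tl (acts r)) (snd c)) =
    map2 act_tape (acts r) (ext_tapes c)"
proof -
  obtain q rs q' as where e: "trs ! r = (q, rs, q', as)" by (cases "trs ! r") auto
  then have "acts r = (q', Stay) # as" by (simp add: acts_def)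
  then show ?thesis using ext_tapes_step[of q' as "snd c" "fst c"] by simp
qed

lemma ext_tapes_init:
  assumes "p < k"
  shows "fst (ext_tapes (initial_config M x) ! p) (int i - int T) = init p i"
    "snd (ext_tapes (initial_config M x) ! p) = 0"
proof -
  have k: "0 < tm_tapes M" using wf unfolding wf_tm_def by simp
  consider "p = 0" | "p = 1" | q where "p = Suc (Suc q)" by (cases p; cases "p - 1") auto
  then show "fst (ext_tapes (initial_config M x) ! p) (int i - int T) = init p i"
    "snd (ext_tapes (initial_config M x) ! p) = 0"
  proof (atomize(full), cases)
    case 2
    have "0 \<le> int i - int T \<longleftrightarrow> T \<le> i" "nat (int i - int T) = i - T" by auto
    moreover have "T \<le> i \<Longrightarrow> int i - int T < int (length x) \<longleftrightarrow> i - T < length x" by linarith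
    ultimately show "fst (ext_tapes (initial_config M x) ! p) (int i - int T) = init p i \<and>
      snd (ext_tapes (initial_config M x) ! p) = 0"
      using 2 by (auto simp: ext_tapes_def initial_config_def init_def tape_contents_def)
  next
    case 3
    then show "fst (ext_tapes (initial_config M x) ! p) (int i - int T) = init p i \<and>
      snd (ext_tapes (initial_config M x) ! p) = 0"
      using assms k by (auto simp: ext_tapes_def initial_config_def init_def tape_contents_def)
  qed (auto simp: ext_tapes_def initial_config_def init_def)
qed

lemma length_ext_init: "length (ext_tapes (initial_config M x)) = k"
  using wf unfolding wf_tm_def by (simp add: ext_tapes_def initial_config_def)

lemma bounds: "T < b" "Suc T < b" "2 * T + 2 < b" "k < b" "m < b" "tm_final M < b" "tm_start M < b"
  "10 < b" "c0 \<le> b"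
  using c0 by (auto simp: b_def)

lemma head_offset_cases: "head_offset d = -1 \<or> head_offset d = 0 \<or> head_offset d = 1"
  by (cases d) auto

end

section \<open>Satisfying assignments yield accepting runs\<close>

locale tableau_sound = tableau +
  fixes \<sigma> :: "nat \<Rightarrow> nat \<Rightarrow> nat \<Rightarrow> nat \<Rightarrow> nat \<Rightarrow> bool"
  assumes sat: "tab_sat \<sigma>"
begin

abbreviation "head t p i \<equiv> \<sigma> 0 t p i 0"
abbreviation "cell t p i a \<equiv> \<sigma> 1 t p i a"
abbreviation "taken t r \<equiv> \<sigma> 2 t 0 0 r"

lemma clause:
  assumes "K < b" "t < b" "p < b" "i < b" "a < b" "c < b"
    and "k' < b" "t' < b" "p' < b" "i' < b" "a' < b" "lit_rel K t p i a c k' t' p' i' a' s"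
  obtains k' t' p' i' a' where "k' < b" "t' < b" "p' < b" "i' < b" "a' < b"
    "lit_rel K t p i a c k' t' p' i' a' (\<sigma> k' t' p' i' a')"
proof -
  have "\<exists>k'<b. \<exists>t'<b. \<exists>p'<b. \<exists>i'<b. \<exists>a'<b. \<exists>s. lit_rel K t p i a c k' t' p' i' a' s"
    using assms(7-12) by blast
  from sat[unfolded tab_sat_def, rule_format, OF assms(1-6) this] show thesis using that by blast
qed

lemma init_less: "init p i < b" using c0 by (auto simp: init_def b_def)

lemma cell_init: assumes "p < b" "i < b" shows "cell 0 p i (init p i)"
proof -
  obtain k' t' p' i' a' where "lit_rel 0 0 p i 0 0 k' t' p' i' a' (\<sigma> k' t' p' i' a')"
    by (rule clause[of 0 0 p i 0 0 1 0 p i "init p i" True])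
      (use assms bounds init_less in \<open>auto simp: lit_rel_simps\<close>)
  then show ?thesis by (auto simp: lit_rel_simps)
qed

lemma head_init: assumes "p < k" shows "head 0 p T"
proof -
  obtain k' t' p' i' a' where "lit_rel 1 0 p 0 0 0 k' t' p' i' a' (\<sigma> k' t' p' i' a')"
    by (rule clause[of 1 0 p 0 0 0 0 0 p T 0 True])
      (use assms bounds in \<open>auto simp: lit_rel_simps\<close>)
  then show ?thesis by (auto simp: lit_rel_simps)
qed

lemma trans_or_final: assumes "t < b" shows "(\<exists>r<m. taken t r) \<or> cell t 0 T (tm_final M)"
proof -
  obtain k' t' p' i' a' where "lit_rel 2 t 0 0 0 0 k' t' p' i' a' (\<sigma> k' t' p' i' a')"
    by (rule clause[of 2 t 0 0 0 0 1 t 0 T "tm_final M" True])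
      (use assms bounds in \<open>auto simp: lit_rel_simps\<close>)
  then show ?thesis by (auto simp: lit_rel_simps)
qed

lemma read_cell:
  assumes "t < b" "p < k" "i < b" "r < m" "taken t r" "head t p i"
  shows "cell t p i (reads r ! p)"
proof -
  obtain k' t' p' i' a' where "lit_rel 3 t p i r 0 k' t' p' i' a' (\<sigma> k' t' p' i' a')"
    by (rule clause[of 3 t p i r 0 0 t p i 0 False])
      (use assms bounds in \<open>auto simp: lit_rel_simps\<close>)
  then show ?thesis using assms by (auto simp: lit_rel_simps RD_def)
qed

lemma write_cell:
  assumes "t < b" "p < k" "i < b" "r < m" "taken t r" "head t p i"
  shows "cell (Suc t) p i (fst (acts r ! p))"
proof -
  obtain k' t' p' i' a' where "lit_rel 4 t p i r 0 k' t' p' i' a' (\<sigma> k' t' p' i' a')"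
    by (rule clause[of 4 t p i r 0 0 t p i 0 False])
      (use assms bounds in \<open>auto simp: lit_rel_simps\<close>)
  then show ?thesis using assms by (auto simp: lit_rel_simps WR_def)
qed

lemma move_head:
  assumes "t < b" "p < k" "i < b" "r < m" "taken t r" "head t p i"
    and "int j = int i + head_offset (snd (acts r ! p))"
  shows "head (Suc t) p j"
proof -
  obtain k' t' p' i' a' where "lit_rel 5 t p i r 0 k' t' p' i' a' (\<sigma> k' t' p' i' a')"
    by (rule clause[of 5 t p i r 0 0 t p i 0 False])
      (use assms bounds in \<open>auto simp: lit_rel_simps\<close>)
  then have "head (Suc t) p i' \<and> i \<le> Suc i' \<and> Suc i' - i = nat (1 + head_offset (snd (acts r ! p)))"
    using assms by (auto simp: lit_rel_simps MV_def)
  \<comment> \<open>Subtraction truncates; \<open>i \<le> Suc i'\<close> is what lets the shifted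
    difference determine \<open>i'\<close>.\<close>
  moreover from this have "i' = j"
    using assms(7) head_offset_cases[of "snd (acts r ! p)"] by auto
  ultimately show ?thesis by simp
qed

lemma keep_cell:
  assumes "t < T" "p < b" "i < b" "a < b" "\<not> head t p i" "cell t p i a"
  shows "cell (Suc t) p i a"
proof -
  obtain k' t' p' i' a' where "lit_rel 6 t p i a 0 k' t' p' i' a' (\<sigma> k' t' p' i' a')"
    by (rule clause[of 6 t p i a 0 0 t p i 0 True])
      (use assms bounds in \<open>auto simp: lit_rel_simps\<close>)
  then show ?thesis using assms by (auto simp: lit_rel_simps)
qed

lemma cell_unique:
  assumes "t < b" "p < b" "i < b" "a < b" "c < b" "cell t p i a" "cell t p i c"
  shows "a = c"
proof (rule ccontr)
  assume ne: "a \<noteq> c"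
  obtain k' t' p' i' a' where "lit_rel 7 t p i a c k' t' p' i' a' (\<sigma> k' t' p' i' a')"
    by (rule clause[of 7 t p i a c 1 t p i a False])
      (use assms ne bounds in \<open>auto simp: lit_rel_simps\<close>)
  then show False using assms by (auto simp: lit_rel_simps)
qed

lemma head_unique:
  assumes "t < b" "p < b" "i < b" "j < b" "head t p i" "head t p j"
  shows "i = j"
proof (rule ccontr)
  assume ne: "i \<noteq> j"
  obtain k' t' p' i' a' where "lit_rel 8 t p i 0 j k' t' p' i' a' (\<sigma> k' t' p' i' a')"
    by (rule clause[of 8 t p i 0 j 0 t p i 0 False])
      (use assms ne bounds in \<open>auto simp: lit_rel_simps\<close>)
  then show False using assms by (auto simp: lit_rel_simps)
qed

lemma final_cell: "cell T 0 T (tm_final M)"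
proof -
  obtain k' t' p' i' a' where "lit_rel 9 0 0 0 0 0 k' t' p' i' a' (\<sigma> k' t' p' i' a')"
    by (rule clause[of 9 0 0 0 0 0 1 T 0 T "tm_final M" True])
      (use bounds in \<open>auto simp: lit_rel_simps\<close>)
  then show ?thesis by (auto simp: lit_rel_simps)
qed

text \<open>Only the cells at distance at most \<open>T\<close> from the origin are represented, and
  the bound on the head keeps it among them up to time \<open>T\<close>. Symbols must stay below
  \<open>b\<close>, since the uniqueness clauses speak of digits only.\<close>

definition matches :: "nat \<Rightarrow> tape list \<Rightarrow> bool" where
  "matches t us \<longleftrightarrow> length us = k \<and> (\<forall>p<k. \<bar>snd (us ! p)\<bar> \<le> int t \<and>
     head t p (nat (snd (us ! p) + int T)) \<and>
     (\<forall>i\<le>2 * T. fst (us ! p) (int i - int T) < b \<and> cell t p i (fst (us ! p) (int i - int T))))"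

lemma matches_init: "matches 0 (ext_tapes (initial_config M x))"
  unfolding matches_def
  using length_ext_init ext_tapes_init head_init cell_init init_less bounds by auto

lemma matches_step:
  assumes t: "t < T" and m: "matches t (ext_tapes c)" and r: "r < m" "taken t r"
  shows "map read_tape (ext_tapes c) = reads r \<and> matches (Suc t) (map2 act_tape (acts r) (ext_tapes c))"
proof -
  let ?us = "ext_tapes c"
  have len: "length ?us = k" using m unfolding matches_def by simp
  have tb: "t < b" using t bounds by simp
  have pos: "\<bar>snd (?us ! p)\<bar> \<le> int t" "head t p (nat (snd (?us ! p) + int T))" if "p < k" for p
    using m that unfolding matches_def by auto
  have cel: "fst (?us ! p) (int i - int T) < b" "cell t p i (fst (?us ! p) (int i - int T))"
    if "p < k" "i \<le> 2 * T" for p i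
    using m that unfolding matches_def by auto
  have rd: "read_tape (?us ! p) = reads r ! p" if p: "p < k" for p
  proof -
    let ?i = "nat (snd (?us ! p) + int T)"
    have i: "?i \<le> 2 * T" "int ?i - int T = snd (?us ! p)" using pos(1)[OF p] t by auto
    have "cell t p ?i (reads r ! p)"
      using read_cell[OF tb p _ r] pos(2)[OF p] i bounds by auto
    moreover have "cell t p ?i (fst (?us ! p) (snd (?us ! p)))" "fst (?us ! p) (snd (?us ! p)) < b"
      using cel[OF p i(1)] i(2) by auto
    ultimately have "fst (?us ! p) (snd (?us ! p)) = reads r ! p"
      using cell_unique[of t p ?i] tb p i bounds trs_bounds[OF r(1) p] by auto
    then show ?thesis by (cases "?us ! p") auto
  qed
  then have "map read_tape ?us = reads r"
    using len trs_lengths[OF r(1)] by (intro nth_equalityI) auto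
  moreover have "matches (Suc t) (map2 act_tape (acts r) ?us)"
    unfolding matches_def
  proof (intro conjI allI impI)
    show "length (map2 act_tape (acts r) ?us) = k" using len trs_lengths[OF r(1)] by simp
    fix p assume p: "p < k"
    obtain f h where fh: "?us ! p = (f, h)" by (cases "?us ! p") auto
    obtain a d where ad: "acts r ! p = (a, d)" by (cases "acts r ! p") auto
    have nth: "map2 act_tape (acts r) ?us ! p = (f(h := a), h + head_offset d)"
      using len trs_lengths[OF r(1)] p fh ad by simp
    have h: "\<bar>h\<bar> \<le> int t" "head t p (nat (h + int T))" using pos[OF p] fh by auto
    have hb: "nat (h + int T) < b" using h(1) t bounds by linarith
    show "\<bar>snd (map2 act_tape (acts r) ?us ! p)\<bar> \<le> int (Suc t)"
      unfolding nth using h(1) head_offset_cases[of d] by auto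
    have "int (nat (h + head_offset d + int T)) = int (nat (h + int T)) + head_offset d"
      using h(1) head_offset_cases[of d] t by auto
    from move_head[OF tb p hb r h(2), of "nat (h + head_offset d + int T)"] this
    show "head (Suc t) p (nat (snd (map2 act_tape (acts r) ?us ! p) + int T))"
      unfolding nth by (simp add: ad)
    fix i assume i: "i \<le> 2 * T"
    have ib: "i < b" using i bounds by linarith
    show "fst (map2 act_tape (acts r) ?us ! p) (int i - int T) < b"
      unfolding nth using cel[OF p i] fh trs_bounds[OF r(1) p] ad bounds by auto
    show "cell (Suc t) p i (fst (map2 act_tape (acts r) ?us ! p) (int i - int T))"
    proof (cases "int i - int T = h")
      case True
      then have "i = nat (h + int T)" by auto
      then show ?thesis unfolding nth using write_cell[OF tb p ib r] h(2) True ad by auto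
    next
      case False
      then have "i \<noteq> nat (h + int T)" using h(1) t by auto
      then have "\<not> head t p i" using head_unique[OF tb _ ib hb _ h(2)] p bounds by auto
      then show ?thesis unfolding nth
        using keep_cell[OF t _ ib cel(1)[OF p i] _ cel(2)[OF p i]] p bounds fh False by auto
    qed
  qed
  ultimately show ?thesis by blast
qed

lemma final_of_cell:
  assumes "t \<le> T" "matches t (ext_tapes c)" "cell t 0 T (tm_final M)"
  shows "fst c = tm_final M"
proof -
  have "fst (ext_tapes c ! 0) (int T - int T) < b \<and> cell t 0 T (fst (ext_tapes c ! 0) (int T - int T))"
  proof -
    have "0 < k" "T \<le> 2 * T" by auto
    then show ?thesis using assms(2) unfolding matches_def by blast
  qed
  then have "fst c < b" "cell t 0 T (fst c)" by (auto simp: ext_tapes_def)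
  then show ?thesis using cell_unique[of t 0 T "fst c" "tm_final M"] assms bounds by auto
qed

text \<open>Once the final state shows up, no transition has to be taken and the simulation stops;
  hence the alternative of an earlier acceptance.\<close>

lemma run:
  assumes "t \<le> T"
  shows "(\<exists>t'\<le>t. accepts_in M x t') \<or>
    (\<exists>c. (tm_step M ^^ t) (initial_config M x) c \<and> matches t (ext_tapes c))"
  using assms
proof (induction t)
  case 0
  then show ?case using matches_init by auto
next
  case (Suc t)
  then consider t' where "t' \<le> t" "accepts_in M x t'"
    | c where "(tm_step M ^^ t) (initial_config M x) c" "matches t (ext_tapes c)"
    by auto
  then show ?case
  proof cases
    case 1
    then show ?thesis by (meson le_SucI)
  next
    case 2
    have tb: "t < b" "t < T" using Suc.prems bounds by auto
    from trans_or_final[OF tb(1)] show ?thesis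
    proof
      assume "cell t 0 T (tm_final M)"
      then have "fst c = tm_final M" using final_of_cell[of t c] 2 Suc.prems by simp
      then have "accepts_in M x t" unfolding accepts_in_def using 2(1) by (metis prod.collapse)
      then show ?thesis by (meson le_Suc_eq order_refl)
    next
      assume "\<exists>r<m. taken t r"
      then obtain r where r: "r < m" "taken t r" by blast
      let ?d = "(fst (acts r ! 0), map2 act_tape (tl (acts r)) (snd c))"
      from matches_step[OF tb(2) 2(2) r]
      have "tm_step M c ?d" "matches (Suc t) (ext_tapes ?d)"
        using tm_step_iff r ext_tapes_acts[OF r(1), of c] by auto
      then show ?thesis using 2(1) by auto
    qed
  qed
qed

lemma accepts: "\<exists>t\<le>T. accepts_in M x t"
proof -
  from run[of T] consider "\<exists>t\<le>T. accepts_in M x t"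
    | c where "(tm_step M ^^ T) (initial_config M x) c" "matches T (ext_tapes c)"
    by auto
  then show ?thesis
  proof cases
    case 2
    then have "fst c = tm_final M" using final_of_cell[of T c] final_cell by simp
    then have "accepts_in M x T" unfolding accepts_in_def using 2(1) by (metis prod.collapse)
    then show ?thesis by blast
  qed
qed

end

section \<open>Accepting runs yield satisfying assignments\<close>

locale tableau_complete = tableau +
  fixes f :: "nat \<Rightarrow> config" and t0 :: nat
  assumes t0: "t0 \<le> T" and f0: "f 0 = initial_config M x" and ft0: "fst (f t0) = tm_final M"
    and fstep: "t < t0 \<Longrightarrow> tm_step M (f t) (f (Suc t))"
begin

text \<open>The accepting configuration is repeated forever, because clauses exist for all times
  below \<open>b\<close>.\<close>

definition us :: "nat \<Rightarrow> tape list" where "us t = ext_tapes (f (min t t0))"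

definition rho :: "nat \<Rightarrow> nat" where
  "rho t = (SOME r. r < m \<and> map read_tape (us t) = reads r \<and> us (Suc t) = map2 act_tape (acts r) (us t))"

text \<open>Numbers from \<open>k\<close> on denote no tape. Their cells hold 0, as
  \<open>init\<close> demands, and they have no head, so the frame clauses keep these cells.\<close>

definition \<sigma> :: "nat \<Rightarrow> nat \<Rightarrow> nat \<Rightarrow> nat \<Rightarrow> nat \<Rightarrow> bool" where
  "\<sigma> k' t p i a = (if k' = 0 then p < k \<and> int i = snd (us t ! p) + int T
     else if k' = 1 then a = (if p < k then fst (us t ! p) (int i - int T) else 0)
     else t < t0 \<and> a = rho t)"

lemma \<sigma>_simps:
  "\<sigma> 0 t p i a \<longleftrightarrow> p < k \<and> int i = snd (us t ! p) + int T"
  "\<sigma> (Suc 0) t p i a \<longleftrightarrow> a = (if p < k then fst (us t ! p) (int i - int T) else 0)"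
  "\<sigma> 2 t p i a \<longleftrightarrow> t < t0 \<and> a = rho t"
  by (simp_all add: \<sigma>_def)

lemma rho:
  assumes "t < t0"
  shows "rho t < m" "map read_tape (us t) = reads (rho t)"
    "us (Suc t) = map2 act_tape (acts (rho t)) (us t)"
proof -
  have mt: "min t t0 = t" "min (Suc t) t0 = Suc t" using assms by auto
  obtain r where r: "r < m" "map read_tape (ext_tapes (f t)) = reads r"
    "f (Suc t) = (fst (acts r ! 0), map2 act_tape (tl (acts r)) (snd (f t)))"
    using fstep[OF assms] tm_step_iff by blast
  then have "us (Suc t) = map2 act_tape (acts r) (us t)"
    using ext_tapes_acts[OF r(1), of "f t"] by (simp add: us_def mt)
  then have "\<exists>r. r < m \<and> map read_tape (us t) = reads r \<and> us (Suc t) = map2 act_tape (acts r) (us t)"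
    using r by (auto simp: us_def mt)
  then have "rho t < m \<and> map read_tape (us t) = reads (rho t) \<and>
      us (Suc t) = map2 act_tape (acts (rho t)) (us t)"
    unfolding rho_def by (rule someI_ex)
  then show "rho t < m" "map read_tape (us t) = reads (rho t)"
    "us (Suc t) = map2 act_tape (acts (rho t)) (us t)" by auto
qed

lemma us_idle: "t0 \<le> t \<Longrightarrow> us t = us t0"
  by (simp add: us_def)

lemma us_0: "us 0 = ext_tapes (initial_config M x)"
  by (simp add: us_def f0)

lemma length_us: "length (us t) = k"
proof (induction t)
  case 0
  then show ?case by (simp add: us_0 length_ext_init)
next
  case (Suc t)
  show ?case
  proof (cases "t < t0")
    case True
    then show ?thesis using rho[OF True] Suc trs_lengths[OF rho(1)[OF True]] by simp
  next
    case False
    then show ?thesis using us_idle[of t] us_idle[of "Suc t"] Suc by simp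
  qed
qed

lemma us_step:
  assumes "t < t0" "p < k"
  shows "us (Suc t) ! p = act_tape (acts (rho t) ! p) (us t ! p)"
  using rho[OF assms(1)] length_us[of t] trs_lengths[OF rho(1)[OF assms(1)]] assms(2) by simp

lemma us_read:
  assumes "t < t0" "p < k"
  shows "fst (us t ! p) (snd (us t ! p)) = reads (rho t) ! p"
proof -
  have "read_tape (us t ! p) = map read_tape (us t) ! p" using assms length_us by simp
  then have "read_tape (us t ! p) = reads (rho t) ! p" using rho[OF assms(1)] by simp
  then show ?thesis by (cases "us t ! p") simp
qed

lemma us_pos:
  assumes "p < k"
  shows "\<bar>snd (us t ! p)\<bar> \<le> int (min t t0)"
proof (induction t)
  case 0
  then show ?case using ext_tapes_init(2)[OF assms] by (simp add: us_0)
next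
  case (Suc t)
  show ?case
  proof (cases "t < t0")
    case True
    obtain g h where gh: "us t ! p = (g, h)" by (cases "us t ! p") auto
    obtain a d where ad: "acts (rho t) ! p = (a, d)" by (cases "acts (rho t) ! p") auto
    have "snd (us (Suc t) ! p) = h + head_offset d" using us_step[OF True assms] gh ad by simp
    moreover have "\<bar>h\<bar> \<le> int t" using Suc gh True by simp
    ultimately show ?thesis using True head_offset_cases[of d] by auto
  next
    case False
    then have "us (Suc t) = us t" using us_idle[of t] us_idle[of "Suc t"] by simp
    then show ?thesis using Suc False by simp
  qed
qed

lemma us_pos_T: "p < k \<Longrightarrow> \<bar>snd (us t ! p)\<bar> \<le> int T"
  using us_pos[of p t] t0 by linarith

lemma us_final: "t0 \<le> t \<Longrightarrow> fst (us t ! 0) 0 = tm_final M"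
  using ft0 by (simp add: us_def ext_tapes_def)

lemma us_keep:
  assumes "p < k" "snd (us t ! p) \<noteq> j"
  shows "fst (us (Suc t) ! p) j = fst (us t ! p) j"
proof (cases "t < t0")
  case True
  obtain g h where gh: "us t ! p = (g, h)" by (cases "us t ! p") auto
  obtain a d where ad: "acts (rho t) ! p = (a, d)" by (cases "acts (rho t) ! p") auto
  show ?thesis using us_step[OF True assms(1)] gh ad assms(2) by simp
next
  case False
  then show ?thesis using us_idle[of t] us_idle[of "Suc t"] by simp
qed

lemma tab_sat_\<sigma>: "tab_sat \<sigma>"
  unfolding tab_sat_def
proof (intro allI impI)
  fix K t p i a c
  assume digits: "K < b" "t < b" "p < b" "i < b" "a < b" "c < b"
    and ne: "\<exists>k'<b. \<exists>t'<b. \<exists>p'<b. \<exists>i'<b. \<exists>a'<b. \<exists>s. lit_rel K t p i a c k' t' p' i' a' s"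
  let ?goal = "\<exists>k'<b. \<exists>t'<b. \<exists>p'<b. \<exists>i'<b. \<exists>a'<b.
    lit_rel K t p i a c k' t' p' i' a' (\<sigma> k' t' p' i' a')"
  have wit: ?goal if "lit_rel K t p i a c k' t' p' i' a' (\<sigma> k' t' p' i' a')"
    "k' < b" "t' < b" "p' < b" "i' < b" "a' < b" for k' t' p' i' a'
    using that by blast
  have b0: "0 < b" "Suc 0 < b" "2 < b" using bounds by auto
  \<comment> \<open>Kinds 3 to 5 are implications whose two premises appear as negative literals;
    only the case where both premises hold is left for below.\<close>
  have neg: ?goal if K: "K = 3 \<or> K = 4 \<or> K = 5" and no: "\<not> \<sigma> 2 t 0 0 a \<or> \<not> \<sigma> 0 t p i 0"
    using no
  proof
    assume "\<not> \<sigma> 2 t 0 0 a"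
    then show ?goal by (intro wit[of 2 t 0 0 a]) (use K digits b0 in \<open>auto simp: lit_rel_simps\<close>)
  next
    assume "\<not> \<sigma> 0 t p i 0"
    then show ?goal by (intro wit[of 0 t p i 0]) (use K digits b0 in \<open>auto simp: lit_rel_simps\<close>)
  qed
  have "K = 0 \<or> K = Suc 0 \<or> K = 2 \<or> K = 3 \<or> K = 4 \<or> K = 5 \<or> K = 6 \<or> K = 7 \<or> K = 8 \<or>
      K = 9 \<or> 10 \<le> K" by presburger
  then consider "K = 0" | "K = Suc 0" | "K = 2" | "K = 3" | "K = 4" | "K = 5" | "K = 6" | "K = 7"
    | "K = 8" | "K = 9" | "10 \<le> K" by blast
  then show ?goal
  proof cases
    case 1
    have "init p i < b" using c0 by (auto simp: init_def b_def)
    moreover have "\<sigma> (Suc 0) 0 p i (init p i)"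
    proof (cases "p < k")
      case True
      then show ?thesis using ext_tapes_init(1)[OF True, of i] by (simp add: \<sigma>_simps us_0)
    next
      case False
      have "0 < tm_tapes M" using wf unfolding wf_tm_def by simp
      then show ?thesis using False by (auto simp: \<sigma>_simps init_def)
    qed
    ultimately show ?goal
      by (intro wit[of "Suc 0" 0 p i "init p i"]) (use 1 digits b0 in \<open>auto simp: lit_rel_simps\<close>)
  next
    case 2
    then have p: "p < k" using ne by (auto simp: lit_rel_simps)
    have "\<sigma> 0 0 p T 0" using ext_tapes_init(2)[OF p] p by (simp add: \<sigma>_simps us_0)
    then show ?goal
      by (intro wit[of 0 0 p T 0]) (use 2 p digits b0 bounds in \<open>auto simp: lit_rel_simps\<close>)
  next
    case 3
    show ?goal
    proof (cases "t < t0")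
      case True
      have "\<sigma> 2 t 0 0 (rho t)" using True by (simp add: \<sigma>_simps)
      then show ?goal
        by (intro wit[of 2 t 0 0 "rho t"])
          (use 3 rho(1)[OF True] digits b0 bounds in \<open>auto simp: lit_rel_simps\<close>)
    next
      case False
      then have "\<sigma> (Suc 0) t 0 T (tm_final M)" using us_final[of t] by (simp add: \<sigma>_simps)
      then show ?goal
        by (intro wit[of "Suc 0" t 0 T "tm_final M"]) (use 3 digits b0 bounds in \<open>auto simp: lit_rel_simps\<close>)
    qed
  next
    case 4
    show ?goal
    proof (cases "\<sigma> 2 t 0 0 a \<and> \<sigma> 0 t p i 0")
      case True
      then have t: "t < t0" "a = rho t" "p < k" "int i - int T = snd (us t ! p)" by (auto simp: \<sigma>_simps)
      have "\<sigma> (Suc 0) t p i (reads a ! p)" using us_read[OF t(1,3)] t by (simp add: \<sigma>_simps)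
      moreover have "a < m" using rho(1)[OF t(1)] t by simp
      ultimately show ?goal
        by (intro wit[of "Suc 0" t p i "reads a ! p"])
          (use 4 t digits b0 bounds trs_bounds[of a p] in \<open>auto simp: lit_rel_simps RD_def\<close>)
    qed (use 4 neg in blast)
  next
    case 5
    show ?goal
    proof (cases "\<sigma> 2 t 0 0 a \<and> \<sigma> 0 t p i 0")
      case True
      then have t: "t < t0" "a = rho t" "p < k" "int i - int T = snd (us t ! p)" by (auto simp: \<sigma>_simps)
      obtain g h where gh: "us t ! p = (g, h)" by (cases "us t ! p") auto
      obtain w d where wd: "acts a ! p = (w, d)" by (cases "acts a ! p") auto
      have "\<sigma> (Suc 0) (Suc t) p i w" using us_step[OF t(1,3)] t gh wd by (simp add: \<sigma>_simps)
      moreover have "a < m" using rho(1)[OF t(1)] t by simp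
      moreover have "Suc t < b" using t(1) t0 bounds by simp
      ultimately show ?goal
        by (intro wit[of "Suc 0" "Suc t" p i w])
          (use 5 t wd digits b0 bounds trs_bounds[of a p] in \<open>auto simp: lit_rel_simps WR_def\<close>)
    qed (use 5 neg in blast)
  next
    case 6
    show ?goal
    proof (cases "\<sigma> 2 t 0 0 a \<and> \<sigma> 0 t p i 0")
      case True
      then have t: "t < t0" "a = rho t" "p < k" "int i = snd (us t ! p) + int T" by (auto simp: \<sigma>_simps)
      obtain g h where gh: "us t ! p = (g, h)" by (cases "us t ! p") auto
      obtain w d where wd: "acts a ! p = (w, d)" by (cases "acts a ! p") auto
      define j where "j = nat (h + head_offset d + int T)"
      have h: "snd (us (Suc t) ! p) = h + head_offset d" using us_step[OF t(1,3)] t gh wd by simp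
      have j: "int j = h + head_offset d + int T" "j \<le> 2 * T"
        using us_pos_T[OF t(3), of "Suc t"] unfolding h j_def by auto
      have "\<sigma> 0 (Suc t) p j 0" using j(1) t(3) h by (simp add: \<sigma>_simps)
      moreover have "a < m" using rho(1)[OF t(1)] t by simp
      moreover have "Suc t < b" using t(1) t0 bounds by simp
      moreover have "j < b" using j(2) bounds by simp
      moreover have "int i = h + int T" using t(4) gh by simp
      then have "i \<le> Suc j" "Suc j - i = nat (1 + head_offset d)"
        using j(1) head_offset_cases[of d] by auto
      then have "i \<le> Suc j" "(a, p, Suc j - i) \<in> MV" using wd t \<open>a < m\<close> by (auto simp: MV_def)
      ultimately show ?goal
        by (intro wit[of 0 "Suc t" p j 0]) (use 6 digits b0 in \<open>simp_all add: lit_rel_simps\<close>)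
    qed (use 6 neg in blast)
  next
    case 7
    then have t: "t < T" using ne by (auto simp: lit_rel_simps)
    consider "\<sigma> 0 t p i 0" | "\<not> \<sigma> (Suc 0) t p i a" | "\<not> \<sigma> 0 t p i 0" "\<sigma> (Suc 0) t p i a" by blast
    then show ?goal
    proof cases
      case 1
      then show ?goal by (intro wit[of 0 t p i 0]) (use 7 t digits b0 in \<open>auto simp: lit_rel_simps\<close>)
    next
      case 2
      then show ?goal by (intro wit[of "Suc 0" t p i a]) (use 7 t digits b0 in \<open>auto simp: lit_rel_simps\<close>)
    next
      case 3
      have "\<sigma> (Suc 0) (Suc t) p i a"
      proof (cases "p < k")
        case True
        then have "snd (us t ! p) \<noteq> int i - int T" using 3(1) by (auto simp: \<sigma>_simps)
        from us_keep[OF True this] show ?thesis using 3(2) True by (simp add: \<sigma>_simps)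
      next
        case False
        then show ?thesis using 3(2) by (simp add: \<sigma>_simps)
      qed
      then show ?goal
        by (intro wit[of "Suc 0" "Suc t" p i a]) (use 7 t digits b0 bounds in \<open>auto simp: lit_rel_simps\<close>)
    qed
  next
    case 8
    then have ac: "a \<noteq> c" using ne by (auto simp: lit_rel_simps)
    then have "\<not> \<sigma> (Suc 0) t p i a \<or> \<not> \<sigma> (Suc 0) t p i c" by (auto simp: \<sigma>_simps)
    then show ?goal
    proof
      assume "\<not> \<sigma> (Suc 0) t p i a"
      then show ?goal by (intro wit[of "Suc 0" t p i a]) (use 8 ac digits b0 in \<open>auto simp: lit_rel_simps\<close>)
    next
      assume "\<not> \<sigma> (Suc 0) t p i c"
      then show ?goal by (intro wit[of "Suc 0" t p i c]) (use 8 ac digits b0 in \<open>auto simp: lit_rel_simps\<close>)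
    qed
  next
    case 9
    then have ac: "i \<noteq> c" using ne by (auto simp: lit_rel_simps)
    then have "\<not> \<sigma> 0 t p i 0 \<or> \<not> \<sigma> 0 t p c 0" by (auto simp: \<sigma>_simps)
    then show ?goal
    proof
      assume "\<not> \<sigma> 0 t p i 0"
      then show ?goal by (intro wit[of 0 t p i 0]) (use 9 ac digits b0 in \<open>auto simp: lit_rel_simps\<close>)
    next
      assume "\<not> \<sigma> 0 t p c 0"
      then show ?goal by (intro wit[of 0 t p c 0]) (use 9 ac digits b0 in \<open>auto simp: lit_rel_simps\<close>)
    qed
  next
    case 10
    have "\<sigma> (Suc 0) T 0 T (tm_final M)" using us_final[OF t0] by (simp add: \<sigma>_simps)
    then show ?goal
      by (intro wit[of "Suc 0" T 0 T "tm_final M"]) (use 10 digits b0 bounds in \<open>auto simp: lit_rel_simps\<close>)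
  next
    case 11
    then show ?goal using ne by (auto simp: lit_rel_simps)
  qed
qed

end

theorem (in tableau) tab_sat_iff_accepts: "(\<exists>\<sigma>. tab_sat \<sigma>) \<longleftrightarrow> (\<exists>t\<le>T. accepts_in M x t)"
proof
  assume "\<exists>\<sigma>. tab_sat \<sigma>"
  then obtain \<sigma> where "tab_sat \<sigma>" by blast
  then interpret tableau_sound M trs c0 x T \<sigma> by unfold_locales
  show "\<exists>t\<le>T. accepts_in M x t" by (rule accepts)
next
  assume "\<exists>t\<le>T. accepts_in M x t"
  then obtain t ts where t: "t \<le> T" "(tm_step M ^^ t) (initial_config M x) (tm_final M, ts)"
    unfolding accepts_in_def by blast
  then obtain f where f: "f 0 = initial_config M x" "f t = (tm_final M, ts)"
    "\<And>i. i < t \<Longrightarrow> tm_step M (f i) (f (Suc i))" unfolding relpowp_fun_conv by blast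
  interpret tableau_complete M trs c0 x T f t by unfold_locales (use t f in auto)
  show "\<exists>\<sigma>. tab_sat \<sigma>" using tab_sat_\<sigma> by blast
qed

section \<open>Holes as cyclic sequences\<close>

definition cyclic_nbrs :: "nat \<Rightarrow> nat \<Rightarrow> nat \<Rightarrow> bool" where
  "cyclic_nbrs n i j \<longleftrightarrow> j = Suc i \<or> i = Suc j \<or> (i = 0 \<and> Suc j = n) \<or> (j = 0 \<and> Suc i = n)"

text \<open>Chords and edges are both covered by one equivalence on indices, in place of an equation
  between edge sets.\<close>

definition hole_seq :: "('a \<Rightarrow> 'a \<Rightarrow> bool) \<Rightarrow> nat \<Rightarrow> (nat \<Rightarrow> 'a) \<Rightarrow> bool" where
  "hole_seq A n v \<longleftrightarrow> 4 \<le> n \<and> inj_on v {..<n} \<and>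
     (\<forall>i<n. \<forall>j<n. A (v i) (v j) \<longleftrightarrow> cyclic_nbrs n i j)"

lemma Suc_mod_eq:
  assumes "i < n"
  shows "Suc i mod n = (if Suc i = n then 0 else Suc i)"
  using assms by auto

lemma hole_seq_of_is_hole:
  assumes "is_hole V E W"
  obtains v where "hole_seq (\<lambda>x y. {x, y} \<in> E) (card W) v" "v ` {..<card W} = W"
proof -
  from assms obtain vs where vs: "distinct vs" "3 \<le> length vs" "W = set vs"
    and E: "induced_edges E W = {{vs ! i, vs ! ((i + 1) mod length vs)} | i. i < length vs}"
    and c: "4 \<le> card W"
    unfolding is_hole_def is_cycle_def by auto
  let ?n = "length vs"
  have cn: "card W = ?n" using vs distinct_card by blast
  have "{vs ! i, vs ! j} \<in> E \<longleftrightarrow> cyclic_nbrs ?n i j" if ij: "i < ?n" "j < ?n" for i j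
  proof -
    have "{vs ! i, vs ! j} \<in> E \<longleftrightarrow> {vs ! i, vs ! j} \<in> induced_edges E W"
      using ij vs unfolding induced_edges_def by auto
    also have "\<dots> \<longleftrightarrow> (\<exists>k<?n. {vs ! i, vs ! j} = {vs ! k, vs ! (Suc k mod ?n)})"
      unfolding E by auto
    also have "\<dots> \<longleftrightarrow> (\<exists>k<?n. (i = k \<and> j = Suc k mod ?n) \<or> (j = k \<and> i = Suc k mod ?n))"
    proof (intro ex_cong1 conj_cong refl)
      fix k assume k: "k < ?n"
      have m: "Suc k mod ?n < ?n" using vs by (intro mod_less_divisor) auto
      show "({vs ! i, vs ! j} = {vs ! k, vs ! (Suc k mod ?n)}) =
        ((i = k \<and> j = Suc k mod ?n) \<or> (j = k \<and> i = Suc k mod ?n))"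
        unfolding doubleton_eq_iff
        by (metis ij k m nth_eq_iff_index_eq vs(1))
    qed
    also have "\<dots> \<longleftrightarrow> j = Suc i mod ?n \<or> i = Suc j mod ?n"
      using ij by auto
    also have "\<dots> \<longleftrightarrow> cyclic_nbrs ?n i j"
      unfolding Suc_mod_eq[OF ij(1)] Suc_mod_eq[OF ij(2)] cyclic_nbrs_def
      using ij by auto
    finally show ?thesis .
  qed
  then have "hole_seq (\<lambda>x y. {x, y} \<in> E) (card W) ((!) vs)"
    unfolding hole_seq_def cn using c cn vs(1) by (auto simp: inj_on_def nth_eq_iff_index_eq)
  moreover have "(!) vs ` {..<card W} = W"
    unfolding cn using vs(3) by (auto simp: in_set_conv_nth)
  ultimately show thesis using that by blast
qed

lemma is_hole_of_hole_seq:
  assumes h: "hole_seq (\<lambda>x y. {x, y} \<in> E) n v" and V: "v ` {..<n} \<subseteq> V"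
    and two: "\<And>e. e \<in> E \<Longrightarrow> card e = 2"
  shows "is_hole V E (v ` {..<n})" "card (v ` {..<n}) = n"
proof -
  have inj: "inj_on v {..<n}" and n: "4 \<le> n"
    and A: "\<And>i j. i < n \<Longrightarrow> j < n \<Longrightarrow> {v i, v j} \<in> E \<longleftrightarrow> cyclic_nbrs n i j"
    using h unfolding hole_seq_def by auto
  show c: "card (v ` {..<n}) = n" using inj by (simp add: card_image)
  let ?vs = "map v [0..<n]"
  have nth: "?vs ! i = v i" if "i < n" for i using that by simp
  have "induced_edges E (v ` {..<n}) = {{v i, v (Suc i mod n)} | i. i < n}"
  proof (intro equalityI subsetI)
    fix e assume e: "e \<in> induced_edges E (v ` {..<n})"
    then have eE: "e \<in> E" and eW: "e \<subseteq> v ` {..<n}" unfolding induced_edges_def by auto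
    obtain x y where "e = {x, y}" using two[OF eE] by (auto simp: card_2_iff)
    then obtain i j where ij: "i < n" "j < n" "e = {v i, v j}" using eW by auto
    then have "cyclic_nbrs n i j" using A eE by auto
    then have "j = Suc i mod n \<or> i = Suc j mod n"
      using ij Suc_mod_eq[of i n] Suc_mod_eq[of j n] unfolding cyclic_nbrs_def by auto
    then show "e \<in> {{v i, v (Suc i mod n)} | i. i < n}"
      using ij by (auto simp: insert_commute)
  next
    fix e assume "e \<in> {{v i, v (Suc i mod n)} | i. i < n}"
    then obtain i where i: "i < n" "e = {v i, v (Suc i mod n)}" by auto
    have m: "Suc i mod n < n" using n by (intro mod_less_divisor) auto
    have "cyclic_nbrs n i (Suc i mod n)"
      unfolding cyclic_nbrs_def using Suc_mod_eq[OF i(1)] by auto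
    then have "e \<in> E" using A i m by auto
    then show "e \<in> induced_edges E (v ` {..<n})"
      unfolding induced_edges_def using i m by auto
  qed
  also have "\<dots> = {{?vs ! i, ?vs ! ((i + 1) mod length ?vs)} | i. i < length ?vs}"
  proof -
    have "{v i, v (Suc i mod n)} = {?vs ! i, ?vs ! ((i + 1) mod length ?vs)}" if "i < n" for i
    proof -
      have "Suc i mod n < n" using n by (intro mod_less_divisor) auto
      then show ?thesis using that by simp
    qed
    then show ?thesis by (intro Collect_cong ex_cong1) auto
  qed
  finally have E: "induced_edges E (v ` {..<n}) =
    {{?vs ! i, ?vs ! ((i + 1) mod length ?vs)} | i. i < length ?vs}" .
  have d: "distinct ?vs" using inj by (auto simp: distinct_map atLeast0LessThan)
  have s: "v ` {..<n} = set ?vs" by (simp add: atLeast0LessThan)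
  have l: "3 \<le> length ?vs" using n by simp
  have "is_cycle (v ` {..<n}) (induced_edges E (v ` {..<n}))"
    unfolding is_cycle_def by (rule exI[of _ ?vs]) (use E d s l in blast)
  then show "is_hole V E (v ` {..<n})"
    unfolding is_hole_def c using V n by blast
qed

lemma even_hole_free_iff_hole_seq:
  assumes two: "\<And>e. e \<in> E \<Longrightarrow> card e = 2"
  shows "even_hole_free V E \<longleftrightarrow>
    (\<nexists>n v. hole_seq (\<lambda>x y. {x, y} \<in> E) n v \<and> v ` {..<n} \<subseteq> V \<and> even n)"
proof
  assume "even_hole_free V E"
  then show "\<nexists>n v. hole_seq (\<lambda>x y. {x, y} \<in> E) n v \<and> v ` {..<n} \<subseteq> V \<and> even n"
    unfolding even_hole_free_def using is_hole_of_hole_seq[OF _ _ two] by metis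
next
  assume *: "\<nexists>n v. hole_seq (\<lambda>x y. {x, y} \<in> E) n v \<and> v ` {..<n} \<subseteq> V \<and> even n"
  show "even_hole_free V E"
    unfolding even_hole_free_def
  proof
    assume "\<exists>W. is_hole V E W \<and> even (card W)"
    then obtain W where W: "is_hole V E W" "even (card W)" by auto
    then obtain v where "hole_seq (\<lambda>x y. {x, y} \<in> E) (card W) v" "v ` {..<card W} = W"
      using hole_seq_of_is_hole by blast
    moreover have "W \<subseteq> V" using W unfolding is_hole_def by auto
    ultimately show False using * W by metis
  qed
qed

lemma hole_seq_rotate1:
  assumes "hole_seq A n v"
  shows "hole_seq A n (\<lambda>i. v (if Suc i = n then 0 else Suc i))"
proof -
  have "inj_on (\<lambda>i. v (if Suc i = n then 0 else Suc i)) {..<n}"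
  proof (rule inj_onI)
    fix x y assume xy: "x \<in> {..<n}" "y \<in> {..<n}"
      "v (if Suc x = n then 0 else Suc x) = v (if Suc y = n then 0 else Suc y)"
    moreover have "(if Suc k = n then 0 else Suc k) \<in> {..<n}" if "k \<in> {..<n}" for k
      using that by auto
    ultimately have "(if Suc x = n then 0 else Suc x) = (if Suc y = n then 0 else Suc y)"
      using assms unfolding hole_seq_def inj_on_def by blast
    then show "x = y" by (auto split: if_splits)
  qed
  moreover have "cyclic_nbrs n (if Suc i = n then 0 else Suc i) (if Suc j = n then 0 else Suc j)
      \<longleftrightarrow> cyclic_nbrs n i j" if "i < n" "j < n" for i j
    using that assms unfolding cyclic_nbrs_def hole_seq_def by auto
  ultimately show ?thesis using assms unfolding hole_seq_def by auto
qed

lemma hole_seq_start_at: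
  assumes "hole_seq A n v" "i < n"
  obtains v' where "hole_seq A n v'" "v' ` {..<n} = v ` {..<n}" "v' 0 = v i"
  using assms
proof (induction i arbitrary: v thesis)
  case 0
  then show ?case by blast
next
  case (Suc i)
  let ?w = "\<lambda>i. v (if Suc i = n then 0 else Suc i)"
  have w: "hole_seq A n ?w" using Suc.prems hole_seq_rotate1 by blast
  have "?w ` {..<n} = v ` {..<n}"
  proof (intro equalityI subsetI)
    fix x assume "x \<in> v ` {..<n}"
    then obtain k where k: "k < n" "x = v k" by auto
    show "x \<in> ?w ` {..<n}"
    proof (cases k)
      case 0
      then show ?thesis using k by (intro image_eqI[of _ _ "n - 1"]) auto
    next
      case (Suc k')
      then show ?thesis using k by (intro image_eqI[of _ _ k']) auto
    qed
  qed auto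
  moreover obtain v' where "hole_seq A n v'" "v' ` {..<n} = ?w ` {..<n}" "v' 0 = ?w i"
    using Suc.IH[OF _ w] Suc.prems by auto
  ultimately show ?case using Suc.prems by auto
qed

section \<open>The sandwich instance of a line problem\<close>

text \<open>Position \<open>g\<close> is the path vertex \<open>W (2 * g + 1)\<close>. The hub \<open>H g\<close> chooses between the positions \<open>g\<close> and
  \<open>g + 1\<close>, the hub \<open>C j\<close> between the positions allowed for constraint \<open>j\<close>, and \<open>S g b\<close> compares the
  hubs at position \<open>g\<close> with one of \<open>H g\<close>, \<open>H (g - 1)\<close>.\<close>

datatype vert = W nat | H nat | C nat | S nat bool

fun is_hub :: "vert \<Rightarrow> bool" where
  "is_hub (H _) = True"
| "is_hub (C _) = True"
| "is_hub _ = False"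

definition own :: "nat \<Rightarrow> bool \<Rightarrow> vert" where
  "own g b = H (if b then g else g - 1)"

definition edges_on :: "'a set \<Rightarrow> ('a \<Rightarrow> 'a \<Rightarrow> bool) \<Rightarrow> 'a set set" where
  "edges_on V R = {{u, v} | u v. u \<in> V \<and> v \<in> V \<and> u \<noteq> v \<and> R u v}"

lemma edges_on_iff:
  "{u, v} \<in> edges_on V R \<longleftrightarrow> u \<in> V \<and> v \<in> V \<and> u \<noteq> v \<and> (R u v \<or> R v u)"
  unfolding edges_on_def by (auto simp: doubleton_eq_iff)

lemma simple_graph_edges_on: "finite V \<Longrightarrow> simple_graph V (edges_on V R)"
  unfolding simple_graph_def edges_on_def by auto

lemma edges_on_mono:
  assumes "\<And>u v. u \<in> V \<Longrightarrow> v \<in> V \<Longrightarrow> R u v \<Longrightarrow> R' u v \<or> R' v u"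
  shows "edges_on V R \<subseteq> edges_on V R'"
proof
  fix e assume "e \<in> edges_on V R"
  then obtain u v where e: "e = {u, v}" "u \<in> V" "v \<in> V" "u \<noteq> v" "R u v"
    unfolding edges_on_def by auto
  then have "R' u v \<or> R' v u" using assms by auto
  then show "e \<in> edges_on V R'" using e edges_on_iff[of u v V R'] by simp
qed

text \<open>\<open>P\<close> marks the positions at which hubs are compared; \<open>P_range\<close>
  makes both \<open>H (g - 1)\<close> and \<open>H g\<close> vertices there.
  \<open>Opt_not_adjacent\<close> ensures that a constraint hub choosing \<open>g + 1\<close> or
  \<open>g - 1\<close> lacks the option \<open>g\<close>, so that its edge to \<open>S g b\<close>
  is allowed.\<close>

locale line =
  fixes G J :: nat and P :: "nat \<Rightarrow> bool" and Opt :: "nat \<Rightarrow> nat \<Rightarrow> bool"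
  assumes P_range: "P g \<Longrightarrow> 0 < g \<and> Suc g < G"
    and Opt_P: "j < J \<Longrightarrow> Opt j g \<Longrightarrow> P g"
    and Opt_not_adjacent: "j < J \<Longrightarrow> Opt j g \<Longrightarrow> \<not> Opt j (Suc g)"
begin

fun opt :: "vert \<Rightarrow> nat \<Rightarrow> bool" where
  "opt (H g) d \<longleftrightarrow> d = g \<or> d = Suc g"
| "opt (C j) d \<longleftrightarrow> Opt j d"
| "opt _ _ \<longleftrightarrow> False"

text \<open>A constraint without options gets no hub: having nothing to choose, such a hub would
  close an even hole with the whole path.\<close>

definition verts :: "vert set" where
  "verts = W ` {..2 * G} \<union> {H g | g. Suc g < G} \<union> {C j | j. j < J \<and> (\<exists>g. Opt j g)} \<union>
     {S g b | g b. P g}"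

definition forced :: "vert \<Rightarrow> vert \<Rightarrow> bool" where
  "forced u v \<longleftrightarrow>
     (\<exists>i. u = W i \<and> v = W (Suc i)) \<or>
     (is_hub u \<and> is_hub v) \<or>
     (is_hub u \<and> (v = W 0 \<or> v = W (2 * G))) \<or>
     (\<exists>g b. u = S g b \<and> (v = W (2 * g + 1) \<or> v = own g b))"

definition optional :: "vert \<Rightarrow> vert \<Rightarrow> bool" where
  "optional u v \<longleftrightarrow>
     (\<exists>d. is_hub u \<and> opt u d \<and> v = W (2 * d + 1)) \<or>
     (\<exists>g b. u = S g b \<and> (v = W (2 * g) \<or> v = W (2 * g + 2) \<or> (is_hub v \<and> \<not> opt v g)))"

definition E1 :: "vert set set" where "E1 = edges_on verts forced"

definition E2 :: "vert set set" where "E2 = edges_on verts (\<lambda>u v. forced u v \<or> optional u v)"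

text \<open>This is all that the graph enforces: at a compared position its two line hubs agree, and
  a constraint hub may only go where they go.\<close>

definition solution :: "(vert \<Rightarrow> nat) \<Rightarrow> bool" where
  "solution l \<longleftrightarrow> (\<forall>d \<in> verts. is_hub d \<longrightarrow> opt d (l d)) \<and>
     (\<forall>g. P g \<longrightarrow> (l (H (g - 1)) = g \<longleftrightarrow> l (H g) = g)) \<and>
     (\<forall>g j. P g \<longrightarrow> C j \<in> verts \<longrightarrow> l (C j) = g \<longrightarrow> l (H g) = g)"

lemma verts_simps [simp]:
  "W i \<in> verts \<longleftrightarrow> i \<le> 2 * G"
  "H g \<in> verts \<longleftrightarrow> Suc g < G"
  "C j \<in> verts \<longleftrightarrow> j < J \<and> (\<exists>g. Opt j g)"
  "S g b \<in> verts \<longleftrightarrow> P g"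
  unfolding verts_def by auto

lemma finite_verts: "finite verts"
proof -
  have g: "g < G" if "P g" for g using P_range[OF that] by simp
  have "finite (H ` {..<G})" "finite (C ` {..<J})"
    "finite ((\<lambda>(g, b). S g b) ` ({..<G} \<times> UNIV))"
    by auto
  moreover have "{H g | g. Suc g < G} \<subseteq> H ` {..<G}" by auto
  moreover have "{C j | j. j < J \<and> (\<exists>g. Opt j g)} \<subseteq> C ` {..<J}" by auto
  moreover have "{S g b | g b. P g} \<subseteq> (\<lambda>(g, b). S g b) ` ({..<G} \<times> UNIV)"
    using g by force
  ultimately show ?thesis
    unfolding verts_def by (meson finite_UnI finite_imageI finite_atMost finite_subset)
qed

lemma own_in_verts: "P g \<Longrightarrow> own g b \<in> verts"
  using P_range[of g] by (auto simp: own_def)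

lemma opt_own: "P g \<Longrightarrow> opt (own g b) g"
  using P_range[of g] by (auto simp: own_def)

lemma opt_range: "d \<in> verts \<Longrightarrow> opt d g \<Longrightarrow> g < G"
proof (cases d)
  case (C j)
  assume "d \<in> verts" "opt d g"
  then have "P g" using C Opt_P by auto
  then show ?thesis using P_range[of g] by simp
qed auto

lemma is_hub_own [simp]: "is_hub (own g b)"
  by (simp add: own_def)

end

section \<open>Every sandwich graph contains a solution\<close>

locale line_sandwich = line +
  fixes E :: "vert set set"
  assumes simple: "simple_graph verts E"
    and E1E: "E1 \<subseteq> E" and EE2: "E \<subseteq> E2" and free: "even_hole_free verts E"
begin

abbreviation A :: "vert \<Rightarrow> vert \<Rightarrow> bool" where "A u v \<equiv> {u, v} \<in> E"

lemma A_sym: "A u v \<longleftrightarrow> A v u" by (simp add: insert_commute)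

lemma A_irrefl: "\<not> A u u"
proof
  assume "A u u"
  then have "card {u, u} = 2" using simple unfolding simple_graph_def by blast
  then show False by simp
qed

lemma A_forced: "u \<in> verts \<Longrightarrow> v \<in> verts \<Longrightarrow> u \<noteq> v \<Longrightarrow> forced u v \<or> forced v u \<Longrightarrow> A u v"
  using E1E edges_on_iff[of u v verts forced] unfolding E1_def by blast

lemma A_allowed: "A u v \<Longrightarrow> u \<in> verts \<and> v \<in> verts \<and> u \<noteq> v \<and>
    (forced u v \<or> optional u v \<or> forced v u \<or> optional v u)"
  using EE2 edges_on_iff[of u v verts "\<lambda>u v. forced u v \<or> optional u v"]
  unfolding E2_def by blast

lemma no_even_hole:
  assumes "hole_seq A n v" "v ` {..<n} \<subseteq> verts" "even n"
  shows False
proof -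
  have "card e = 2" if "e \<in> E" for e using simple that unfolding simple_graph_def by blast
  from even_hole_free_iff_hole_seq[OF this] show False using free assms by blast
qed

lemma A_W_W: "i \<le> 2 * G \<Longrightarrow> j \<le> 2 * G \<Longrightarrow> A (W i) (W j) \<longleftrightarrow> j = Suc i \<or> i = Suc j"
proof
  assume "A (W i) (W j)"
  from A_allowed[OF this] show "j = Suc i \<or> i = Suc j"
    by (auto simp: forced_def optional_def)
next
  assume "i \<le> 2 * G" "j \<le> 2 * G" "j = Suc i \<or> i = Suc j"
  then show "A (W i) (W j)" by (intro A_forced) (auto simp: forced_def)
qed

text \<open>The hub and the subpath form a hole with \<open>j - i + 2\<close> vertices. An even gap
  is at least 2, so this is never just a triangle.\<close>

lemma hub_gap_not_even:
  assumes d: "d \<in> verts" "is_hub d" and ij: "i < j" "j \<le> 2 * G" "even (j - i)"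
    and adj: "A d (W i)" "A d (W j)" and none: "\<And>k. i < k \<Longrightarrow> k < j \<Longrightarrow> \<not> A d (W k)"
  shows False
proof -
  define v where "v t = (case t of 0 \<Rightarrow> d | Suc s \<Rightarrow> W (i + s))" for t
  define n where "n = j - i + 2"
  have v0: "v 0 = d" and vS: "\<And>s. v (Suc s) = W (i + s)" by (auto simp: v_def)
  have dW: "d \<noteq> W k" for k using d by auto
  have gap: "2 \<le> j - i" using ij by (cases "j - i = 1") auto
  have dk: "A d (W (i + s)) \<longleftrightarrow> s = 0 \<or> s = j - i" if "s \<le> j - i" for s
  proof -
    have "s = 0 \<or> s = j - i \<or> (i < i + s \<and> i + s < j)" using that by auto
    then show ?thesis using adj none[of "i + s"] ij by auto
  qed
  have "hole_seq A n v"
    unfolding hole_seq_def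
  proof (intro conjI allI impI)
    show "4 \<le> n" using gap by (simp add: n_def)
    show "inj_on v {..<n}"
      by (rule inj_onI) (auto simp: v_def dW dW[symmetric] split: nat.splits)
    fix a b assume ab: "a < n" "b < n"
    show "A (v a) (v b) \<longleftrightarrow> cyclic_nbrs n a b"
    proof (cases a)
      case a0: 0
      show ?thesis
      proof (cases b)
        case 0
        then show ?thesis using a0 A_irrefl gap by (auto simp: cyclic_nbrs_def n_def)
      next
        case (Suc s)
        then show ?thesis using a0 ab dk[of s] gap by (auto simp: cyclic_nbrs_def n_def v0 vS)
      qed
    next
      case aS: (Suc r)
      show ?thesis
      proof (cases b)
        case 0
        then show ?thesis using aS ab dk[of r] gap
          by (subst A_sym) (auto simp: cyclic_nbrs_def n_def v0 vS)
      next
        case (Suc s)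
        have "i + r \<le> 2 * G" "i + s \<le> 2 * G" using aS Suc ab ij by (auto simp: n_def)
        then show ?thesis using aS Suc by (auto simp: vS A_W_W cyclic_nbrs_def n_def)
      qed
    qed
  qed
  moreover have "v ` {..<n} \<subseteq> verts"
    using d ij by (auto simp: v_def n_def split: nat.splits)
  moreover have "even n" using ij by (simp add: n_def)
  ultimately show False using no_even_hole by blast
qed

lemma hub_W_cases:
  assumes "is_hub d" "A d (W k)"
  shows "k = 0 \<or> k = 2 * G \<or> (\<exists>g. opt d g \<and> k = 2 * g + 1)"
  using A_allowed[OF assms(2)] assms(1) by (auto simp: forced_def optional_def)

lemma hub_ends:
  assumes "d \<in> verts" "is_hub d"
  shows "A d (W 0)" "A d (W (2 * G))"
proof -
  have "d \<noteq> W i" for i using assms by auto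
  then show "A d (W 0)" "A d (W (2 * G))"
    using A_forced[of d "W 0"] A_forced[of d "W (2 * G)"] assms
    unfolding forced_def by simp_all
qed

text \<open>Without a choice the whole path is a single gap, of even length
  \<open>2 * G\<close>.\<close>

lemma hub_ex_choice:
  assumes d: "d \<in> verts" "is_hub d" and G: "0 < G"
  obtains g where "opt d g" "A d (W (2 * g + 1))"
proof (rule ccontr)
  assume "\<not> thesis"
  with that have no: "\<And>g. opt d g \<Longrightarrow> \<not> A d (W (2 * g + 1))" by blast
  show False
  proof (rule hub_gap_not_even[OF d, of 0 "2 * G"])
    show "\<not> A d (W k)" if "0 < k" "k < 2 * G" for k
      using hub_W_cases[OF d(2), of k] no that by auto
  qed (use G hub_ends[OF d] in auto)
qed

text \<open>All positions sit at odd indices of the path. Hence the gap from a chosen position to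
  the next neighbour of the hub is even as long as that neighbour is again a position.\<close>

lemma hub_choice_unique_aux:
  assumes d: "d \<in> verts" "is_hub d" and g: "A d (W (2 * g + 1))" "A d (W (2 * g' + 1))" "g < g'"
    "g' < G"
  shows False
proof -
  define j where "j = (LEAST k. 2 * g + 1 < k \<and> A d (W k))"
  have ex: "2 * g + 1 < 2 * g' + 1 \<and> A d (W (2 * g' + 1))" using g by auto
  have j: "2 * g + 1 < j" "A d (W j)" using LeastI[of "\<lambda>k. 2 * g + 1 < k \<and> A d (W k)", OF ex]
    by (auto simp: j_def)
  have jle: "j \<le> 2 * g' + 1" unfolding j_def using ex by (intro Least_le)
  have "even (j - (2 * g + 1))"
    using hub_W_cases[OF d(2) j(2)] j jle g by auto
  then show False
  proof (intro hub_gap_not_even[OF d j(1) _ _ g(1) j(2)])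
    show "j \<le> 2 * G" using jle g by auto
    show "\<not> A d (W k)" if "2 * g + 1 < k" "k < j" for k
      using not_less_Least[of k "\<lambda>k. 2 * g + 1 < k \<and> A d (W k)"] that by (auto simp: j_def)
  qed
qed

lemma hub_choice_unique:
  assumes "d \<in> verts" "is_hub d" "opt d g" "opt d g'" "A d (W (2 * g + 1))" "A d (W (2 * g' + 1))"
  shows "g = g'"
proof (cases g g' rule: linorder_cases)
  case less
  then show ?thesis using hub_choice_unique_aux[OF assms(1,2,5,6)] opt_range[OF assms(1,4)] by blast
next
  case greater
  then show ?thesis using hub_choice_unique_aux[OF assms(1,2,6,5)] opt_range[OF assms(1,3)] by blast
qed

text \<open>Otherwise \<open>d\<close>, \<open>W (2 * g + 1)\<close>, \<open>S g b\<close>,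
  \<open>own g b\<close> form a hole on four vertices. The diagonal from \<open>d\<close> to
  \<open>S g b\<close> is not in \<open>E2\<close>: apart from its own hub, \<open>S g b\<close> may
  only see hubs without the option \<open>g\<close>.\<close>

lemma choice_propagates:
  assumes g: "P g" and d: "d \<in> verts" "is_hub d" "opt d g" and adj: "A d (W (2 * g + 1))"
  shows "A (own g b) (W (2 * g + 1))"
proof (rule ccontr)
  assume no: "\<not> A (own g b) (W (2 * g + 1))"
  then have ne: "d \<noteq> own g b" using adj by metis
  define w where "w = W (2 * g + 1)"
  define s where "s = S g b"
  define h where "h = own g b"
  define v where "v t = (if t = 0 then d else if t = 1 then w else if t = 2 then s else h)"
    for t :: nat
  have V: "w \<in> verts" "s \<in> verts" "h \<in> verts"
    using g P_range[OF g] own_in_verts[OF g] by (auto simp: w_def s_def h_def)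
  have dist: "d \<noteq> w" "d \<noteq> s" "d \<noteq> h" "w \<noteq> s" "w \<noteq> h" "s \<noteq> h"
    using d ne by (auto simp: w_def s_def h_def own_def)
  have f: "forced s w" "forced s h" "forced h d"
    using d by (auto simp: forced_def w_def s_def h_def)
  have a: "A d w" "A w s" "A s h" "A h d"
    using adj A_forced[OF V(1,2) dist(4)] A_forced[OF V(2,3) dist(6)]
      A_forced[OF V(3) d(1) dist(3)[symmetric]] f by (simp_all add: w_def)
  have a': "A w d" "A s w" "A h s" "A d h" using a by (simp_all add: insert_commute)
  have "\<not> A d s"
  proof
    assume "A d s"
    from A_allowed[OF this] show False using d dist
      by (auto simp: forced_def optional_def s_def h_def)
  qed
  then have na: "\<not> A d s" "\<not> A w h" using no by (simp_all add: w_def h_def insert_commute)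
  have na': "\<not> A s d" "\<not> A h w" using na by (simp_all add: insert_commute)
  have four: "t < 4 \<Longrightarrow> t = 0 \<or> t = 1 \<or> t = 2 \<or> t = (3::nat)" for t by auto
  have "hole_seq A 4 v"
    unfolding hole_seq_def
  proof (intro conjI allI impI)
    show "inj_on v {..<4}"
      by (rule inj_onI) (use dist dist[symmetric] in \<open>auto simp: v_def split: if_splits\<close>)
    fix i j :: nat assume "i < 4" "j < 4"
    then have "i = 0 \<or> i = 1 \<or> i = 2 \<or> i = 3" "j = 0 \<or> j = 1 \<or> j = 2 \<or> j = 3"
      using four by auto
    then show "A (v i) (v j) \<longleftrightarrow> cyclic_nbrs 4 i j"
      using a na a' na' A_irrefl[of d] A_irrefl[of w] A_irrefl[of s] A_irrefl[of h]
      by (elim disjE) (simp_all add: v_def cyclic_nbrs_def del: insert_absorb2)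
  qed auto
  moreover have "v ` {..<4} \<subseteq> verts" using V d by (auto simp: v_def)
  ultimately show False using no_even_hole[of 4 v] by simp
qed

lemma ex_solution: "\<exists>l. solution l"
proof -
  define l where "l d = (SOME g. opt d g \<and> A d (W (2 * g + 1)))" for d
  have l: "opt d (l d)" "A d (W (2 * l d + 1))" if d: "d \<in> verts" "is_hub d" for d
  proof -
    have "0 < G"
    proof (cases d)
      case (C j)
      then obtain g where "P g" using d Opt_P by auto
      then show ?thesis using P_range by fastforce
    qed (use d in auto)
    then obtain g where "opt d g" "A d (W (2 * g + 1))" using hub_ex_choice[OF d] by blast
    then have "\<exists>g. opt d g \<and> A d (W (2 * g + 1))" by blast
    then have "opt d (l d) \<and> A d (W (2 * l d + 1))"
      unfolding l_def by (rule someI_ex)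
    then show "opt d (l d)" "A d (W (2 * l d + 1))" by auto
  qed
  have propag: "l (own g b) = g" if "P g" "d \<in> verts" "is_hub d" "opt d g" "l d = g" for g b d
  proof -
    have "A (own g b) (W (2 * g + 1))"
      using choice_propagates[OF that(1-4), of b] l(2)[OF that(2,3)] that(5) by simp
    then show ?thesis
      using hub_choice_unique[OF own_in_verts[OF that(1)] is_hub_own]
        l[OF own_in_verts[OF that(1)] is_hub_own] opt_own[OF that(1)] by blast
  qed
  have own: "l (H (g - 1)) = g \<longleftrightarrow> l (H g) = g" if "P g" for g
    using propag[OF that own_in_verts[OF that] _ opt_own[OF that], of True False]
      propag[OF that own_in_verts[OF that] _ opt_own[OF that], of False True]
    by (auto simp: own_def)
  have "l (H g) = g" if "P g" "C j \<in> verts" "l (C j) = g" for g j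
    using propag[OF that(1) that(2) _ _ that(3), of True] l(1)[OF that(2)] that by (simp add: own_def)
  then show ?thesis unfolding solution_def using l own by blast
qed

end

lemma (in line) solution_of_sandwich:
  assumes "has_even_hole_free_sandwich verts E1 E2"
  shows "\<exists>l. solution l"
proof -
  from assms obtain E where "simple_graph verts E" "E1 \<subseteq> E" "E \<subseteq> E2" "even_hole_free verts E"
    unfolding has_even_hole_free_sandwich_def by auto
  then interpret line_sandwich G J P Opt E by unfold_locales auto
  show ?thesis by (rule ex_solution)
qed

section \<open>Every solution yields a sandwich graph\<close>

locale line_solution = line +
  fixes l :: "vert \<Rightarrow> nat"
  assumes sol: "solution l"
begin

abbreviation chosen :: "nat \<Rightarrow> bool" where "chosen g \<equiv> l (H g) = g"

text \<open>At an unchosen position, \<open>H g\<close> has moved to \<open>g + 1\<close> and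
  \<open>H (g - 1)\<close> to \<open>g - 1\<close>. \<open>S g b\<close> then sees every hub that
  made the same choice as its own hub; seeing only its own hub would leave even holes through two
  hubs.\<close>

fun hub_sees :: "vert \<Rightarrow> vert \<Rightarrow> bool" where
  "hub_sees k (W i) \<longleftrightarrow> i = 0 \<or> i = 2 * l k + 1 \<or> i = 2 * G"
| "hub_sees k (S g b) \<longleftrightarrow>
     (if chosen g then k = own g b else l k = (if b then Suc g else g - 1))"
| "hub_sees k _ \<longleftrightarrow> True"

text \<open>At an unchosen \<open>g\<close>, the hubs seen by \<open>S g True\<close> choose
  \<open>W (2 * g + 3)\<close>, and \<open>S g True\<close> is glued to the edge from
  \<open>W (2 * g)\<close> to \<open>W (2 * g + 1)\<close>. This closes a cycle of 5 vertices on the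
  right and one of \<open>2 * g + 3\<close> vertices on the left. \<open>S g False\<close> is the
  mirror image.\<close>

definition sol_adj :: "vert \<Rightarrow> vert \<Rightarrow> bool" where
  "sol_adj u v \<longleftrightarrow>
     (\<exists>i. u = W i \<and> v = W (Suc i)) \<or>
     (is_hub u \<and> hub_sees u v) \<or>
     (\<exists>g b. u = S g b \<and> (v = W (2 * g + 1) \<or>
        (\<not> chosen g \<and> v = W (if b then 2 * g else 2 * g + 2))))"

definition E where "E = edges_on verts sol_adj"

abbreviation A :: "vert \<Rightarrow> vert \<Rightarrow> bool" where "A u v \<equiv> {u, v} \<in> E"

text \<open>The closed intervals from \<open>lo\<close> to \<open>hi\<close> represent the graph induced by the non-hubs.\<close>

fun lo hi :: "vert \<Rightarrow> nat" where
  "lo (W i) = 3 * i"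
| "lo (S g b) = (if chosen g then (if b then 6 * g + 5 else 6 * g + 4)
     else (if b then 6 * g + 3 else 6 * g + 6))"
| "lo _ = 0"
| "hi (W i) = 3 * i + 3"
| "hi (S g b) = (if chosen g then (if b then 6 * g + 5 else 6 * g + 4)
     else (if b then 6 * g + 3 else 6 * g + 6))"
| "hi _ = 0"

lemma hub_opt: "d \<in> verts \<Longrightarrow> is_hub d \<Longrightarrow> opt d (l d)"
  using sol unfolding solution_def by blast

lemma hub_less: "d \<in> verts \<Longrightarrow> is_hub d \<Longrightarrow> l d < G"
  using hub_opt opt_range by blast

lemma chosen_prev: "P g \<Longrightarrow> l (H (g - 1)) = g \<longleftrightarrow> chosen g"
  using sol unfolding solution_def by blast

lemma not_chosen:
  assumes "P g" "\<not> chosen g"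
  shows "l (H (g - 1)) = g - 1" "l (H g) = Suc g"
proof -
  have g: "0 < g" "Suc g < G" using P_range[OF assms(1)] by auto
  then have "opt (H (g - 1)) (l (H (g - 1)))" "opt (H g) (l (H g))"
    by (intro hub_opt; simp)+
  then show "l (H (g - 1)) = g - 1" "l (H g) = Suc g"
    using g assms chosen_prev[OF assms(1)] by auto
qed

lemma none_at_not_chosen:
  assumes "P g" "\<not> chosen g" "d \<in> verts" "is_hub d"
  shows "l d \<noteq> g"
proof (cases d)
  case (H g')
  then have "l d = g' \<or> l d = Suc g'" using hub_opt[OF assms(3,4)] by auto
  then show ?thesis using H assms chosen_prev[OF assms(1)] P_range[OF assms(1)] by auto
next
  case (C j)
  then show ?thesis using sol assms unfolding solution_def by blast
qed (use assms in auto)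

text \<open>If \<open>g\<close> is unchosen, \<open>H g\<close> must take its other option
  \<open>Suc g\<close>.\<close>

lemma chosen_next: "P g \<Longrightarrow> \<not> chosen g \<Longrightarrow> P (Suc g) \<Longrightarrow> chosen (Suc g)"
  using not_chosen[of g] chosen_prev[of "Suc g"] by simp

lemma own_chosen: "P g \<Longrightarrow> chosen g \<Longrightarrow> l (own g b) = g"
  using chosen_prev by (auto simp: own_def)

lemma A_iff: "A u v \<longleftrightarrow> u \<in> verts \<and> v \<in> verts \<and> u \<noteq> v \<and> (sol_adj u v \<or> sol_adj v u)"
  unfolding E_def by (rule edges_on_iff)

lemma A_sym: "A u v \<longleftrightarrow> A v u" by (simp add: insert_commute)

lemma A_hub:
  assumes "k \<in> verts" "is_hub k" "u \<in> verts" "\<not> is_hub u"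
  shows "A k u \<longleftrightarrow> hub_sees k u"
proof -
  have "k \<noteq> u" using assms by auto
  moreover have "sol_adj k u \<longleftrightarrow> hub_sees k u"
    using assms unfolding sol_adj_def by auto
  moreover have "\<not> sol_adj u k" using assms unfolding sol_adj_def by auto
  ultimately show ?thesis using assms A_iff by blast
qed

lemma A_hubs: "k \<in> verts \<Longrightarrow> is_hub k \<Longrightarrow> k' \<in> verts \<Longrightarrow> is_hub k' \<Longrightarrow> k \<noteq> k' \<Longrightarrow> A k k'"
  unfolding A_iff sol_adj_def by (cases k') auto

lemma sol_adj_simps [simp]:
  "sol_adj (W i) (W j) \<longleftrightarrow> j = Suc i"
  "\<not> sol_adj (W i) (S g b)"
  "\<not> sol_adj (S g b) (S g' b')"
  "sol_adj (S g b) (W j) \<longleftrightarrow>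
     j = 2 * g + 1 \<or> (\<not> chosen g \<and> j = (if b then 2 * g else 2 * g + 2))"
  by (auto simp: sol_adj_def)

text \<open>Neighbouring path intervals share one endpoint. For a chosen \<open>g\<close> the points
  6g + 4 and 6g + 5 are interior to the interval of \<open>W (2 * g + 1)\<close>; for an unchosen
  \<open>g\<close> the points 6g + 3 and 6g + 6 are the ends that it shares with its neighbours on
  the path.\<close>

lemma W_S_interval:
  "sol_adj (S g b) (W i) \<longleftrightarrow> lo (S g b) \<le> hi (W i) \<and> lo (W i) \<le> hi (S g b)"
proof -
  have "i = 2 * g + 1 \<longleftrightarrow> 6 * g + 5 \<le> 3 * i + 3 \<and> 3 * i \<le> 6 * g + 5"
    "i = 2 * g + 1 \<longleftrightarrow> 6 * g + 4 \<le> 3 * i + 3 \<and> 3 * i \<le> 6 * g + 4"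
    "i = 2 * g + 1 \<or> i = 2 * g \<longleftrightarrow> 6 * g + 3 \<le> 3 * i + 3 \<and> 3 * i \<le> 6 * g + 3"
    "i = 2 * g + 1 \<or> i = 2 * g + 2 \<longleftrightarrow> 6 * g + 6 \<le> 3 * i + 3 \<and> 3 * i \<le> 6 * g + 6"
    by presburger+
  then show ?thesis by (cases b; cases "chosen g") simp_all
qed

text \<open>The points used are 5, 4, 3 and 0 modulo 6, hence all different. The scale 3 of the path
  intervals provides the two interior points.\<close>

lemma S_S_interval:
  assumes "S g b \<noteq> S g' b'"
  shows "\<not> (lo (S g b) \<le> hi (S g' b') \<and> lo (S g' b') \<le> hi (S g b))"
proof -
  have "lo (S g b) \<noteq> lo (S g' b')"
  proof
    assume eq: "lo (S g b) = lo (S g' b')"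
    have "g = g' \<and> b = b'"
      using eq by (simp split: if_splits; presburger)
    then show False using assms by simp
  qed
  then show ?thesis by (auto split: if_splits)
qed

lemma A_interval:
  assumes "u \<in> verts" "v \<in> verts" "\<not> is_hub u" "\<not> is_hub v" "u \<noteq> v"
  shows "A u v \<longleftrightarrow> lo u \<le> hi v \<and> lo v \<le> hi u"
proof -
  have "(sol_adj u v \<or> sol_adj v u) \<longleftrightarrow> lo u \<le> hi v \<and> lo v \<le> hi u"
  proof (cases u)
    case u: (W i)
    show ?thesis
    proof (cases v)
      case (W j)
      then show ?thesis using u assms by auto
    next
      case (S g b)
      then show ?thesis using u W_S_interval[of g b i] by (auto simp del: lo.simps hi.simps)
    qed (use assms in auto)
  next
    case u: (S g b)
    show ?thesis
    proof (cases v)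
      case (W j)
      then show ?thesis using u W_S_interval[of g b j] by (auto simp del: lo.simps hi.simps)
    next
      case (S g' b')
      then show ?thesis using u assms S_S_interval[of g b g' b'] by (simp del: lo.simps hi.simps)
    qed (use assms in auto)
  qed (use assms in auto)
  then show ?thesis using assms A_iff by blast
qed

lemma E1_subset: "E1 \<subseteq> E"
  unfolding E1_def E_def
proof (rule edges_on_mono)
  fix u v assume uv: "u \<in> verts" "v \<in> verts" "forced u v"
  have own: "hub_sees (own g b) (S g b)" if "P g" for g b
    using not_chosen[OF that] P_range[OF that] by (auto simp: own_def)
  from uv(3)[unfolded forced_def] consider i where "u = W i" "v = W (Suc i)" | "is_hub u" "is_hub v"
    | "is_hub u" "v = W 0 \<or> v = W (2 * G)" | g b where "u = S g b" "v = W (2 * g + 1)"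
    | g b where "u = S g b" "v = own g b"
    by blast
  then show "sol_adj u v \<or> sol_adj v u"
  proof cases
    case 2
    then have "hub_sees u v" by (cases v) auto
    then show ?thesis using 2 unfolding sol_adj_def by blast
  next
    case 3
    then have "hub_sees u v" by auto
    then show ?thesis using 3 unfolding sol_adj_def by blast
  next
    case 5
    then have "hub_sees v u" using own[of g b] uv by simp
    then show ?thesis using 5 unfolding sol_adj_def by auto
  qed auto
qed

lemma E_subset: "E \<subseteq> E2"
  unfolding E2_def E_def
proof (rule edges_on_mono)
  fix u v assume uv: "u \<in> verts" "v \<in> verts" "sol_adj u v"
  consider i where "u = W i" "v = W (Suc i)" | "is_hub u" "hub_sees u v"
    | g b where "u = S g b" "v = W (2 * g + 1) \<or> (\<not> chosen g \<and> v = W (if b then 2 * g else 2 * g + 2))"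
    using uv(3) unfolding sol_adj_def by blast
  then show "(forced u v \<or> optional u v) \<or> forced v u \<or> optional v u"
  proof cases
    case 2
    show ?thesis
    proof (cases v)
      case (W i)
      then show ?thesis using 2 hub_opt[OF uv(1) 2(1)] unfolding forced_def optional_def by auto
    next
      case (S g b)
      have Pg: "P g" using uv S by simp
      show ?thesis
      proof (cases "u = own g b")
        case False
        then have nc: "\<not> chosen g" and lu: "l u = (if b then Suc g else g - 1)"
          using 2 S by (auto split: if_splits)
        have "\<not> opt u g"
        proof
          assume o: "opt u g"
          show False
          proof (cases u)
            case (H g')
            then have "g = g' \<or> g = Suc g'" using o by auto
            then show False using H False lu not_chosen[OF Pg nc] P_range[OF Pg]
              by (cases b) (auto simp: own_def)
          next
            case (C j)
            \<comment> \<open>A constraint hub choosing \<open>Suc g\<close> or \<open>g - 1\<close>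
              while also having the option \<open>g\<close> would need an edge that
              \<open>E2\<close> lacks; two adjacent options are excluded.\<close>
            then have "Opt j g" "Opt j (l u)" "j < J" using o hub_opt[OF uv(1) 2(1)] uv by auto
            then show False using lu Opt_not_adjacent[of j g] Opt_not_adjacent[of j "g - 1"]
                P_range[OF Pg] by (auto split: if_splits)
          qed (use 2 in auto)
        qed
        then show ?thesis using S 2 unfolding optional_def by auto
      qed (use S in \<open>auto simp: forced_def\<close>)
    qed (use 2 in \<open>auto simp: forced_def\<close>)
  qed (auto simp: forced_def optional_def split: if_splits)
qed

section \<open>Parity of the path between two neighbours of hubs\<close>

definition right_of :: "vert \<Rightarrow> nat \<Rightarrow> bool" where
  "right_of u a \<longleftrightarrow> lo u \<le> 3 * a + 3 \<and> 3 * a \<le> hi u \<and> hi u < 3 * a + 3"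

text \<open>Mirror image of \<open>right_of\<close>. Together they describe the ends of a path
  \<open>u, W a, ..., W b, w\<close> from left to right: \<open>u\<close> meets \<open>W a\<close>
  and ends before it does, \<open>w\<close> meets \<open>W b\<close> and begins after it
  does.\<close>

definition left_of :: "vert \<Rightarrow> nat \<Rightarrow> bool" where
  "left_of u b \<longleftrightarrow> lo u \<le> 3 * b + 3 \<and> 3 * b \<le> hi u \<and> 3 * b < lo u"

text \<open>The parity of \<open>a\<close> tells on which side of the choice of \<open>k\<close> the
  path starts: \<open>W 0\<close> gives \<open>a = 1\<close>, the chosen vertex gives its even
  successor, and a comparison vertex gives \<open>2 * g + 1\<close> at or before the choice or
  \<open>2 * g + 2\<close> beyond it. \<open>a \<le> 2 * G\<close> excludes the right end of the
  path as \<open>u\<close>.\<close>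

lemma right_of_hub:
  assumes "k \<in> verts" "is_hub k" "u \<in> verts" "\<not> is_hub u" "hub_sees k u" "right_of u a" "a \<le> 2 * G"
  shows "(odd a \<and> a \<le> 2 * l k + 1) \<or> (even a \<and> 2 * l k + 1 < a)"
proof (cases u)
  case (W c)
  then have "a = Suc c" using assms unfolding right_of_def by auto
  then show ?thesis using W assms by auto
next
  case (S g b)
  have Pg: "P g" using S assms by simp
  have "a = (if chosen g \<or> b then 2 * g + 1 else 2 * g + 2)"
    using assms(6) S unfolding right_of_def by (auto split: if_splits; presburger)
  then show ?thesis
    using S assms(5) own_chosen[OF Pg, of b] P_range[OF Pg] by (auto split: if_splits)
qed (use assms in auto)

lemma left_of_hub:
  assumes "k \<in> verts" "is_hub k" "u \<in> verts" "\<not> is_hub u" "hub_sees k u" "left_of u b"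
  shows "(odd b \<and> 2 * l k + 1 \<le> b) \<or> (even b \<and> b < 2 * l k + 1)"
proof (cases u)
  case (W c)
  then have "c = Suc b" using assms unfolding left_of_def by auto
  moreover have "odd b \<and> 2 * l k + 1 \<le> b" if "Suc b = 2 * G"
  proof -
    have "2 * l k + 2 \<le> Suc b" using hub_less[OF assms(1,2)] that by simp
    moreover have "odd b" using that by presburger
    ultimately show ?thesis by simp
  qed
  ultimately show ?thesis using W assms by auto
next
  case (S g c)
  have Pg: "P g" using S assms by simp
  have "b = (if chosen g \<or> \<not> c then 2 * g + 1 else 2 * g)"
    using assms(6) S unfolding left_of_def by (auto split: if_splits; presburger)
  then show ?thesis
    using S assms(5) own_chosen[OF Pg, of c] P_range[OF Pg] by (auto split: if_splits)
qed (use assms in auto)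

text \<open>The hole would have \<open>b - a + 5\<close> vertices. For odd \<open>a\<close> both
  chosen vertices lie beyond \<open>W b\<close>, so the private neighbour \<open>u\<close> of
  \<open>k\<close> is \<open>S g True\<close> at an unchosen \<open>g\<close> with
  \<open>l k = Suc g\<close>, and \<open>b = 2 * g + 2\<close>. Then \<open>w\<close> is either
  \<open>W (2 * g + 3)\<close>, which \<open>k\<close> sees as well, or a comparison vertex at
  \<open>Suc g\<close>, which would be unchosen against \<open>chosen_next\<close>. Even
  \<open>a\<close> is the mirror image.\<close>

lemma two_hubs_parity:
  assumes k: "k \<in> verts" "is_hub k" and k': "k' \<in> verts" "is_hub k'"
    and u: "u \<in> verts" "\<not> is_hub u" "hub_sees k u" "\<not> hub_sees k' u" "right_of u a"
    and w: "w \<in> verts" "\<not> is_hub w" "hub_sees k' w" "\<not> hub_sees k w" "left_of w b"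
    and ab: "a \<le> b" "a \<le> 2 * G" "odd (b - a)"
    and out: "\<not> (a \<le> 2 * l k + 1 \<and> 2 * l k + 1 \<le> b)" "\<not> (a \<le> 2 * l k' + 1 \<and> 2 * l k' + 1 \<le> b)"
  shows False
proof -
  have par: "odd a \<noteq> odd b" using ab by auto
  have ra: "(odd a \<and> a \<le> 2 * l k + 1) \<or> (even a \<and> 2 * l k + 1 < a)"
    by (rule right_of_hub[OF k u(1-3) u(5) ab(2)])
  have rb: "(odd b \<and> 2 * l k' + 1 \<le> b) \<or> (even b \<and> b < 2 * l k' + 1)"
    by (rule left_of_hub[OF k' w(1-3) w(5)])
  have ua: "(\<exists>c. u = W c \<and> a = Suc c) \<or>
     (\<exists>g d. u = S g d \<and> a = (if chosen g \<or> d then 2 * g + 1 else 2 * g + 2))"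
    using u(2,5) unfolding right_of_def by (cases u) (auto split: if_splits; presburger)+
  have wb: "(\<exists>c. w = W c \<and> c = Suc b) \<or>
     (\<exists>g d. w = S g d \<and> b = (if chosen g \<or> \<not> d then 2 * g + 1 else 2 * g))"
    using w(2,5) unfolding left_of_def by (cases w) (auto split: if_splits; presburger)+
  show False
  proof (cases "odd a")
    case True
    then have bounds: "b < 2 * l k + 1" "b < 2 * l k' + 1" "even b" using ra rb par out by auto
    obtain g where g: "u = S g True" "\<not> chosen g" "a = 2 * g + 1" "l k = Suc g" "P g"
      using ua u True bounds ab(1) own_chosen by (auto split: if_splits)
    from wb show False
    proof
      assume "\<exists>c. w = W c \<and> c = Suc b"
      then have "w = W (Suc b)" "Suc b = 2 * l k' + 1"
        using w(3) bounds by auto presburger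
      then show False using w(4) g bounds ab by auto
    next
      assume "\<exists>g d. w = S g d \<and> b = (if chosen g \<or> \<not> d then 2 * g + 1 else 2 * g)"
      then obtain g' where g': "w = S g' True" "\<not> chosen g'" "b = 2 * g'"
        using bounds by (auto split: if_splits)
      then have "g' = Suc g" using g bounds ab by auto
      then show False using g' g chosen_next[of g] w(1) by auto
    qed
  next
    case False
    then have bounds: "2 * l k + 1 < a" "2 * l k' + 1 < a" "odd b" using ra rb par out by auto
    obtain g where g: "w = S g False" "\<not> chosen g" "b = 2 * g + 1" "l k' = g - 1" "P g"
    proof -
      have "w \<noteq> W (Suc b)"
      proof
        assume wW: "w = W (Suc b)"
        have "Suc b = 2 * G" using w(3) bounds wW by auto
        then show False using w(4) wW by simp
      qed
      then obtain g d where gd: "w = S g d" "b = (if chosen g \<or> \<not> d then 2 * g + 1 else 2 * g)"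
        using wb by auto
      have Pg: "P g" using gd w by simp
      have nc: "\<not> chosen g"
      proof
        assume "chosen g"
        then have "l k' = g" "b = 2 * g + 1" using gd w(3) own_chosen[OF Pg, of d] by auto
        then show False using bounds ab by auto
      qed
      moreover have "\<not> d" using gd nc bounds by auto
      ultimately show thesis using that[of g] gd w(3) Pg by auto
    qed
    from ua show False
    proof
      assume "\<exists>c. u = W c \<and> a = Suc c"
      then obtain c where c: "u = W c" "a = Suc c" by auto
      have "c = 2 * l k + 1" using c u(3,4) False by auto
      moreover have "c + 1 \<le> 2 * g + 1" "2 * (g - 1) + 1 < c + 1" using c ab g bounds by auto
      ultimately have "l k = g - 1" using P_range[OF g(5)] by auto
      then show False using w(4) g by auto
    next
      assume "\<exists>g d. u = S g d \<and> a = (if chosen g \<or> d then 2 * g + 1 else 2 * g + 2)"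
      then obtain g' where g': "u = S g' False" "\<not> chosen g'" "a = 2 * g' + 2"
        using False by (auto split: if_splits)
      have P': "P g'" using g' u by simp
      have "2 * g' + 2 \<le> 2 * g + 1" "2 * (g - 1) + 1 < 2 * g' + 2" using g' g ab bounds by auto
      then have "g = Suc g'" using P_range[OF g(5)] by auto
      then show False using g g' chosen_next[OF P' g'(2)] by auto
    qed
  qed
qed

text \<open>The case of a hole on four vertices. Path vertices seen by only one of the two hubs have
  odd index, hence are not consecutive; and if \<open>S g b\<close> is adjacent to one of them, it
  is \<open>W (2 * g + 1)\<close>, so \<open>g\<close> is chosen and both hubs see it.\<close>

lemma two_hubs_adjacent:
  assumes k: "k \<in> verts" "is_hub k" and k': "k' \<in> verts" "is_hub k'"
    and u: "u \<in> verts" "\<not> is_hub u" "hub_sees k u" "\<not> hub_sees k' u"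
    and w: "w \<in> verts" "\<not> is_hub w" "hub_sees k' w" "\<not> hub_sees k w"
    and A: "sol_adj u w"
  shows False
proof -
  consider i where "u = W i" "w = W (Suc i)"
    | g b where "u = S g b" "w = W (2 * g + 1) \<or>
        (\<not> chosen g \<and> w = W (if b then 2 * g else 2 * g + 2))"
    using A u(2) unfolding sol_adj_def by blast
  then show False
  proof cases
    case 1
    then have "i = 2 * l k + 1" "Suc i = 2 * l k' + 1" using u(3,4) w(3,4) by auto
    then show False by presburger
  next
    case 2
    have Pg: "P g" using 2 u by simp
    obtain c where c: "w = W c" using 2 by auto
    then have "c = 2 * l k' + 1" using w(3,4) by auto
    then have c': "c = 2 * g + 1" "l k' = g" using 2(2) c by (auto split: if_splits; presburger)+
    then have "chosen g" using none_at_not_chosen[OF Pg _ k'] by auto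
    then have "l k = g" using u(3) 2(1) own_chosen[OF Pg] by auto
    then show False using w(4) c c' by simp
  qed
qed

end

section \<open>Even holes of the constructed graph\<close>

context line_solution
begin

definition induced_path :: "nat \<Rightarrow> (nat \<Rightarrow> vert) \<Rightarrow> bool" where
  "induced_path m x \<longleftrightarrow> 3 \<le> m \<and> inj_on x {..<m} \<and> (\<forall>t<m. x t \<in> verts \<and> \<not> is_hub (x t)) \<and>
     (\<forall>s<m. \<forall>t<m. A (x s) (x t) \<longleftrightarrow> s = Suc t \<or> t = Suc s)"

lemma induced_path_meets:
  assumes "induced_path m x" "s < m" "t < m" "s \<noteq> t"
  shows "lo (x s) \<le> hi (x t) \<and> lo (x t) \<le> hi (x s) \<longleftrightarrow> s = Suc t \<or> t = Suc s"
proof -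
  have "x s \<noteq> x t" using assms unfolding induced_path_def inj_on_def by auto
  then show ?thesis using A_interval[of "x s" "x t"] assms unfolding induced_path_def by auto
qed

lemma induced_path_reverse:
  assumes "induced_path m x"
  shows "induced_path m (\<lambda>t. x (m - 1 - t))"
proof -
  have "inj_on (\<lambda>t. x (m - 1 - t)) {..<m}"
  proof (rule inj_onI)
    fix s t assume st: "s \<in> {..<m}" "t \<in> {..<m}" "x (m - 1 - s) = x (m - 1 - t)"
    then have "m - 1 - s = m - 1 - t"
      using assms unfolding induced_path_def inj_on_def by auto
    then show "s = t" using st by auto
  qed
  moreover have "(m - 1 - s = Suc (m - 1 - t) \<or> m - 1 - t = Suc (m - 1 - s)) \<longleftrightarrow>
      (s = Suc t \<or> t = Suc s)" if "s < m" "t < m" for s t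
    using that by auto
  moreover have "m - 1 - t < m" if "t < m" for t using that by auto
  ultimately show ?thesis using assms unfolding induced_path_def by auto
qed

text \<open>A comparison vertex is a single point of the line: two neighbours of it share that point
  and so are adjacent to each other.\<close>

lemma induced_path_interior:
  assumes x: "induced_path m x" and t: "0 < t" "Suc t < m"
  obtains a where "x t = W a"
proof (cases "x t")
  case (S g b)
  then have pt: "lo (x t) = hi (x t)" by simp
  obtain r where r: "t = Suc r" using t by (cases t) auto
  have "lo (x r) \<le> hi (x t)" "lo (x t) \<le> hi (x r)"
    "lo (x (Suc t)) \<le> hi (x t)" "lo (x t) \<le> hi (x (Suc t))"
    using induced_path_meets[OF x, of r t] induced_path_meets[OF x, of "Suc t" t] t r by simp_all
  then have "lo (x r) \<le> hi (x (Suc t)) \<and> lo (x (Suc t)) \<le> hi (x r)"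
    using pt by linarith
  then show ?thesis using induced_path_meets[OF x, of r "Suc t"] t r by simp
next
  case (W a)
  then show ?thesis using that by blast
next
  case (H g)
  then have "is_hub (x t)" by simp
  then show ?thesis using x t unfolding induced_path_def by simp
next
  case (C g)
  then have "is_hub (x t)" by simp
  then show ?thesis using x t unfolding induced_path_def by simp
qed

text \<open>An induced path of intervals cannot turn round: the two middle vertices are consecutive
  on the line, and each outer vertex meets just one of them.\<close>

lemma induced_path_direction_step:
  assumes x: "induced_path m x" and t: "t + 3 < m"
  shows "hi (x t) < lo (x (t + 2)) \<longleftrightarrow> hi (x (t + 1)) < lo (x (t + 3))"
proof -
  obtain a where a: "x (t + 1) = W a" using induced_path_interior[OF x, of "t + 1"] t by auto
  obtain b where b: "x (t + 2) = W b" using induced_path_interior[OF x, of "t + 2"] t by auto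
  show ?thesis
    using induced_path_meets[OF x, of t "t + 1"] induced_path_meets[OF x, of t "t + 2"]
      induced_path_meets[OF x, of "t + 1" "t + 2"] induced_path_meets[OF x, of "t + 2" "t + 3"]
      induced_path_meets[OF x, of "t + 1" "t + 3"] t a b by auto
qed

lemma induced_path_direction:
  assumes x: "induced_path m x"
  shows "t + 2 < m \<Longrightarrow> hi (x 0) < lo (x 2) \<longleftrightarrow> hi (x t) < lo (x (t + 2))"
proof (induction t)
  case 0
  then show ?case by (simp only: add_0)
next
  case (Suc t)
  have e: "Suc t = t + 1" "t + 1 + 2 = t + 3" by auto
  have m: "t + 3 < m" using Suc.prems by simp
  then have "t + 2 < m" by simp
  with Suc.IH induced_path_direction_step[OF x m] show ?case unfolding e by blast
qed

text \<open>Read from left to right, the path is \<open>u\<close>, then \<open>m - 2\<close>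
  consecutive path vertices starting with \<open>W a\<close>, then \<open>w\<close>.\<close>

definition spans :: "nat \<Rightarrow> (nat \<Rightarrow> vert) \<Rightarrow> nat \<Rightarrow> vert \<Rightarrow> vert \<Rightarrow> bool" where
  "spans m x a u w \<longleftrightarrow> right_of u a \<and> left_of w (a + (m - 3)) \<and>
     (\<forall>i. a \<le> i \<and> i \<le> a + (m - 3) \<longrightarrow> (\<exists>t. 0 < t \<and> Suc t < m \<and> x t = W i))"

lemma induced_path_spans_increasing:
  assumes x: "induced_path m x" and inc: "hi (x 0) < lo (x 2)"
  shows "\<exists>a. spans m x a (x 0) (x (m - 1))"
proof -
  have m: "3 \<le> m" using x unfolding induced_path_def by simp
  obtain a where a: "x 1 = W a" using induced_path_interior[OF x, of 1] m by auto
  have pos: "x (Suc t) = W (a + t)" if "t + 2 < m" for t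
    using that
  proof (induction t)
    case 0
    then show ?case using a by simp
  next
    case (Suc t)
    then have IH: "x (Suc t) = W (a + t)" by simp
    obtain b where b: "x (t + 2) = W b" using induced_path_interior[OF x, of "t + 2"] Suc.prems by auto
    have "hi (x t) < lo (x (t + 2))" using induced_path_direction[OF x, of t] inc Suc.prems by simp
    then have "b = Suc (a + t)"
      using IH b induced_path_meets[OF x, of t "t + 1"] induced_path_meets[OF x, of "t + 1" "t + 2"]
        Suc.prems by auto
    then show ?case using b by simp
  qed
  have "right_of (x 0) a"
    using inc a induced_path_meets[OF x, of 0 1] induced_path_meets[OF x, of 1 2] m
    unfolding right_of_def by auto
  moreover have "left_of (x (m - 1)) (a + (m - 3))"
  proof -
    have e: "m - 3 + 2 = m - 1" "Suc (m - 3) = m - 2" "m - 3 < m" "m - 1 < m" "m - 2 < m"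
      "m - 1 = Suc (m - 2)" using m by auto
    have d: "hi (x (m - 3)) < lo (x (m - 1))"
      using induced_path_direction[OF x, of "m - 3"] inc m e by simp
    have w: "x (m - 2) = W (a + (m - 3))" using pos[of "m - 3"] m e by simp
    have meet1: "lo (x (m - 2)) \<le> hi (x (m - 3))"
      using induced_path_meets[OF x, of "m - 2" "m - 3"] e by auto
    have meet2: "lo (x (m - 1)) \<le> hi (x (m - 2)) \<and> lo (x (m - 2)) \<le> hi (x (m - 1))"
      using induced_path_meets[OF x, of "m - 1" "m - 2"] e by auto
    show ?thesis unfolding left_of_def using d w meet1 meet2 by auto
  qed
  moreover have "\<exists>t. 0 < t \<and> Suc t < m \<and> x t = W i" if "a \<le> i \<and> i \<le> a + (m - 3)" for i
    using pos[of "i - a"] that m by (intro exI[of _ "Suc (i - a)"]) auto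
  ultimately show ?thesis unfolding spans_def by blast
qed

lemma induced_path_spans:
  assumes x: "induced_path m x"
  shows "\<exists>a. spans m x a (x 0) (x (m - 1)) \<or> spans m x a (x (m - 1)) (x 0)"
proof (cases "hi (x 0) < lo (x 2)")
  case True
  then show ?thesis using induced_path_spans_increasing[OF x] by blast
next
  case False
  have m: "3 \<le> m" using x unfolding induced_path_def by simp
  let ?y = "\<lambda>t. x (m - 1 - t)"
  have y: "induced_path m ?y" by (rule induced_path_reverse[OF x])
  have e: "m - 3 + 2 = m - 1" "m - 3 < m" "m - 1 < m" "m - 1 - 2 = m - 3" using m by auto
  have "\<not> hi (x (m - 3)) < lo (x (m - 1))"
    using induced_path_direction[OF x, of "m - 3"] False m e by simp
  then have "hi (x (m - 1)) < lo (x (m - 3))"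
    using induced_path_meets[OF x, of "m - 1" "m - 3"] e m by auto
  then have "hi (?y 0) < lo (?y 2)" using e by simp
  from induced_path_spans_increasing[OF y this] obtain a where
    a: "spans m ?y a (x (m - 1)) (x 0)" using m by auto
  have "\<exists>t. 0 < t \<and> Suc t < m \<and> x t = W i" if "\<exists>t. 0 < t \<and> Suc t < m \<and> ?y t = W i" for i
  proof -
    from that obtain t where "0 < t" "Suc t < m" "?y t = W i" by blast
    then show ?thesis by (intro exI[of _ "m - 1 - t"]) auto
  qed
  then have "spans m x a (x (m - 1)) (x 0)" using a unfolding spans_def by blast
  then show ?thesis by blast
qed

text \<open>Interval graphs are chordal: the neighbours of the interval that ends first all contain
  its right end and form a clique.\<close>

lemma no_hole_without_hubs:
  assumes h: "hole_seq A n v" and V: "v ` {..<n} \<subseteq> verts" and nh: "\<And>i. i < n \<Longrightarrow> \<not> is_hub (v i)"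
  shows False
proof -
  have n: "4 \<le> n" using h unfolding hole_seq_def by simp
  have "finite ((\<lambda>i. hi (v i)) ` {..<n})" "(\<lambda>i. hi (v i)) ` {..<n} \<noteq> {}"
    using n by (auto simp: lessThan_empty_iff)
  from Min_in[OF this] obtain i where i: "i < n" "hi (v i) = Min ((\<lambda>i. hi (v i)) ` {..<n})" by auto
  have le: "hi (v i) \<le> hi (v j)" if "j < n" for j using i that by auto
  obtain w where w: "hole_seq A n w" "w ` {..<n} = v ` {..<n}" "w 0 = v i"
    using hole_seq_start_at[OF h i(1)] by blast
  have wv: "w j \<in> verts \<and> \<not> is_hub (w j) \<and> hi (w 0) \<le> hi (w j)" if "j < n" for j
  proof -
    have "w j \<in> v ` {..<n}" using w(2) that by blast
    then show ?thesis using V nh le w(3) by auto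
  qed
  have A: "A (w a) (w b) \<longleftrightarrow> cyclic_nbrs n a b" if "a < n" "b < n" for a b
    using w(1) that unfolding hole_seq_def by blast
  have ne: "w a \<noteq> w b" if "a < n" "b < n" "a \<noteq> b" for a b
    using w(1) that unfolding hole_seq_def inj_on_def by blast
  have i3: "0 < n" "1 < n" "n - 1 < n" using n by auto
  have "A (w 0) (w 1)" "A (w 0) (w (n - 1))" "\<not> A (w 1) (w (n - 1))"
    using A[OF i3(1,2)] A[OF i3(1,3)] A[OF i3(2,3)] n by (auto simp: cyclic_nbrs_def)
  moreover have "w 0 \<noteq> w 1" "w 0 \<noteq> w (n - 1)" "w 1 \<noteq> w (n - 1)"
    using ne[OF i3(1,2)] ne[OF i3(1,3)] ne[OF i3(2,3)] n by auto
  ultimately show False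
    using A_interval[of "w 0" "w 1"] A_interval[of "w 0" "w (n - 1)"] A_interval[of "w 1" "w (n - 1)"]
      wv[OF i3(1)] wv[OF i3(2)] wv[OF i3(3)] by auto
qed

lemma induced_path_of_hole:
  assumes h: "hole_seq A n v" and V: "v ` {..<n} \<subseteq> verts"
    and m: "3 \<le> m" "m < n" and nh: "\<And>i. 0 < i \<Longrightarrow> i \<le> m \<Longrightarrow> \<not> is_hub (v i)"
  shows "induced_path m (\<lambda>t. v (Suc t))"
  unfolding induced_path_def
proof (intro conjI allI impI)
  show "inj_on (\<lambda>t. v (Suc t)) {..<m}"
  proof (rule inj_onI)
    fix x y assume xy: "x \<in> {..<m}" "y \<in> {..<m}" "v (Suc x) = v (Suc y)"
    then have "Suc x \<in> {..<n}" "Suc y \<in> {..<n}" using m by auto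
    then have "Suc x = Suc y" using h xy unfolding hole_seq_def inj_on_def by blast
    then show "x = y" by simp
  qed
  fix s assume s: "s < m"
  show "v (Suc s) \<in> verts" "\<not> is_hub (v (Suc s))" using V nh[of "Suc s"] s m by auto
  fix t assume "t < m"
  then show "A (v (Suc s)) (v (Suc t)) \<longleftrightarrow> s = Suc t \<or> t = Suc s"
    using h s m unfolding hole_seq_def cyclic_nbrs_def by auto
qed (fact m)

text \<open>The hole has \<open>b - a + 4\<close> vertices, so \<open>a\<close> and \<open>b\<close>
  have equal parity. If both are odd, the chosen vertex lies between them and would be a chord; if
  both are even, it would lie to the left of \<open>a\<close> and to the right of
  \<open>b\<close>.\<close>

lemma no_even_hole_one_hub:
  assumes h: "hole_seq A n v" and V: "v ` {..<n} \<subseteq> verts" and even: "even n"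
    and k: "is_hub (v 0)" and nh: "\<And>i. 0 < i \<Longrightarrow> i < n \<Longrightarrow> \<not> is_hub (v i)"
  shows False
proof -
  have n: "4 \<le> n" using h unfolding hole_seq_def by simp
  define m where "m = n - 1"
  define x where "x t = v (Suc t)" for t
  have x: "induced_path m x"
    unfolding x_def by (rule induced_path_of_hole[OF h V]) (use n nh in \<open>auto simp: m_def\<close>)
  have kV: "v 0 \<in> verts" using V n by auto
  have xT: "x t \<in> verts" "\<not> is_hub (x t)" if "t < m" for t
    using x that unfolding induced_path_def by auto
  have sees: "hub_sees (v 0) (x t) \<longleftrightarrow> t = 0 \<or> Suc t = m" if "t < m" for t
  proof -
    have "A (v 0) (x t) \<longleftrightarrow> cyclic_nbrs n 0 (Suc t)"
      using h that n unfolding hole_seq_def x_def m_def by auto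
    then show ?thesis using A_hub[OF kV k xT[OF that]] that unfolding cyclic_nbrs_def m_def by auto
  qed
  have main: False if sp: "spans m x a (x s) (x t)" and st: "s = 0 \<and> Suc t = m \<or> t = 0 \<and> Suc s = m"
    for a s t
  proof -
    let ?b = "a + (m - 3)" and ?c = "2 * l (v 0) + 1"
    have s: "s < m" "t < m" using st n by (auto simp: m_def)
    have int: "\<exists>t. 0 < t \<and> Suc t < m \<and> x t = W i" if "a \<le> i" "i \<le> ?b" for i
      using sp that unfolding spans_def by blast
    have "a \<le> 2 * G"
    proof -
      obtain t where "0 < t" "Suc t < m" "x t = W a" using int[of a] by auto
      then show ?thesis using xT(1)[of t] by auto
    qed
    moreover have "hub_sees (v 0) (x s)" "hub_sees (v 0) (x t)" "right_of (x s) a" "left_of (x t) ?b"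
      using sees[OF s(1)] sees[OF s(2)] sp st unfolding spans_def by blast+
    ultimately have ra: "(odd a \<and> a \<le> ?c) \<or> (even a \<and> ?c < a)"
      and rb: "(odd ?b \<and> ?c \<le> ?b) \<or> (even ?b \<and> ?b < ?c)"
      using right_of_hub[OF kV k xT[OF s(1)], of a] left_of_hub[OF kV k xT[OF s(2)], of ?b] by blast+
    have out: "\<not> (a \<le> ?c \<and> ?c \<le> ?b)"
    proof
      assume "a \<le> ?c \<and> ?c \<le> ?b"
      then obtain t where t: "0 < t" "Suc t < m" "x t = W ?c" using int by blast
      have "hub_sees (v 0) (x t)" unfolding t(3) by simp
      then show False using sees[of t] t by auto
    qed
    have "even (m - 3)" using even n by (auto simp: m_def)
    then have "odd ?b \<longleftrightarrow> odd a" by simp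
    then show False using ra rb out by linarith
  qed
  obtain a where "spans m x a (x 0) (x (m - 1)) \<or> spans m x a (x (m - 1)) (x 0)"
    using induced_path_spans[OF x] by blast
  moreover have "Suc (m - 1) = m" using n by (simp add: m_def)
  ultimately show False using main[of a 0 "m - 1"] main[of a "m - 1" 0] by blast
qed

lemma no_even_hole_two_hubs:
  assumes h: "hole_seq A n v" and V: "v ` {..<n} \<subseteq> verts" and even: "even n"
    and k: "is_hub (v 0)" "is_hub (v (n - 1))"
    and nh: "\<And>i. 0 < i \<Longrightarrow> i < n - 1 \<Longrightarrow> \<not> is_hub (v i)"
  shows False
proof -
  have n: "4 \<le> n" using h unfolding hole_seq_def by simp
  define m where "m = n - 2"
  define x where "x t = v (Suc t)" for t
  have kV: "v 0 \<in> verts" "v (n - 1) \<in> verts" using V n by auto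
  have xT: "x t \<in> verts" "\<not> is_hub (x t)" if "t < m" for t
    using that V nh[of "Suc t"] n by (auto simp: x_def m_def)
  have sees: "hub_sees (v 0) (x t) \<longleftrightarrow> t = 0" "hub_sees (v (n - 1)) (x t) \<longleftrightarrow> Suc t = m" if "t < m" for t
  proof -
    have "A (v 0) (x t) \<longleftrightarrow> cyclic_nbrs n 0 (Suc t)" "A (v (n - 1)) (x t) \<longleftrightarrow> cyclic_nbrs n (n - 1) (Suc t)"
      using h that n unfolding hole_seq_def x_def m_def by auto
    then show "hub_sees (v 0) (x t) \<longleftrightarrow> t = 0" "hub_sees (v (n - 1)) (x t) \<longleftrightarrow> Suc t = m"
      using A_hub[OF kV(1) k(1) xT[OF that]] A_hub[OF kV(2) k(2) xT[OF that]] that n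
      unfolding cyclic_nbrs_def m_def by auto
  qed
  show False
  proof (cases "n = 4")
    \<comment> \<open>With \<open>n = 4\<close> only two vertices are not hubs, so there is no
      interior path vertex to measure parity with.\<close>
    case True
    then have m: "m = 2" by (simp add: m_def)
    have "A (x 0) (x 1)" using h n True unfolding hole_seq_def x_def cyclic_nbrs_def by auto
    then have "sol_adj (x 0) (x 1) \<or> sol_adj (x 1) (x 0)" unfolding A_iff by blast
    then show False
      using two_hubs_adjacent[OF kV(1) k(1) kV(2) k(2), of "x 0" "x 1"]
        two_hubs_adjacent[OF kV(2) k(2) kV(1) k(1), of "x 1" "x 0"]
        sees[of 0] sees[of 1] xT[of 0] xT[of 1] m by auto
  next
    case False
    then have n6: "6 \<le> n" using n even by presburger
    have x: "induced_path m x"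
      unfolding x_def by (rule induced_path_of_hole[OF h V]) (use n6 nh in \<open>auto simp: m_def\<close>)
    have em: "odd (m - 3)" using even n6 by (auto simp: m_def)
    have int: "\<exists>t. 0 < t \<and> Suc t < m \<and> x t = W i"
      if "spans m x a u w" "a \<le> i" "i \<le> a + (m - 3)" for a u w i
      using that unfolding spans_def by blast
    have out: "\<not> (a \<le> 2 * l c + 1 \<and> 2 * l c + 1 \<le> a + (m - 3))"
      if sp: "spans m x a u w" and c: "c = v 0 \<or> c = v (n - 1)" for a u w c
    proof
      assume "a \<le> 2 * l c + 1 \<and> 2 * l c + 1 \<le> a + (m - 3)"
      then obtain t where t: "0 < t" "Suc t < m" "x t = W (2 * l c + 1)"
        using int[OF sp] by blast
      have "t < m" "t \<noteq> 0" "Suc t \<noteq> m" using t by auto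
      moreover have "hub_sees c (x t)" unfolding t(3) by simp
      ultimately show False using sees[of t] c by blast
    qed
    have aG: "a \<le> 2 * G" if sp: "spans m x a u w" for a u w
    proof -
      obtain t where t: "0 < t" "Suc t < m" "x t = W a" using int[OF sp, of a] by auto
      then have "x t \<in> verts" using xT(1)[of t] by simp
      then show ?thesis using t by simp
    qed
    have m01: "0 < m" "m - 1 < m" "Suc (m - 1) = m" "m - 1 \<noteq> 0" "Suc 0 \<noteq> m"
      using n6 by (auto simp: m_def)
    have s0: "hub_sees (v 0) (x 0)" "\<not> hub_sees (v (n - 1)) (x 0)"
      and s1: "hub_sees (v (n - 1)) (x (m - 1))" "\<not> hub_sees (v 0) (x (m - 1))"
      using sees[OF m01(1)] sees[OF m01(2)] m01 by auto
    obtain a where "spans m x a (x 0) (x (m - 1)) \<or> spans m x a (x (m - 1)) (x 0)"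
      using induced_path_spans[OF x] by blast
    then show False
    proof
      assume sp: "spans m x a (x 0) (x (m - 1))"
      then have "right_of (x 0) a" "left_of (x (m - 1)) (a + (m - 3))"
        unfolding spans_def by blast+
      then show False
        using two_hubs_parity[OF kV(1) k(1) kV(2) k(2) xT[OF m01(1)] s0 _ xT[OF m01(2)] s1,
            of a "a + (m - 3)"] out[OF sp] aG[OF sp] em by simp
    next
      assume sp: "spans m x a (x (m - 1)) (x 0)"
      then have "right_of (x (m - 1)) a" "left_of (x 0) (a + (m - 3))"
        unfolding spans_def by blast+
      then show False
        using two_hubs_parity[OF kV(2) k(2) kV(1) k(1) xT[OF m01(2)] s1 _ xT[OF m01(1)] s0,
            of a "a + (m - 3)"] out[OF sp] aG[OF sp] em by simp
    qed
  qed
qed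

text \<open>Hubs are pairwise adjacent, hence cyclically consecutive on a hole, so there are at most
  two of them. A rotation brings them to the indices 0 and \<open>n - 1\<close>.\<close>

lemma no_even_hole:
  assumes h: "hole_seq A n v" and V: "v ` {..<n} \<subseteq> verts" and even: "even n"
  shows False
proof (cases "\<exists>i<n. is_hub (v i)")
  case False
  then show ?thesis using no_hole_without_hubs[OF h V] by blast
next
  case True
  then obtain i where i: "i < n" "is_hub (v i)" by blast
  obtain w where w: "hole_seq A n w" "w ` {..<n} = v ` {..<n}" "w 0 = v i"
    using hole_seq_start_at[OF h i(1)] by blast
  have wV: "w ` {..<n} \<subseteq> verts" using w V by simp
  have n: "4 \<le> n" using h unfolding hole_seq_def by simp
  have hub0: "is_hub (w 0)" using w i by simp
  have adj: "cyclic_nbrs n a b" if "a < n" "b < n" "a \<noteq> b" "is_hub (w a)" "is_hub (w b)" for a b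
  proof -
    have "w a \<noteq> w b" using w(1) that unfolding hole_seq_def inj_on_def by blast
    then have "A (w a) (w b)" using A_hubs that wV by blast
    then show ?thesis using w(1) that unfolding hole_seq_def by blast
  qed
  show False
  proof (cases "is_hub (w (n - 1))")
    case True
    have "\<not> is_hub (w j)" if j: "0 < j" "j < n - 1" for j
    proof
      assume hj: "is_hub (w j)"
      have jn: "j < n" "n - 1 < n" "n - 1 \<noteq> j" "0 \<noteq> j" "0 < n" using j n by auto
      have "cyclic_nbrs n 0 j" "cyclic_nbrs n (n - 1) j"
        using adj[OF jn(5,1,4) hub0 hj] adj[OF jn(2,1,3) True hj] by auto
      then show False using j n by (auto simp: cyclic_nbrs_def)
    qed
    then show False using no_even_hole_two_hubs[OF w(1) wV even hub0 True] by blast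
  next
    case last: False
    show False
    proof (cases "is_hub (w 1)")
      case True
      define y where "y = (\<lambda>i. w (if Suc i = n then 0 else Suc i))"
      have y: "hole_seq A n y" unfolding y_def by (rule hole_seq_rotate1[OF w(1)])
      have "y ` {..<n} \<subseteq> verts" using wV n by (auto simp: y_def)
      moreover have "is_hub (y 0)" "is_hub (y (n - 1))" using True hub0 n by (auto simp: y_def)
      moreover have "\<not> is_hub (y j)" if "0 < j" "j < n - 1" for j
      proof
        assume "is_hub (y j)"
        then have hj: "is_hub (w (Suc j))" using that unfolding y_def by (cases "Suc j = n") auto
        have jn: "Suc j < n" "0 < n" "1 < n" "0 \<noteq> Suc j" "1 \<noteq> Suc j" using that n by auto
        have "cyclic_nbrs n 0 (Suc j)" "cyclic_nbrs n 1 (Suc j)"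
          using adj[OF jn(2,1,4) hub0 hj] adj[OF jn(3,1,5) True hj] by auto
        then show False using that n by (auto simp: cyclic_nbrs_def)
      qed
      ultimately show False using no_even_hole_two_hubs[OF y _ even] by blast
    next
      case False
      have "\<not> is_hub (w j)" if "0 < j" "j < n" for j
      proof
        assume j: "is_hub (w j)"
        then have "cyclic_nbrs n 0 j" using adj[of 0 j] that hub0 n by auto
        then have "j = 1 \<or> j = n - 1" using that by (auto simp: cyclic_nbrs_def)
        then show False using j False last by auto
      qed
      then show False using no_even_hole_one_hub[OF w(1) wV even hub0] by blast
    qed
  qed
qed

lemma has_sandwich: "has_even_hole_free_sandwich verts E1 E2"
proof -
  have s: "simple_graph verts E" unfolding E_def by (rule simple_graph_edges_on[OF finite_verts])
  have two: "card e = 2" if "e \<in> E" for e using s that unfolding simple_graph_def by blast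
  have "even_hole_free verts E"
    using even_hole_free_iff_hole_seq[of E verts] two no_even_hole by blast
  then show ?thesis
    unfolding has_even_hole_free_sandwich_def using s E1_subset E_subset by blast
qed

end

theorem (in line) sandwich_iff_solution:
  "has_even_hole_free_sandwich verts E1 E2 \<longleftrightarrow> (\<exists>l. solution l)"
proof
  assume "\<exists>l. solution l"
  then obtain l where "solution l" by blast
  then interpret line_solution G J P Opt l by unfold_locales
  show "has_even_hole_free_sandwich verts E1 E2" by (rule has_sandwich)
qed (rule solution_of_sandwich)

section \<open>Satisfiability as a line problem\<close>

text \<open>Clauses without literals count as satisfied; they correspond to constraints without a
  hub.\<close>

definition cnf_sat :: "nat \<Rightarrow> nat \<Rightarrow> (nat \<Rightarrow> nat \<Rightarrow> bool \<Rightarrow> bool) \<Rightarrow> bool" where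
  "cnf_sat X J lit \<longleftrightarrow> (\<exists>\<sigma>. \<forall>j<J. (\<exists>x<X. \<exists>s. lit j x s) \<longrightarrow> (\<exists>x<X. lit j x (\<sigma> x)))"

definition slot_count :: "nat \<Rightarrow> nat" where "slot_count J = 2 * J + 2"

text \<open>Variable \<open>x\<close> owns the positions \<open>x * slot_count J + k\<close>; among them, the positive and the
  negative occurrence in clause \<open>j\<close> have offset \<open>k = 2 * j + 1\<close> and \<open>k = 2 * j + 2\<close>. The two
  remaining offsets separate the variables from each other.\<close>

definition slot_pos :: "nat \<Rightarrow> nat \<Rightarrow> nat \<Rightarrow> bool" where
  "slot_pos X J g \<longleftrightarrow> (\<exists>x<X. \<exists>k<slot_count J. 1 \<le> k \<and> k \<le> 2 * J \<and> g = x * slot_count J + k)"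

definition slot_opt :: "nat \<Rightarrow> nat \<Rightarrow> (nat \<Rightarrow> nat \<Rightarrow> bool \<Rightarrow> bool) \<Rightarrow> nat \<Rightarrow> nat \<Rightarrow> bool" where
  "slot_opt X J lit j g \<longleftrightarrow> (\<exists>x<X. (lit j x True \<and> g = x * slot_count J + (2 * j + 1)) \<or>
     (lit j x False \<and> g = x * slot_count J + (2 * j + 2)))"

locale cnf =
  fixes X J :: nat and lit :: "nat \<Rightarrow> nat \<Rightarrow> bool \<Rightarrow> bool"
  assumes no_tautology: "\<not> (lit j x True \<and> lit j x False)"
begin

abbreviation K :: nat where "K \<equiv> slot_count J"

abbreviation CP :: "nat \<Rightarrow> bool" where "CP \<equiv> slot_pos X J"

abbreviation COpt :: "nat \<Rightarrow> nat \<Rightarrow> bool" where "COpt \<equiv> slot_opt X J lit"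

lemma split_eq: "k < K \<Longrightarrow> k' < K \<Longrightarrow> x * K + k = x' * K + k' \<longleftrightarrow> x = x' \<and> k = k'"
proof
  assume a: "k < K" "k' < K" "x * K + k = x' * K + k'"
  have "(x * K + k) div K = x" "(x' * K + k') div K = x'" using a(1,2) by auto
  then show "x = x' \<and> k = k'" using a(3) by auto
qed auto

lemma in_range: "x < X \<Longrightarrow> k < K \<Longrightarrow> x * K + k < X * K"
proof -
  assume "x < X" "k < K"
  then have "x * K + k < Suc x * K" by simp
  also have "\<dots> \<le> X * K" using \<open>x < X\<close> by (intro mult_le_mono1) simp
  finally show ?thesis .
qed

lemma COptE:
  assumes "COpt j g"
  obtains x s where "x < X" "lit j x s" "g = x * K + (2 * j + (if s then 1 else 2))"
proof -
  from assms obtain x where "x < X" "(lit j x True \<and> g = x * K + (2 * j + 1)) \<or>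
     (lit j x False \<and> g = x * K + (2 * j + 2))"
    unfolding slot_opt_def by blast
  then show thesis using that[of x True] that[of x False] by auto
qed

lemma CPE:
  assumes "CP g"
  obtains x k where "x < X" "1 \<le> k" "k \<le> 2 * J" "g = x * K + k"
  using assms unfolding slot_pos_def by blast

lemma COptI:
  assumes "x < X" "lit j x s"
  shows "COpt j (x * K + (2 * j + (if s then 1 else 2)))"
  using assms unfolding slot_opt_def by (cases s) auto

sublocale line "X * K" J CP COpt
proof
  show "0 < g \<and> Suc g < X * K" if g: "CP g" for g
  proof -
    from g obtain x k where "x < X" "1 \<le> k" "k \<le> 2 * J" "g = x * K + k"
      by (rule CPE)
    then show ?thesis using in_range[of x "Suc k"] by (auto simp: slot_count_def)
  qed
  show "CP g" if j: "j < J" and o: "COpt j g" for j g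
  proof -
    from o obtain x s where "x < X" "g = x * K + (2 * j + (if s then 1 else 2))"
      by (rule COptE)
    then show ?thesis unfolding slot_pos_def using j
      by (intro exI[of _ x] exI[of _ "2 * j + (if s then 1 else 2)"] conjI) (auto simp: slot_count_def)
  qed
  show "\<not> COpt j (Suc g)" if j: "j < J" and o: "COpt j g" for j g
  proof
    assume o': "COpt j (Suc g)"
    from o obtain x s where x: "x < X" "lit j x s" "g = x * K + (2 * j + (if s then 1 else 2))"
      by (rule COptE)
    from o' obtain x' s' where x': "x' < X" "lit j x' s'"
      "Suc g = x' * K + (2 * j + (if s' then 1 else 2))"
      by (rule COptE)
    \<comment> \<open>The offset of \<open>Suc g\<close> is at most
      \<open>2 * j + 3 \<le> 2 * J + 1\<close>, thanks to the separating offset still in the same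
      segment. So both options belong to one variable, with opposite signs.\<close>
    have "x * K + (2 * j + (if s then 2 else 3)) = x' * K + (2 * j + (if s' then 1 else 2))"
      using x(3) x'(3) by (auto split: if_splits)
    then have "x = x'" "2 * j + (if s then 2 else 3) = 2 * j + (if s' then 1 else 2)"
      using split_eq[of "2 * j + (if s then 2 else 3)" "2 * j + (if s' then 1 else 2)" x x'] j
      by (auto simp: slot_count_def)
    then have "s" "\<not> s'" "x = x'" by (auto split: if_splits)
    then show False using x x' no_tautology[of j x] by auto
  qed
qed

lemma solution_of_sat:
  assumes "cnf_sat X J lit"
  shows "\<exists>l. solution l"
proof -
  from assms obtain \<sigma> where
    \<sigma>: "\<And>j. j < J \<Longrightarrow> \<exists>x<X. \<exists>s. lit j x s \<Longrightarrow> \<exists>x<X. lit j x (\<sigma> x)"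
    unfolding cnf_sat_def by blast
  define pick where "pick j = (SOME x. x < X \<and> lit j x (\<sigma> x))" for j
  \<comment> \<open>If \<open>\<sigma> x\<close> holds, the hubs of segment \<open>x\<close> meet in
    pairs at odd offsets, where the positive occurrences are, and otherwise at even ones: a hub
    stays if its own offset has the right parity and moves up by one if not.\<close>
  define l where "l d = (case d of
      H g \<Rightarrow> (if g mod K = 2 * J + 1 \<or> odd (g mod K) = \<sigma> (g div K) then g else Suc g)
    | C j \<Rightarrow> pick j * K + (2 * j + (if \<sigma> (pick j) then 1 else 2)) | _ \<Rightarrow> 0)" for d
  have pick: "pick j < X" "lit j (pick j) (\<sigma> (pick j))" if j: "C j \<in> verts" for j
  proof -
    obtain g where "j < J" "COpt j g" using j by auto
    then obtain x s where "j < J" "x < X" "lit j x s" using COptE by blast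
    then have "\<exists>x<X. lit j x (\<sigma> x)" using \<sigma>[of j] by blast
    then have "pick j < X \<and> lit j (pick j) (\<sigma> (pick j))"
      unfolding pick_def by (rule someI_ex)
    then show "pick j < X" "lit j (pick j) (\<sigma> (pick j))" by auto
  qed
  have lH: "l (H (x * K + k)) = (if k = 2 * J + 1 \<or> odd k = \<sigma> x then x * K + k else Suc (x * K + k))"
    if "k < K" for x k
    using that by (simp add: l_def)
  have "opt d (l d)" if d: "d \<in> verts" "is_hub d" for d
  proof (cases d)
    case (C j)
    have "C j \<in> verts" using d C by simp
    from COptI[OF pick[OF this]] have "COpt j (l d)" using C by (simp add: l_def)
    then show ?thesis using C by simp
  qed (use d in \<open>auto simp: l_def\<close>)
  moreover have "l (H (g - 1)) = g \<longleftrightarrow> l (H g) = g" if "CP g" for g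
  proof -
    from that obtain x k where k: "x < X" "1 \<le> k" "k \<le> 2 * J" "g = x * K + k"
      by (rule CPE)
    obtain k' where k': "k = Suc k'" using k by (cases k) auto
    have "g - 1 = x * K + k'" using k k' by simp
    then have "l (H (g - 1)) = (if odd k' = \<sigma> x then x * K + k' else Suc (x * K + k'))"
      using lH[of k' x] k k' by (simp add: slot_count_def)
    moreover have "l (H g) = (if odd k = \<sigma> x then x * K + k else Suc (x * K + k))"
      using lH[of k x] k by (simp add: slot_count_def)
    ultimately show ?thesis using k k' by auto
  qed
  moreover have "l (H g) = g" if "CP g" "C j \<in> verts" "l (C j) = g" for g j
  proof -
    let ?k = "2 * j + (if \<sigma> (pick j) then 1 else 2)"
    have g: "g = pick j * K + ?k" using that(3) by (simp add: l_def)
    have "j < J" using that(2) by simp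
    then have "?k < K" by (auto simp: slot_count_def)
    from lH[OF this, of "pick j"] show ?thesis unfolding g by auto
  qed
  ultimately show ?thesis unfolding solution_def by blast
qed

lemma sat_of_solution:
  assumes l: "solution l"
  shows "cnf_sat X J lit"
proof -
  have hub: "opt d (l d)" if "d \<in> verts" "is_hub d" for d
    using l that unfolding solution_def by blast
  have step: "l (H (g - 1)) = g \<longleftrightarrow> l (H g) = g" if "CP g" for g
    using l that unfolding solution_def by blast
  have cl: "l (H g) = g" if "CP g" "C j \<in> verts" "l (C j) = g" for g j
    using l that unfolding solution_def by blast
  \<comment> \<open>Offset 0 is not a compared position, so the first hub of a segment is not tied
    to the previous segment; its choice fixes the parity of the following ones.\<close>
  define \<sigma> where "\<sigma> x = (l (H (x * K)) = Suc (x * K))" for x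
  have main: "l (H (x * K + k)) = (if odd k = \<sigma> x then x * K + k else Suc (x * K + k))"
    if x: "x < X" and "k \<le> 2 * J" for x k
    using that(2)
  proof (induction k)
    case 0
    have "Suc (x * K) < X * K" using in_range[OF x, of 1] by (simp add: slot_count_def)
    then have "l (H (x * K)) = x * K \<or> l (H (x * K)) = Suc (x * K)" using hub[of "H (x * K)"] by simp
    then show ?case by (auto simp: \<sigma>_def)
  next
    case (Suc k)
    let ?g = "x * K + Suc k"
    have "Suc ?g < X * K" using in_range[OF x, of "Suc (Suc k)"] Suc.prems by (simp add: slot_count_def)
    then have "l (H ?g) = ?g \<or> l (H ?g) = Suc ?g" using hub[of "H ?g"] by simp
    moreover have "CP ?g" unfolding slot_pos_def using x Suc.prems
      by (intro exI[of _ x] exI[of _ "Suc k"] conjI) (auto simp: slot_count_def)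
    from step[OF this] have "l (H (x * K + k)) = ?g \<longleftrightarrow> l (H ?g) = ?g" by simp
    ultimately show ?case using Suc by auto
  qed
  have "\<exists>x<X. lit j x (\<sigma> x)" if j: "j < J" and ne: "\<exists>x<X. \<exists>s. lit j x s" for j
  proof -
    from ne obtain x s where xs: "x < X" "lit j x s" by blast
    from COptI[OF xs] have V: "C j \<in> verts" using j by auto
    have o: "COpt j (l (C j))" using hub[OF V] by simp
    then obtain x s where x: "x < X" "lit j x s" "l (C j) = x * K + (2 * j + (if s then 1 else 2))"
      by (rule COptE)
    let ?k = "2 * j + (if s then 1 else 2)"
    have "l (H (x * K + ?k)) = x * K + ?k" using cl[OF Opt_P[OF j o] V refl] x(3) by simp
    moreover have "?k \<le> 2 * J" using j by auto
    ultimately have "odd ?k = \<sigma> x" using main[OF x(1), of ?k] by (auto split: if_splits)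
    then have "\<sigma> x = s" by (auto split: if_splits)
    then show ?thesis using x by blast
  qed
  then show ?thesis unfolding cnf_sat_def by blast
qed

theorem sandwich_iff_sat: "has_even_hole_free_sandwich verts E1 E2 \<longleftrightarrow> cnf_sat X J lit"
  using sandwich_iff_solution solution_of_sat sat_of_solution by blast

end

section \<open>Transfer along injections\<close>

lemma image_doubleton_mem_iff:
  assumes "inj_on f V" "u \<in> V" "v \<in> V" "\<And>e. e \<in> E \<Longrightarrow> e \<subseteq> V"
  shows "{f u, f v} \<in> (`) f ` E \<longleftrightarrow> {u, v} \<in> E"
proof
  assume "{f u, f v} \<in> (`) f ` E"
  then obtain e where e: "e \<in> E" "f ` {u, v} = f ` e" by auto
  then have "{u, v} = e" using assms by (subst (asm) inj_on_image_eq_iff[of f V]) auto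
  then show "{u, v} \<in> E" using e by simp
next
  assume "{u, v} \<in> E"
  then have "f ` {u, v} \<in> (`) f ` E" by blast
  then show "{f u, f v} \<in> (`) f ` E" by simp
qed

text \<open>\<open>V'\<close> may be larger than the image; the additional vertices are isolated,
  whereas each vertex of a hole has a neighbour.\<close>

lemma even_hole_free_image_iff:
  assumes inj: "inj_on f V" and sub: "f ` V \<subseteq> V'" and E: "simple_graph V E"
  shows "even_hole_free V' ((`) f ` E) \<longleftrightarrow> even_hole_free V E"
proof -
  have EV: "e \<subseteq> V" and two: "card e = 2" if "e \<in> E" for e
    using E that unfolding simple_graph_def by auto
  have two': "card e = 2" if e': "e \<in> (`) f ` E" for e
  proof -
    from e' obtain e' where "e' \<in> E" "e = f ` e'" by blast
    then show ?thesis using card_image[OF inj_on_subset[OF inj EV]] two by simp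
  qed
  note mem = image_doubleton_mem_iff[OF inj _ _ EV]
  have fwd: "hole_seq (\<lambda>x y. {x, y} \<in> (`) f ` E) n (\<lambda>i. f (v i))"
    if h: "hole_seq (\<lambda>x y. {x, y} \<in> E) n v" and V: "v ` {..<n} \<subseteq> V" for n v
  proof -
    have "inj_on (\<lambda>i. f (v i)) {..<n}"
    proof (rule inj_onI)
      fix x y assume xy: "x \<in> {..<n}" "y \<in> {..<n}" "f (v x) = f (v y)"
      then have "v x = v y" using inj V unfolding inj_on_def by blast
      then show "x = y" using h xy unfolding hole_seq_def inj_on_def by blast
    qed
    moreover have "{f (v i), f (v j)} \<in> (`) f ` E \<longleftrightarrow> {v i, v j} \<in> E" if "i < n" "j < n" for i j
      using mem[of "v i" "v j"] V that by blast
    ultimately show ?thesis using h unfolding hole_seq_def by simp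
  qed
  have bwd: "\<exists>w. hole_seq (\<lambda>x y. {x, y} \<in> E) n w \<and> w ` {..<n} \<subseteq> V"
    if h: "hole_seq (\<lambda>x y. {x, y} \<in> (`) f ` E) n v" for n v
  proof -
    have n: "4 \<le> n" using h unfolding hole_seq_def by simp
    have ex: "\<exists>u\<in>V. f u = v i" if i: "i < n" for i
    proof -
      obtain j where "j < n" "cyclic_nbrs n i j"
      proof (cases "Suc i = n")
        case True
        then show thesis using that[of 0] n by (simp add: cyclic_nbrs_def)
      next
        case False
        then show thesis using that[of "Suc i"] i by (simp add: cyclic_nbrs_def)
      qed
      then have "{v i, v j} \<in> (`) f ` E" using h i unfolding hole_seq_def by blast
      then obtain e where e: "e \<in> E" "{v i, v j} = f ` e" by blast
      then have "v i \<in> f ` e" by blast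
      then obtain u where "u \<in> e" "v i = f u" by (rule imageE)
      then show ?thesis using EV[OF e(1)] by auto
    qed
    define w where "w i = (SOME u. u \<in> V \<and> f u = v i)" for i
    have w: "w i \<in> V \<and> f (w i) = v i" if "i < n" for i
    proof -
      have "\<exists>u. u \<in> V \<and> f u = v i" using ex[OF that] by blast
      then show ?thesis unfolding w_def by (rule someI_ex)
    qed
    have "inj_on w {..<n}"
    proof (rule inj_onI)
      fix x y assume xy: "x \<in> {..<n}" "y \<in> {..<n}" "w x = w y"
      then have "v x = v y" using w[of x] w[of y] by simp
      then show "x = y" using h xy unfolding hole_seq_def inj_on_def by blast
    qed
    moreover have "{v i, v j} \<in> (`) f ` E \<longleftrightarrow> {w i, w j} \<in> E" if "i < n" "j < n" for i j
      using mem[of "w i" "w j"] w that by simp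
    ultimately have "hole_seq (\<lambda>x y. {x, y} \<in> E) n w" using h unfolding hole_seq_def by simp
    then show ?thesis using w by blast
  qed
  show ?thesis
  proof
    assume *: "even_hole_free V' ((`) f ` E)"
    have "\<not> (hole_seq (\<lambda>x y. {x, y} \<in> E) n v \<and> v ` {..<n} \<subseteq> V \<and> even n)" for n v
    proof
      assume a: "hole_seq (\<lambda>x y. {x, y} \<in> E) n v \<and> v ` {..<n} \<subseteq> V \<and> even n"
      then have "(\<lambda>i. f (v i)) ` {..<n} \<subseteq> V'" using sub by blast
      then show False using * a fwd[of n v] even_hole_free_iff_hole_seq[OF two', where V = V'] by blast
    qed
    then show "even_hole_free V E" using even_hole_free_iff_hole_seq[OF two, where V = V] by blast
  next
    assume *: "even_hole_free V E"
    have "\<not> (hole_seq (\<lambda>x y. {x, y} \<in> (`) f ` E) n v \<and> even n)" for n v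
      using * bwd[of n v] even_hole_free_iff_hole_seq[OF two, where V = V] by blast
    then show "even_hole_free V' ((`) f ` E)" using even_hole_free_iff_hole_seq[OF two', where V = V'] by blast
  qed
qed

lemma simple_graph_image:
  assumes inj: "inj_on f V" and sub: "f ` V \<subseteq> V'" "finite V'" and E: "simple_graph V E"
  shows "simple_graph V' ((`) f ` E)"
proof -
  have "f ` e \<subseteq> V' \<and> card (f ` e) = 2" if "e \<in> E" for e
  proof -
    have e: "e \<subseteq> V" "card e = 2" using E that unfolding simple_graph_def by auto
    then have "card (f ` e) = 2" using card_image[OF inj_on_subset[OF inj e(1)]] by simp
    then show ?thesis using e sub by blast
  qed
  then show ?thesis using sub unfolding simple_graph_def by blast
qed

lemma has_sandwich_image_iff:
  assumes inj: "inj_on f V" and sub: "f ` V \<subseteq> V'" "finite V'" and E2: "simple_graph V E2"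
    and E12: "E1 \<subseteq> E2"
  shows "has_even_hole_free_sandwich V' ((`) f ` E1) ((`) f ` E2) \<longleftrightarrow>
    has_even_hole_free_sandwich V E1 E2"
proof
  assume "has_even_hole_free_sandwich V E1 E2"
  then obtain E where E: "simple_graph V E" "E1 \<subseteq> E" "E \<subseteq> E2" "even_hole_free V E"
    unfolding has_even_hole_free_sandwich_def by blast
  have "simple_graph V' ((`) f ` E)" by (rule simple_graph_image[OF inj sub E(1)])
  moreover have "even_hole_free V' ((`) f ` E)"
    using even_hole_free_image_iff[OF inj sub(1) E(1)] E(4) by simp
  ultimately show "has_even_hole_free_sandwich V' ((`) f ` E1) ((`) f ` E2)"
    unfolding has_even_hole_free_sandwich_def using E by blast
next
  assume "has_even_hole_free_sandwich V' ((`) f ` E1) ((`) f ` E2)"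
  then obtain E' where E': "(`) f ` E1 \<subseteq> E'" "E' \<subseteq> (`) f ` E2" "even_hole_free V' E'"
    unfolding has_even_hole_free_sandwich_def by blast
  define E where "E = {e \<in> E2. f ` e \<in> E'}"
  have s: "simple_graph V E" using E2 unfolding simple_graph_def E_def by blast
  have "E' = (`) f ` E" using E' unfolding E_def by blast
  then have "even_hole_free V E" using even_hole_free_image_iff[OF inj sub(1) s] E'(3) by simp
  moreover have "E1 \<subseteq> E" "E \<subseteq> E2" using E' E12 unfolding E_def by blast+
  ultimately show "has_even_hole_free_sandwich V E1 E2"
    unfolding has_even_hole_free_sandwich_def using s by blast
qed

section \<open>Numeric encodings\<close>

lemma digit_eq:
  fixes u v a c b :: nat
  assumes "a < b" "c < b"
  shows "u * b + a = v * b + c \<longleftrightarrow> u = v \<and> a = c"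
proof
  assume eq: "u * b + a = v * b + c"
  have "(u * b + a) div b = u" "(v * b + c) div b = v" using assms by auto
  then show "u = v \<and> a = c" using eq by auto
qed auto

lemma digit_less:
  fixes u a b :: nat
  assumes "u < b ^ n" "a < b"
  shows "u * b + a < b ^ Suc n"
proof -
  have "u * b + a < Suc u * b" using assms by simp
  also have "\<dots> \<le> b ^ n * b" using assms by (intro mult_le_mono1) simp
  finally show ?thesis by (simp add: mult.commute)
qed

definition vcode :: "nat \<Rightarrow> nat \<Rightarrow> nat \<Rightarrow> nat \<Rightarrow> nat \<Rightarrow> nat \<Rightarrow> nat" where
  "vcode b k t p i a = (((k * b + t) * b + p) * b + i) * b + a"

definition ccode :: "nat \<Rightarrow> nat \<Rightarrow> nat \<Rightarrow> nat \<Rightarrow> nat \<Rightarrow> nat \<Rightarrow> nat \<Rightarrow> nat" where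
  "ccode b k t p i a c = vcode b k t p i a * b + c"

lemma vcode_eq:
  assumes "t < b" "p < b" "i < b" "a < b" "t' < b" "p' < b" "i' < b" "a' < b"
  shows "vcode b k t p i a = vcode b k' t' p' i' a' \<longleftrightarrow> k = k' \<and> t = t' \<and> p = p' \<and> i = i' \<and> a = a'"
  unfolding vcode_def digit_eq[OF assms(4,8)] digit_eq[OF assms(3,7)] digit_eq[OF assms(2,6)]
    digit_eq[OF assms(1,5)] by blast

lemma ccode_eq:
  assumes "t < b" "p < b" "i < b" "a < b" "c < b" "t' < b" "p' < b" "i' < b" "a' < b" "c' < b"
  shows "ccode b k t p i a c = ccode b k' t' p' i' a' c' \<longleftrightarrow>
    k = k' \<and> t = t' \<and> p = p' \<and> i = i' \<and> a = a' \<and> c = c'"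
  unfolding ccode_def digit_eq[OF assms(5,10)] vcode_eq[OF assms(1-4,6-9)] by blast

lemma vcode_less:
  assumes "k < b" "t < b" "p < b" "i < b" "a < b"
  shows "vcode b k t p i a < b ^ 5"
proof -
  have "k < b ^ 1" using assms by simp
  moreover have "Suc (Suc (Suc (Suc 1))) = (5 :: nat)" by simp
  ultimately show ?thesis
    using digit_less[OF digit_less[OF digit_less[OF digit_less[OF _ assms(2)] assms(3)] assms(4)] assms(5),
        of k 1]
    unfolding vcode_def by (simp only:)
qed

lemma ccode_less:
  assumes "k < b" "t < b" "p < b" "i < b" "a < b" "c < b"
  shows "ccode b k t p i a c < b ^ 6"
proof -
  have "Suc 5 = (6 :: nat)" by simp
  then show ?thesis
    using digit_less[OF vcode_less[OF assms(1-5)] assms(6)] unfolding ccode_def by (simp only:)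
qed

context tableau
begin

text \<open>Digits are guessed by bounded quantifiers and compared with the code; decoding by
  division is avoided, which keeps the relation within the definable ones.\<close>

definition nlit :: "nat \<Rightarrow> nat \<Rightarrow> bool \<Rightarrow> bool" where
  "nlit j y s \<longleftrightarrow> (\<exists>K<b. \<exists>t<b. \<exists>p<b. \<exists>i<b. \<exists>a<b. \<exists>c<b.
     \<exists>k'<b. \<exists>t'<b. \<exists>p'<b. \<exists>i'<b. \<exists>a'<b.
     j = ccode b K t p i a c \<and> y = vcode b k' t' p' i' a' \<and> lit_rel K t p i a c k' t' p' i' a' s)"

lemma nlitE:
  assumes "nlit j y s"
  obtains K t p i a c k' t' p' i' a' where "K < b" "t < b" "p < b" "i < b" "a < b" "c < b"
    "k' < b" "t' < b" "p' < b" "i' < b" "a' < b" "j = ccode b K t p i a c" "y = vcode b k' t' p' i' a'"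
    "lit_rel K t p i a c k' t' p' i' a' s"
  using assms unfolding nlit_def
proof (elim exE conjE)
  fix K t p i a c k' t' p' i' a'
  assume l: "lit_rel K t p i a c k' t' p' i' a' s"
    and d: "K < b" "t < b" "p < b" "i < b" "a < b" "c < b" "k' < b" "t' < b" "p' < b" "i' < b" "a' < b"
    and e: "j = ccode b K t p i a c" "y = vcode b k' t' p' i' a'"
  show thesis by (rule that[OF d e l])
qed

lemma nlit_code:
  assumes "K < b" "t < b" "p < b" "i < b" "a < b" "c < b" "k' < b" "t' < b" "p' < b" "i' < b" "a' < b"
  shows "nlit (ccode b K t p i a c) (vcode b k' t' p' i' a') s \<longleftrightarrow> lit_rel K t p i a c k' t' p' i' a' s"
proof
  assume "nlit (ccode b K t p i a c) (vcode b k' t' p' i' a') s"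
  then obtain K2 t2 p2 i2 a2 c2 k2' t2' p2' i2' a2' where
    l: "t2 < b" "p2 < b" "i2 < b" "a2 < b" "c2 < b" "t2' < b" "p2' < b" "i2' < b" "a2' < b"
    and e: "ccode b K t p i a c = ccode b K2 t2 p2 i2 a2 c2"
      "vcode b k' t' p' i' a' = vcode b k2' t2' p2' i2' a2'"
    and r: "lit_rel K2 t2 p2 i2 a2 c2 k2' t2' p2' i2' a2' s"
    by (rule nlitE)
  have "K = K2 \<and> t = t2 \<and> p = p2 \<and> i = i2 \<and> a = a2 \<and> c = c2"
    using e(1) ccode_eq[OF assms(2-6) l(1-5)] by blast
  moreover have "k' = k2' \<and> t' = t2' \<and> p' = p2' \<and> i' = i2' \<and> a' = a2'"
    using e(2) vcode_eq[OF assms(8-11) l(6-9)] by blast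
  ultimately show "lit_rel K t p i a c k' t' p' i' a' s" using r by simp
next
  assume "lit_rel K t p i a c k' t' p' i' a' s"
  then show "nlit (ccode b K t p i a c) (vcode b k' t' p' i' a') s"
    unfolding nlit_def
    by - (rule exI[of _ "K"], rule conjI, rule assms(1), rule exI[of _ "t"], rule conjI, rule assms(2),
        rule exI[of _ "p"], rule conjI, rule assms(3), rule exI[of _ "i"], rule conjI, rule assms(4),
        rule exI[of _ "a"], rule conjI, rule assms(5), rule exI[of _ "c"], rule conjI, rule assms(6),
        rule exI[of _ "k'"], rule conjI, rule assms(7), rule exI[of _ "t'"], rule conjI, rule assms(8),
        rule exI[of _ "p'"], rule conjI, rule assms(9), rule exI[of _ "i'"], rule conjI, rule
        assms(10), rule exI[of _ "a'"], rule conjI, rule assms(11), simp)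
qed

lemma cnf_nlit: "cnf nlit"
proof
  fix j y
  show "\<not> (nlit j y True \<and> nlit j y False)"
  proof
    assume n: "nlit j y True \<and> nlit j y False"
    then have "nlit j y True" by blast
    then obtain K t p i a c k' t' p' i' a' where
      d: "K < b" "t < b" "p < b" "i < b" "a < b" "c < b" "k' < b" "t' < b" "p' < b" "i' < b" "a' < b"
      and e: "j = ccode b K t p i a c" "y = vcode b k' t' p' i' a'"
      by (rule nlitE)
    show False using n nlit_code[OF d] lit_rel_no_tautology unfolding e by blast
  qed
qed

lemma cnf_sat_iff_tab_sat: "cnf_sat (b ^ 5) (b ^ 6) nlit \<longleftrightarrow> (\<exists>\<sigma>. tab_sat \<sigma>)"
proof
  assume "cnf_sat (b ^ 5) (b ^ 6) nlit"
  then obtain \<tau> where \<tau>: "\<And>j. j < b ^ 6 \<Longrightarrow> \<exists>y<b ^ 5. \<exists>s. nlit j y s \<Longrightarrow> \<exists>y<b ^ 5. nlit j y (\<tau> y)"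
    unfolding cnf_sat_def by blast
  define \<sigma> where "\<sigma> k' t' p' i' a' = \<tau> (vcode b k' t' p' i' a')" for k' t' p' i' a'
  have "tab_sat \<sigma>"
    unfolding tab_sat_def
  proof (intro allI impI)
    fix K t p i a c assume d: "K < b" "t < b" "p < b" "i < b" "a < b" "c < b"
      and "\<exists>k'<b. \<exists>t'<b. \<exists>p'<b. \<exists>i'<b. \<exists>a'<b. \<exists>s. lit_rel K t p i a c k' t' p' i' a' s"
    then obtain k' t' p' i' a' s where d': "k' < b" "t' < b" "p' < b" "i' < b" "a' < b"
      and l: "lit_rel K t p i a c k' t' p' i' a' s" by blast
    let ?j = "ccode b K t p i a c"
    have "nlit ?j (vcode b k' t' p' i' a') s" using nlit_code[OF d d'] l by blast
    then obtain y where y: "y < b ^ 5" "nlit ?j y (\<tau> y)"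
      using \<tau>[OF ccode_less[OF d]] vcode_less[OF d'] by blast
    from y(2) obtain K2 t2 p2 i2 a2 c2 k2 t2' p2' i2' a2' where
      e: "k2 < b" "t2' < b" "p2' < b" "i2' < b" "a2' < b" "y = vcode b k2 t2' p2' i2' a2'"
      by (rule nlitE)
    have "lit_rel K t p i a c k2 t2' p2' i2' a2' (\<tau> y)"
      using y(2) nlit_code[OF d e(1-5)] unfolding e(6) by blast
    then have "lit_rel K t p i a c k2 t2' p2' i2' a2' (\<sigma> k2 t2' p2' i2' a2')"
      unfolding \<sigma>_def e(6) .
    then show "\<exists>k'<b. \<exists>t'<b. \<exists>p'<b. \<exists>i'<b. \<exists>a'<b.
        lit_rel K t p i a c k' t' p' i' a' (\<sigma> k' t' p' i' a')"
      using e(1-5) by blast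
  qed
  then show "\<exists>\<sigma>. tab_sat \<sigma>" by blast
next
  assume "\<exists>\<sigma>. tab_sat \<sigma>"
  then obtain \<sigma> where \<sigma>: "tab_sat \<sigma>" by blast
  define \<tau> where "\<tau> y = (\<exists>k'<b. \<exists>t'<b. \<exists>p'<b. \<exists>i'<b. \<exists>a'<b. y = vcode b k' t' p' i' a' \<and> \<sigma> k' t' p' i' a')" for y
  have \<tau>: "\<tau> (vcode b k' t' p' i' a') = \<sigma> k' t' p' i' a'"
    if d: "k' < b" "t' < b" "p' < b" "i' < b" "a' < b" for k' t' p' i' a'
  proof
    assume "\<tau> (vcode b k' t' p' i' a')"
    then obtain k2 t2 p2 i2 a2 where l: "t2 < b" "p2 < b" "i2 < b" "a2 < b"
      and e: "vcode b k' t' p' i' a' = vcode b k2 t2 p2 i2 a2" and s: "\<sigma> k2 t2 p2 i2 a2"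
      unfolding \<tau>_def by blast
    have "k' = k2 \<and> t' = t2 \<and> p' = p2 \<and> i' = i2 \<and> a' = a2" using e vcode_eq[OF d(2-5) l] by blast
    then show "\<sigma> k' t' p' i' a'" using s by simp
  next
    assume "\<sigma> k' t' p' i' a'"
    then show "\<tau> (vcode b k' t' p' i' a')" unfolding \<tau>_def
      by - (rule exI[of _ "k'"], rule conjI, rule d(1), rule exI[of _ "t'"], rule conjI, rule d(2), rule
        exI[of _ "p'"], rule conjI, rule d(3), rule exI[of _ "i'"], rule conjI, rule d(4), rule exI[of
        _ "a'"], rule conjI, rule d(5), simp)
  qed
  have "\<exists>y<b ^ 5. nlit j y (\<tau> y)" if ne: "\<exists>y<b ^ 5. \<exists>s. nlit j y s" for j
  proof -
    from ne obtain y0 s0 where "nlit j y0 s0" by blast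
    then obtain K t p i a c k' t' p' i' a' where d: "K < b" "t < b" "p < b" "i < b" "a < b" "c < b"
      and d': "k' < b" "t' < b" "p' < b" "i' < b" "a' < b"
      and e: "j = ccode b K t p i a c" and l: "lit_rel K t p i a c k' t' p' i' a' s0"
      by (rule nlitE)
    have "\<exists>k'<b. \<exists>t'<b. \<exists>p'<b. \<exists>i'<b. \<exists>a'<b. \<exists>s. lit_rel K t p i a c k' t' p' i' a' s"
      using d' l by blast
    from \<sigma>[unfolded tab_sat_def, rule_format, OF d this]
    obtain k2 t2 p2 i2 a2 where d2: "k2 < b" "t2 < b" "p2 < b" "i2 < b" "a2 < b"
      and l2: "lit_rel K t p i a c k2 t2 p2 i2 a2 (\<sigma> k2 t2 p2 i2 a2)" by blast
    have "nlit j (vcode b k2 t2 p2 i2 a2) (\<tau> (vcode b k2 t2 p2 i2 a2))"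
      using nlit_code[OF d d2] l2 \<tau>[OF d2] unfolding e by simp
    then show ?thesis using vcode_less[OF d2] by blast
  qed
  then show "cnf_sat (b ^ 5) (b ^ 6) nlit" unfolding cnf_sat_def by blast
qed

end

section \<open>Vertices as numbers, adjacency as bounded arithmetic\<close>

fun code :: "vert \<Rightarrow> nat" where
  "code (W i) = 5 * i"
| "code (H g) = 5 * g + 1"
| "code (C j) = 5 * j + 2"
| "code (S g b) = (if b then 5 * g + 4 else 5 * g + 3)"

lemma inj_code: "inj code"
proof (rule injI)
  fix u v :: vert assume "code u = code v"
  then show "u = v" by (cases u; cases v) (auto split: if_splits; presburger)+
qed

text \<open>Counterpart of \<open>is_hub\<close> on the codes of vertices. All quantifiers are
  bounded; for the options this loses nothing, since they lie below \<open>G\<close>.\<close>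

definition nhub :: "nat \<Rightarrow> nat \<Rightarrow> (nat \<Rightarrow> nat \<Rightarrow> bool) \<Rightarrow> nat \<Rightarrow> bool" where
  "nhub G J Opt a \<longleftrightarrow> (\<exists>g<G. Suc g < G \<and> a = 5 * g + 1) \<or>
     (\<exists>j<J. (\<exists>g<G. Opt j g) \<and> a = 5 * j + 2)"

definition nopt :: "nat \<Rightarrow> nat \<Rightarrow> (nat \<Rightarrow> nat \<Rightarrow> bool) \<Rightarrow> nat \<Rightarrow> nat \<Rightarrow> bool" where
  "nopt G J Opt a d \<longleftrightarrow> (\<exists>g<G. Suc g < G \<and> a = 5 * g + 1 \<and> (d = g \<or> d = Suc g)) \<or>
     (\<exists>j<J. a = 5 * j + 2 \<and> Opt j d)"

text \<open>Here \<open>10 * G\<close> is the code of \<open>W (2 * G)\<close>,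
  \<open>10 * g + 5\<close> that of \<open>W (2 * g + 1)\<close>, and \<open>b + 4 = 5 * g\<close>
  says without subtraction that \<open>b\<close> is the code of \<open>H (g - 1)\<close>.\<close>

definition nforced :: "nat \<Rightarrow> nat \<Rightarrow> (nat \<Rightarrow> bool) \<Rightarrow> (nat \<Rightarrow> nat \<Rightarrow> bool) \<Rightarrow> nat \<Rightarrow> nat \<Rightarrow> bool" where
  "nforced G J P Opt a b \<longleftrightarrow>
     (\<exists>i<2 * G. a = 5 * i \<and> b = 5 * i + 5) \<or>
     (nhub G J Opt a \<and> ((nhub G J Opt b \<and> a \<noteq> b) \<or> b = 0 \<or> b = 10 * G)) \<or>
     (\<exists>g<G. P g \<and> ((a = 5 * g + 3 \<and> (b = 10 * g + 5 \<or> b + 4 = 5 * g)) \<or>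
        (a = 5 * g + 4 \<and> (b = 10 * g + 5 \<or> b = 5 * g + 1))))"

definition noptional :: "nat \<Rightarrow> nat \<Rightarrow> (nat \<Rightarrow> bool) \<Rightarrow> (nat \<Rightarrow> nat \<Rightarrow> bool) \<Rightarrow> nat \<Rightarrow> nat \<Rightarrow> bool" where
  "noptional G J P Opt a b \<longleftrightarrow>
     (\<exists>d<G. nopt G J Opt a d \<and> nhub G J Opt a \<and> b = 10 * d + 5) \<or>
     (\<exists>g<G. P g \<and> (a = 5 * g + 3 \<or> a = 5 * g + 4) \<and>
        (b = 10 * g \<or> b = 10 * g + 10 \<or> (nhub G J Opt b \<and> \<not> nopt G J Opt b g)))"

context line
begin

lemma P_less: "P g \<Longrightarrow> g < G" using P_range[of g] by simp

lemma nhub_iff: "nhub G J Opt a \<longleftrightarrow> (\<exists>u\<in>verts. is_hub u \<and> a = code u)"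
proof
  assume "nhub G J Opt a"
  then consider g where "Suc g < G" "a = 5 * g + 1" | j g where "j < J" "Opt j g" "a = 5 * j + 2"
    unfolding nhub_def by blast
  then show "\<exists>u\<in>verts. is_hub u \<and> a = code u"
  proof cases
    case 1
    then show ?thesis by (intro bexI[of _ "H g"]) auto
  next
    case 2
    then show ?thesis by (intro bexI[of _ "C j"]) auto
  qed
next
  assume "\<exists>u\<in>verts. is_hub u \<and> a = code u"
  then obtain u where u: "u \<in> verts" "is_hub u" "a = code u" by blast
  show "nhub G J Opt a"
  proof (cases u)
    case (H g)
    then show ?thesis using u unfolding nhub_def by auto
  next
    case (C j)
    then obtain g where "j < J" "Opt j g" "g < G" using u opt_range[of u] by auto
    then show ?thesis using u C unfolding nhub_def by auto
  qed (use u in auto)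
qed

lemma nopt_iff:
  assumes "u \<in> verts" "is_hub u"
  shows "nopt G J Opt (code u) d \<longleftrightarrow> opt u d"
proof (cases u)
  case (H g)
  have "5 * g + 1 \<noteq> 5 * j + 2" for j :: nat by presburger
  then show ?thesis using H assms unfolding nopt_def by auto
next
  case (C j)
  have "5 * j + 2 \<noteq> 5 * g + 1" for g :: nat by presburger
  then show ?thesis using C assms unfolding nopt_def by auto
qed (use assms in auto)

definition rel_code :: "(vert \<Rightarrow> vert \<Rightarrow> bool) \<Rightarrow> nat \<Rightarrow> nat \<Rightarrow> bool" where
  "rel_code R a b \<longleftrightarrow> (\<exists>u\<in>verts. \<exists>v\<in>verts. u \<noteq> v \<and> a = code u \<and> b = code v \<and> R u v)"

lemma rel_codeI: "u \<in> verts \<Longrightarrow> v \<in> verts \<Longrightarrow> u \<noteq> v \<Longrightarrow> R u v \<Longrightarrow> a = code u \<Longrightarrow> b = code v \<Longrightarrow> rel_code R a b"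
  unfolding rel_code_def by metis

lemma nforced_iff: "nforced G J P Opt a b \<longleftrightarrow> rel_code forced a b"
proof
  assume "nforced G J P Opt a b"
  then consider i where "i < 2 * G" "a = 5 * i" "b = 5 * i + 5"
    | "nhub G J Opt a" "nhub G J Opt b" "a \<noteq> b" | "nhub G J Opt a" "b = 0 \<or> b = 10 * G"
    | g where "P g" "a = 5 * g + 3" "b = 10 * g + 5 \<or> b + 4 = 5 * g"
    | g where "P g" "a = 5 * g + 4" "b = 10 * g + 5 \<or> b = 5 * g + 1"
    unfolding nforced_def by blast
  then show "rel_code forced a b"
  proof cases
    case 1
    then show ?thesis by (intro rel_codeI[of "W i" "W (Suc i)"]) (auto simp: forced_def)
  next
    case 2
    then obtain u v where "u \<in> verts" "is_hub u" "a = code u" "v \<in> verts" "is_hub v" "b = code v"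
      unfolding nhub_iff by blast
    then show ?thesis using 2 by (intro rel_codeI[of u v]) (auto simp: forced_def)
  next
    case 3
    then obtain u where u: "u \<in> verts" "is_hub u" "a = code u" unfolding nhub_iff by blast
    then have "u \<noteq> W i" for i by auto
    with 3(2) u show ?thesis
      by (elim disjE; intro rel_codeI[of u "W (b div 5)"]) (auto simp: forced_def)
  next
    case 4
    then have g: "0 < g" "Suc g < G" using P_range[of g] by auto
    from 4(3) show ?thesis
    proof
      assume "b = 10 * g + 5"
      then show ?thesis using 4 g by (intro rel_codeI[of "S g False" "W (2 * g + 1)"]) (auto simp: forced_def)
    next
      assume "b + 4 = 5 * g"
      then show ?thesis using 4 g
        by (intro rel_codeI[of "S g False" "H (g - 1)"]) (auto simp: forced_def own_def)
    qed
  next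
    case 5
    then have g: "0 < g" "Suc g < G" using P_range[of g] by auto
    from 5(3) show ?thesis
    proof
      assume "b = 10 * g + 5"
      then show ?thesis using 5 g by (intro rel_codeI[of "S g True" "W (2 * g + 1)"]) (auto simp: forced_def)
    next
      assume "b = 5 * g + 1"
      then show ?thesis using 5 g
        by (intro rel_codeI[of "S g True" "H g"]) (auto simp: forced_def own_def)
    qed
  qed
next
  assume "rel_code forced a b"
  then obtain u v where uv: "u \<in> verts" "v \<in> verts" "u \<noteq> v" "a = code u" "b = code v" "forced u v"
    unfolding rel_code_def by blast
  from uv(6)[unfolded forced_def] consider i where "u = W i" "v = W (Suc i)" | "is_hub u" "is_hub v"
    | "is_hub u" "v = W 0 \<or> v = W (2 * G)" | g c where "u = S g c" "v = W (2 * g + 1)"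
    | g c where "u = S g c" "v = own g c"
    by blast
  then show "nforced G J P Opt a b"
  proof cases
    case 1
    then have "i < 2 * G \<and> a = 5 * i \<and> b = 5 * i + 5" using uv by simp
    then show ?thesis unfolding nforced_def by blast
  next
    case 2
    have "a \<noteq> b" using uv inj_code unfolding inj_def by blast
    moreover have "nhub G J Opt a" "nhub G J Opt b" unfolding nhub_iff using uv 2 by blast+
    ultimately show ?thesis unfolding nforced_def by blast
  next
    case 3
    have "nhub G J Opt a" unfolding nhub_iff using uv 3 by blast
    moreover have "b = 0 \<or> b = 10 * G" using uv 3 by auto
    ultimately show ?thesis unfolding nforced_def by blast
  next
    case 4
    then have g: "P g" "g < G" using uv P_less by auto
    have "b = 10 * g + 5" using 4 uv by simp
    moreover have "a = 5 * g + 3 \<or> a = 5 * g + 4" using 4 uv by (cases c) auto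
    ultimately show ?thesis unfolding nforced_def using g by blast
  next
    case 5
    then have g: "P g" "g < G" "0 < g" using uv P_less P_range[of g] by auto
    show ?thesis
    proof (cases c)
      case True
      then have "a = 5 * g + 4" "b = 5 * g + 1" using 5 uv by (auto simp: own_def)
      then show ?thesis unfolding nforced_def using g by blast
    next
      case False
      then have "a = 5 * g + 3" "b + 4 = 5 * g" using 5 uv g by (auto simp: own_def)
      then show ?thesis unfolding nforced_def using g by blast
    qed
  qed
qed

lemma noptional_iff: "noptional G J P Opt a b \<longleftrightarrow> rel_code optional a b"
proof
  assume "noptional G J P Opt a b"
  then consider d where "d < G" "nopt G J Opt a d" "nhub G J Opt a" "b = 10 * d + 5"
    | g where "P g" "a = 5 * g + 3 \<or> a = 5 * g + 4" "b = 10 * g \<or> b = 10 * g + 10"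
    | g where "P g" "a = 5 * g + 3 \<or> a = 5 * g + 4" "nhub G J Opt b" "\<not> nopt G J Opt b g"
    unfolding noptional_def by blast
  then show "rel_code optional a b"
  proof cases
    case 1
    then obtain u where u: "u \<in> verts" "is_hub u" "a = code u" unfolding nhub_iff by blast
    then have "opt u d" "u \<noteq> W (2 * d + 1)" using 1 nopt_iff by auto
    then show ?thesis using 1 u by (intro rel_codeI[of u "W (2 * d + 1)"]) (auto simp: optional_def)
  next
    case 2
    then have g: "Suc g < G" using P_range[of g] by auto
    obtain c where c: "a = code (S g c)" using 2(2) by (metis code.simps(4))
    show ?thesis using 2 g c
      by (elim disjE; intro rel_codeI[of "S g c" "W (b div 5)"]) (auto simp: optional_def)
  next
    case 3
    obtain c where c: "a = code (S g c)" using 3(2) by (metis code.simps(4))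
    obtain v where v: "v \<in> verts" "is_hub v" "b = code v" using 3 unfolding nhub_iff by blast
    then have "\<not> opt v g" "v \<noteq> S g c" using 3 nopt_iff by auto
    then show ?thesis using 3 c v by (intro rel_codeI[of "S g c" v]) (auto simp: optional_def)
  qed
next
  assume "rel_code optional a b"
  then obtain u v where uv: "u \<in> verts" "v \<in> verts" "u \<noteq> v" "a = code u" "b = code v" "optional u v"
    unfolding rel_code_def by blast
  from uv(6)[unfolded optional_def] consider d where "is_hub u" "opt u d" "v = W (2 * d + 1)"
    | g c where "u = S g c" "v = W (2 * g) \<or> v = W (2 * g + 2)"
    | g c where "u = S g c" "is_hub v" "\<not> opt v g" by blast
  then show "noptional G J P Opt a b"
  proof cases
    case 1
    have "nhub G J Opt a" "nopt G J Opt a d" using uv 1 nopt_iff nhub_iff by blast+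
    moreover have "d < G" "b = 10 * d + 5" using opt_range[OF uv(1) 1(2)] uv 1 by auto
    ultimately show ?thesis unfolding noptional_def by blast
  next
    case 2
    then have g: "P g" "g < G" using uv P_less by auto
    have "b = 10 * g \<or> b = 10 * g + 10" using 2 uv by auto
    moreover have "a = 5 * g + 3 \<or> a = 5 * g + 4" using 2 uv by (cases c) auto
    ultimately show ?thesis unfolding noptional_def using g by blast
  next
    case 3
    then have g: "P g" "g < G" using uv P_less by auto
    have "nhub G J Opt b" "\<not> nopt G J Opt b g" using uv 3 nopt_iff nhub_iff by blast+
    moreover have "a = 5 * g + 3 \<or> a = 5 * g + 4" using 3 uv by (cases c) auto
    ultimately show ?thesis unfolding noptional_def using g by blast
  qed
qed

lemma edge_code_iff: "{a, b} \<in> (`) code ` edges_on verts R \<longleftrightarrow> rel_code R a b \<or> rel_code R b a"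
proof
  assume "{a, b} \<in> (`) code ` edges_on verts R"
  then obtain u v where uv: "u \<in> verts" "v \<in> verts" "u \<noteq> v" "R u v" "{a, b} = {code u, code v}"
    unfolding edges_on_def by auto
  then show "rel_code R a b \<or> rel_code R b a" unfolding rel_code_def doubleton_eq_iff by blast
next
  have *: "{a, b} \<in> (`) code ` edges_on verts R" if "rel_code R a b" for a b
  proof -
    from that obtain u v where "u \<in> verts" "v \<in> verts" "u \<noteq> v" "a = code u" "b = code v" "R u v"
      unfolding rel_code_def by blast
    then have "{u, v} \<in> edges_on verts R" "{a, b} = code ` {u, v}" by (auto simp: edges_on_iff)
    then show ?thesis by blast
  qed
  assume "rel_code R a b \<or> rel_code R b a"
  then show "{a, b} \<in> (`) code ` edges_on verts R" using *[of a b] *[of b a] by (auto simp: insert_commute)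
qed

lemma rel_code_disj: "rel_code (\<lambda>u v. R u v \<or> R' u v) a b \<longleftrightarrow> rel_code R a b \<or> rel_code R' a b"
proof
  assume "rel_code (\<lambda>u v. R u v \<or> R' u v) a b"
  then obtain u v where "u \<in> verts" "v \<in> verts" "u \<noteq> v" "a = code u" "b = code v" "R u v \<or> R' u v"
    unfolding rel_code_def by blast
  then show "rel_code R a b \<or> rel_code R' a b" unfolding rel_code_def by metis
next
  assume "rel_code R a b \<or> rel_code R' a b"
  then show "rel_code (\<lambda>u v. R u v \<or> R' u v) a b" unfolding rel_code_def by metis
qed

lemma E1_code_iff: "{a, b} \<in> (`) code ` E1 \<longleftrightarrow> nforced G J P Opt a b \<or> nforced G J P Opt b a"
  unfolding E1_def edge_code_iff nforced_iff ..

lemma E2_code_iff: "{a, b} \<in> (`) code ` E2 \<longleftrightarrow>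
    (nforced G J P Opt a b \<or> noptional G J P Opt a b) \<or> (nforced G J P Opt b a \<or> noptional G J P Opt b a)"
  unfolding E2_def edge_code_iff nforced_iff noptional_iff
    rel_code_disj[of forced optional a b] rel_code_disj[of forced optional b a] ..

text \<open>A simple bound above all codes. Numbers that code no vertex become isolated vertices,
  which lie in no hole.\<close>

definition vertex_count :: nat where "vertex_count = 10 * G + 5 * J + 10"

lemma code_range: "code ` verts \<subseteq> {0..<vertex_count}"
proof
  fix a assume "a \<in> code ` verts"
  then obtain u where u: "u \<in> verts" "a = code u" by blast
  then show "a \<in> {0..<vertex_count}"
    by (cases u) (auto simp: vertex_count_def dest!: P_less)
qed

lemma sandwich_code:
  "sandwich_instance {0..<vertex_count} ((`) code ` E1) ((`) code ` E2)"
  "has_even_hole_free_sandwich {0..<vertex_count} ((`) code ` E1) ((`) code ` E2) \<longleftrightarrow>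
     has_even_hole_free_sandwich verts E1 E2"
proof -
  have inj: "inj_on code verts" using inj_code by (rule inj_on_subset) simp
  have s: "simple_graph verts E1" "simple_graph verts E2"
    unfolding E1_def E2_def by (rule simple_graph_edges_on[OF finite_verts])+
  have sub: "E1 \<subseteq> E2" unfolding E1_def E2_def by (rule edges_on_mono) blast
  show "sandwich_instance {0..<vertex_count} ((`) code ` E1) ((`) code ` E2)"
    unfolding sandwich_instance_def
    using simple_graph_image[OF inj code_range _ s(1)] simple_graph_image[OF inj code_range _ s(2)] sub
    by auto
  show "has_even_hole_free_sandwich {0..<vertex_count} ((`) code ` E1) ((`) code ` E2) \<longleftrightarrow>
     has_even_hole_free_sandwich verts E1 E2"
    by (rule has_sandwich_image_iff[OF inj code_range _ s(2) sub]) simp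
qed

lemma encode_code:
  "encode_instance vertex_count ((`) code ` E1) ((`) code ` E2) =
    replicate vertex_count True @ [False] @
    concat (map (\<lambda>a. map (\<lambda>b. nforced G J P Opt a b \<or> nforced G J P Opt b a) [0..<vertex_count])
      [0..<vertex_count]) @
    concat (map (\<lambda>a. map (\<lambda>b. (nforced G J P Opt a b \<or> noptional G J P Opt a b) \<or>
      (nforced G J P Opt b a \<or> noptional G J P Opt b a)) [0..<vertex_count]) [0..<vertex_count])"
  unfolding encode_instance_def adjacency_bits_def E1_code_iff E2_code_iff ..

end

section \<open>The reduction is computable in polynomial time\<close>

text \<open>Moves the arguments of a definable function to fresh slots above \<open>n\<close>, where
  terms over the first \<open>n\<close> variables can be substituted for them.\<close>

lemma pterm_shift:
  assumes f: "pterm k f"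
  shows "pterm (n + k) (\<lambda>e x. f (\<lambda>i. e (n + i)) x)"
  unfolding pterm_def
proof (intro conjI allI impI)
  show "depends_below (n + k) (\<lambda>e x. f (\<lambda>i. e (n + i)) x)"
    unfolding depends_below_def
  proof (intro allI impI)
    fix e e' :: "nat \<Rightarrow> nat" and x assume "\<forall>i<n + k. e i = e' i"
    then show "f (\<lambda>i. e (n + i)) x = f (\<lambda>i. e' (n + i)) x"
      by (intro depends_belowD[OF pterm_depends[OF f], of "\<lambda>i. e (n + i)" "\<lambda>i. e' (n + i)" x]) simp
  qed
  fix \<rho> q assume r: "\<forall>i<n + k. \<rho> i < (q::nat)"
  then have "\<forall>i<k. \<rho> (n + i) < q" by simp
  then obtain c p where c: "computes k (\<lambda>i. \<rho> (n + i)) q f c p"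
    using ptermE[OF f, of "\<lambda>i. \<rho> (n + i)" q] by blast
  have "computes (n + k) \<rho> q (\<lambda>e x. f (\<lambda>i. e (n + i)) x) c p"
    unfolding computes_def
  proof (intro allI impI)
    fix x e m B w assume "good_env (n + k) \<rho> q p x e m B"
    then have "good_env k (\<lambda>i. \<rho> (n + i)) q p x e m B" unfolding good_env_def by simp
    then show "f (\<lambda>i. e (\<rho> (n + i))) x \<le> poly p m \<and>
        exec x B c (e, 0, w) (e(q := f (\<lambda>i. e (\<rho> (n + i))) x), 0, w)"
      using c unfolding computes_def by blast
  qed
  then show "\<exists>c p. computes (n + k) \<rho> q (\<lambda>e x. f (\<lambda>i. e (n + i)) x) c p" by blast
qed

text \<open>Substitution as a bounded quantifier: the unique \<open>v < u + 1\<close> with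
  \<open>v = u\<close>.\<close>

lemma ppred_let:
  assumes u: "pterm n u" and P: "ppred (Suc n) (\<lambda>e x. P (e n) e x)"
    and ind: "\<And>v w e x. P v (e(n := w)) x \<longleftrightarrow> P v e x"
  shows "ppred n (\<lambda>e x. P (u e x) e x)"
proof -
  have "ppred n (\<lambda>e x. \<exists>v<u e x + 1. v = u e x \<and> P v e x)"
    by (rule ppred_ex[where P = "\<lambda>v e x. v = u e x \<and> P v e x", OF pterm_add[OF u pterm_const[of n 1]]
          ppred_conj[OF ppred_eq[OF pterm_var pterm_Suc[OF u]] P]])
      (use ind pterm_update[OF u] in simp_all)
  then show ?thesis by (rule ppred_cong) auto
qed

lemma ppred_subst1:
  assumes R: "ppred 1 (\<lambda>e x. R (e 0) x)" and u: "pterm n u"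
  shows "ppred n (\<lambda>e x. R (u e x) x)"
proof -
  have "ppred (n + 1) (\<lambda>e x. R (e n) x)"
    using pterm_shift[OF R[unfolded ppred_def], of n] unfolding ppred_def by simp
  then have "ppred (Suc n) (\<lambda>e x. R (e n) x)" by simp
  then show ?thesis by (rule ppred_let[where P = "\<lambda>v e x. R v x", OF u]) simp
qed

lemma ppred_subst2:
  assumes R: "ppred 2 (\<lambda>e x. R (e 0) (e 1) x)" and u: "pterm n u" and v: "pterm n v"
  shows "ppred n (\<lambda>e x. R (u e x) (v e x) x)"
proof -
  have "ppred (n + 2) (\<lambda>e x. R (e n) (e (Suc n)) x)"
    using pterm_shift[OF R[unfolded ppred_def], of n] unfolding ppred_def by simp
  then have "ppred (Suc (Suc n)) (\<lambda>e x. R (e n) (e (Suc n)) x)" by simp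
  then have "ppred (Suc n) (\<lambda>e x. R (e n) (v e x) x)"
    by (rule ppred_let[where P = "\<lambda>w e x. R (e n) w x", OF pterm_Suc[OF v]]) simp
  then show ?thesis
    by (rule ppred_let[where P = "\<lambda>w e x. R w (v e x) x", OF u]) (simp add: pterm_update[OF v])
qed

lemma pterm_Suc_of:
  assumes "pterm n f"
  shows "pterm n (\<lambda>e x. Suc (f e x))"
  using pterm_add[OF assms pterm_const[of n 1]] by simp

text \<open>Lookup in a fixed table is a finite disjunction whose length does not depend on the
  input.\<close>

lemma ppred_mem3:
  fixes A :: "(nat \<times> nat \<times> nat) set"
  assumes "finite A" "pterm n u" "pterm n v" "pterm n w"
  shows "ppred n (\<lambda>e x. (u e x, v e x, w e x) \<in> A)"
proof -
  have "ppred n (\<lambda>e x. \<exists>a\<in>A. u e x = fst a \<and> v e x = fst (snd a) \<and> w e x = snd (snd a))"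
    by (intro ppred_finite_ex ppred_conj ppred_eq pterm_const assms)
  then show ?thesis by (rule ppred_cong) force
qed

lemmas pterm_intros = pterm_const pterm_var pterm_add pterm_mult pterm_diff pterm_Suc_of pterm_length
  pterm_poly pterm_power pterm_if

lemmas ppred_intros = ppred_const ppred_disj ppred_conj ppred_not ppred_eq ppred_le ppred_less ppred_bit
  ppred_ex

section \<open>The reduction for a fixed machine and time bound\<close>

locale reduction =
  fixes M :: tm and trs :: "transition list" and c0 :: nat and p :: "nat poly"
  assumes tab: "tableau M trs c0"
begin

definition T :: "bool list \<Rightarrow> nat" where "T x = poly p (length x)"

definition base :: "bool list \<Rightarrow> nat" where "base x = 2 * T x + c0"

definition nvars :: "bool list \<Rightarrow> nat" where "nvars x = base x ^ 5"

definition nclauses :: "bool list \<Rightarrow> nat" where "nclauses x = base x ^ 6"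

definition lits :: "bool list \<Rightarrow> nat \<Rightarrow> nat \<Rightarrow> bool \<Rightarrow> bool" where
  "lits x = tableau.nlit M trs c0 x (T x)"

definition npos :: "bool list \<Rightarrow> nat" where "npos x = nvars x * slot_count (nclauses x)"

definition P :: "bool list \<Rightarrow> nat \<Rightarrow> bool" where "P x = slot_pos (nvars x) (nclauses x)"

definition Opt :: "bool list \<Rightarrow> nat \<Rightarrow> nat \<Rightarrow> bool" where
  "Opt x = slot_opt (nvars x) (nclauses x) (lits x)"

definition size :: "bool list \<Rightarrow> nat" where "size x = 10 * npos x + 5 * nclauses x + 10"

definition edge1 :: "nat \<Rightarrow> nat \<Rightarrow> bool list \<Rightarrow> bool" where
  "edge1 a b x \<longleftrightarrow> nforced (npos x) (nclauses x) (P x) (Opt x) a b"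

definition edge2 :: "nat \<Rightarrow> nat \<Rightarrow> bool list \<Rightarrow> bool" where
  "edge2 a b x \<longleftrightarrow> edge1 a b x \<or> noptional (npos x) (nclauses x) (P x) (Opt x) a b"

definition reduce :: "bool list \<Rightarrow> bool list" where
  "reduce x = replicate (size x) True @ [False] @
    concat (map (\<lambda>a. map (\<lambda>b. edge1 a b x \<or> edge1 b a x) [0..<size x]) [0..<size x]) @
    concat (map (\<lambda>a. map (\<lambda>b. edge2 a b x \<or> edge2 b a x) [0..<size x]) [0..<size x])"

lemma b_eq: "tableau.b c0 (T x) = base x"
  unfolding base_def tableau.b_def[OF tab] ..

lemma pterm_T: "pterm n (\<lambda>e. T)" unfolding T_def by (intro pterm_intros)

lemma pterm_base: "pterm n (\<lambda>e. base)" unfolding base_def by (intro pterm_intros pterm_T)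

lemma pterm_nvars: "pterm n (\<lambda>e. nvars)" unfolding nvars_def by (intro pterm_intros pterm_base)

lemma pterm_nclauses: "pterm n (\<lambda>e. nclauses)" unfolding nclauses_def by (intro pterm_intros pterm_base)

lemma pterm_slots: "pterm n (\<lambda>e x. slot_count (nclauses x))"
  unfolding slot_count_def by (intro pterm_intros pterm_nclauses)

lemma pterm_npos: "pterm n (\<lambda>e. npos)" unfolding npos_def by (intro pterm_intros pterm_nvars pterm_slots)

lemma pterm_size: "pterm n (\<lambda>e. size)"
  unfolding size_def by (intro pterm_intros pterm_npos pterm_nclauses)

lemma finite_tables: "finite (tableau.RD M trs)" "finite (tableau.WR M trs)" "finite (tableau.MV M trs)"
proof -
  let ?k = "Suc (tm_tapes M)"
  have "tableau.RD M trs \<subseteq> (\<lambda>(r, p). (r, p, tableau.reads trs r ! p)) ` ({..<length trs} \<times> {..<?k})"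
    "tableau.WR M trs \<subseteq> (\<lambda>(r, p). (r, p, fst (tableau.acts trs r ! p))) ` ({..<length trs} \<times> {..<?k})"
    "tableau.MV M trs \<subseteq> (\<lambda>(r, p). (r, p, nat (1 + head_offset (snd (tableau.acts trs r ! p))))) `
      ({..<length trs} \<times> {..<?k})"
    unfolding tableau.RD_def[OF tab] tableau.WR_def[OF tab] tableau.MV_def[OF tab] by auto
  then show "finite (tableau.RD M trs)" "finite (tableau.WR M trs)" "finite (tableau.MV M trs)"
    by (meson finite_SigmaI finite_imageI finite_lessThan finite_subset)+
qed

text \<open>The nested conditional is regrouped so that an input bit is only queried together with
  its range check, the form that \<open>ppred_bit\<close> provides.\<close>

lemma pterm_init:
  assumes "pterm n u" "pterm n v"
  shows "pterm n (\<lambda>e x. tableau.init M x (T x) (u e x) (v e x))"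
proof -
  have "pterm n (\<lambda>e x. if u e x = 0 then tm_start M else
      if u e x = 1 \<and> T x \<le> v e x \<and> (v e x - T x < length x \<and> x ! (v e x - T x)) then 2 else
      if u e x = 1 \<and> T x \<le> v e x \<and> v e x - T x < length x then 1 else 0)"
    by (intro pterm_intros ppred_intros pterm_T assms)
  moreover have "tableau.init M x (T x) a c = (if a = 0 then tm_start M else
      if a = 1 \<and> T x \<le> c \<and> (c - T x < length x \<and> x ! (c - T x)) then 2 else
      if a = 1 \<and> T x \<le> c \<and> c - T x < length x then 1 else 0)" for a c x
    unfolding tableau.init_def[OF tab] by simp
  ultimately show ?thesis by simp
qed

lemma ppred_lits: "ppred 2 (\<lambda>e x. lits x (e 0) (e 1) s)"
  unfolding lits_def tableau.nlit_def[OF tab] tableau.lit_rel_def[OF tab] b_eq vcode_def ccode_def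
  by (intro ppred_ex ppred_intros pterm_intros pterm_base pterm_T pterm_init ppred_mem3 finite_tables;
      simp)

lemma ppred_P: "ppred 1 (\<lambda>e x. P x (e 0))"
  unfolding P_def slot_pos_def
  by (intro ppred_ex ppred_intros pterm_intros pterm_nvars pterm_nclauses pterm_slots; simp)

lemma ppred_Opt: "ppred 2 (\<lambda>e x. Opt x (e 0) (e 1))"
  unfolding Opt_def slot_opt_def
  by (intro ppred_ex ppred_intros pterm_intros pterm_nvars pterm_slots
      ppred_subst2[where R = "\<lambda>a b x. lits x a b s" for s, OF ppred_lits]; simp)

lemma ppred_nhub: "ppred 1 (\<lambda>e x. nhub (npos x) (nclauses x) (Opt x) (e 0))"
  unfolding nhub_def
  by (intro ppred_ex ppred_intros pterm_intros pterm_npos pterm_nclauses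
      ppred_subst2[where R = "\<lambda>a b x. Opt x a b", OF ppred_Opt]; simp)

lemma ppred_nopt: "ppred 2 (\<lambda>e x. nopt (npos x) (nclauses x) (Opt x) (e 0) (e 1))"
  unfolding nopt_def
  by (intro ppred_ex ppred_intros pterm_intros pterm_npos pterm_nclauses
      ppred_subst2[where R = "\<lambda>a b x. Opt x a b", OF ppred_Opt]; simp)

lemma ppred_edge1: "ppred 2 (\<lambda>e x. edge1 (e 0) (e 1) x)"
  unfolding edge1_def nforced_def
  by (intro ppred_ex ppred_intros pterm_intros pterm_npos
      ppred_subst1[where R = "\<lambda>a x. P x a", OF ppred_P]
      ppred_subst1[where R = "\<lambda>a x. nhub (npos x) (nclauses x) (Opt x) a", OF ppred_nhub]; simp)

lemma ppred_edge2: "ppred 2 (\<lambda>e x. edge2 (e 0) (e 1) x)"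
  unfolding edge2_def noptional_def
  by (intro ppred_ex ppred_intros pterm_intros pterm_npos ppred_edge1
      ppred_subst1[where R = "\<lambda>a x. P x a", OF ppred_P]
      ppred_subst1[where R = "\<lambda>a x. nhub (npos x) (nclauses x) (Opt x) a", OF ppred_nhub]
      ppred_subst2[where R = "\<lambda>a b x. nopt (npos x) (nclauses x) (Opt x) a b", OF ppred_nopt]; simp)

lemma poly_time_reduce: "poly_time_computable reduce"
proof -
  have sym: "ppred 2 (\<lambda>e x. R (e 0) (e 1) x \<or> R (e 1) (e 0) x)"
    if "ppred 2 (\<lambda>e x. R (e 0) (e 1) x)" for R
    using ppred_disj[OF that ppred_subst2[OF that pterm_var[of 1 2] pterm_var[of 0 2]]] by simp
  show ?thesis
    unfolding reduce_def[abs_def]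
    using poly_time_computable_encoding[OF pterm_size sym[OF ppred_edge1] sym[OF ppred_edge2]] .
qed

lemma reduce_correct:
  "reduce x \<in> Even_Hole_Free_Sandwich_Problem \<longleftrightarrow> (\<exists>t\<le>T x. accepts_in M x t)"
proof -
  interpret tableau M trs c0 x "T x" by (rule tab)
  interpret cnf "nvars x" "nclauses x" "lits x" unfolding lits_def by (rule cnf_nlit)
  have vc: "vertex_count = size x" unfolding vertex_count_def size_def npos_def ..
  have "reduce x = encode_instance vertex_count ((`) code ` E1) ((`) code ` E2)"
    unfolding encode_code unfolding vc reduce_def edge1_def edge2_def P_def Opt_def npos_def ..
  then have "reduce x \<in> Even_Hole_Free_Sandwich_Problem \<longleftrightarrow> has_even_hole_free_sandwich verts E1 E2"
    using encode_instance_in_problem_iff[OF sandwich_code(1)] sandwich_code(2) by simp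
  also have "\<dots> \<longleftrightarrow> cnf_sat (nvars x) (nclauses x) (lits x)" by (rule sandwich_iff_sat)
  also have "\<dots> \<longleftrightarrow> (\<exists>t\<le>T x. accepts_in M x t)"
    unfolding nvars_def nclauses_def lits_def b_eq[symmetric] cnf_sat_iff_tab_sat
    by (rule tab_sat_iff_accepts)
  finally show ?thesis .
qed

end

lemma ex_tableau:
  assumes wf: "wf_tm M"
  shows "\<exists>trs c0. tableau M trs c0"
proof -
  have "finite (tm_trans M)" using wf unfolding wf_tm_def by simp
  then obtain trs where trs: "set trs = tm_trans M" using finite_list by blast
  let ?A = "(\<Union>(q, rs, q', as)\<in>set trs. {q, q'} \<union> set rs \<union> fst ` set as) \<union>
    {length trs, Suc (tm_tapes M), tm_start M, tm_final M, 11}"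
  have "finite ?A" by auto
  then obtain c where "\<forall>a\<in>?A. a < c" using finite_nat_set_iff_bounded by blast
  then have c: "a < c" if "a \<in> ?A" for a using that by blast
  have "tableau M trs c"
  proof
    fix q rs q' as assume i: "(q, rs, q', as) \<in> set trs"
    have "a < c" if "a \<in> {q, q'} \<union> set rs \<union> fst ` set as" for a
      by (rule c) (use i that in blast)
    then show "q < c \<and> q' < c \<and> (\<forall>a\<in>set rs. a < c) \<and> (\<forall>a\<in>set as. fst a < c)" by blast
  next
    have "11 < c" by (rule c) blast
    then show "12 \<le> c" by simp
    show "length trs < c" "Suc (tm_tapes M) < c" "tm_start M < c" "tm_final M < c"
      by (rule c; blast)+
  qed (rule wf trs)+
  then show ?thesis by blast
qed

theorem theorem3:
  shows "NP_hard Even_Hole_Free_Sandwich_Problem"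
  unfolding NP_hard_def
proof
  fix L assume "L \<in> NP"
  then obtain M and p :: "nat poly" where wf: "wf_tm M"
    and yes: "\<And>x. x \<in> L \<Longrightarrow> \<exists>t\<le>poly p (length x). accepts_in M x t"
    and no: "\<And>x t. x \<notin> L \<Longrightarrow> \<not> accepts_in M x t"
    unfolding NP_def by blast
  obtain trs c0 where "tableau M trs c0" using ex_tableau[OF wf] by blast
  then interpret reduction M trs c0 p by (rule reduction.intro)
  have "x \<in> L \<longleftrightarrow> reduce x \<in> Even_Hole_Free_Sandwich_Problem" for x
    unfolding reduce_correct T_def using yes no by blast
  then show "poly_time_reducible L Even_Hole_Free_Sandwich_Problem"
    unfolding poly_time_reducible_def using poly_time_reduce by blast
qed

end
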